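(* Let $\mathcal S=X^*_e\ast_{J_+}X=\{((h,p,u,k),(p,g,q))\}$, which is identified with $X^*\ast_{J_-}X_e$ by $((h,p,u,k),(p,g,q))\leftrightarrow((h,p,u),(h,k,p,g,q))$. If the horizontal structure on $\mathcal S$ is the left action groupoid $X^*_e\ltimes X\rightrightarrows X$ and the vertical structure on $\mathcal S$ is the right action groupoid $X^*\rtimes X_e\rightrightarrows X^*$, then $(\mathcal S;X^*,X,\mathfrak h^* )$ is a double Lie groupoid.
   Context: Setting. $G$ is a connected, simply connected Lie group, $H\subset G$ a connected, simply connected Lie subgroup, $\mathfrak g,\mathfrak h$ their Lie algebras, $\iota:\mathfrak h\to\mathfrak g$ the inclusion. $\mathrm{Ad}^*_x,\mathrm{ad}^*_Y$ are the transposes of $\mathrm{Ad}_x,\mathrm{ad}_Y$. $R:\mathfrak g^*\to\mathfrak g$ is linear, skew-symmetric, such that $\kappa(A,B)=-[RA,RB]-R\,\mathrm{ad}^*_{RA}B+R\,\mathrm{ad}^*_{RB}A$ satisfies $\mathrm{ad}_Y\kappa(A,B)+\kappa(\mathrm{ad}^*_YA,B)+\kappa(A,\mathrm{ad}^*_YB)=0$ for $Y\in\mathfrak g$, and $R\,\mathrm{ad}^*_{\iota Z}+\mathrm{ad}_{\iota Z}R=0$ for $Z\in\mathfrak h$. Poisson Lie groups. $G$ with $\{f,g\}_G=\langle R(Df),Dg\rangle-\langle R(D'f),D'g\rangle$ ($\langle Df,Y\rangle=\frac{d}{dt}|_0f(e^{tY}x)$, $\langle D'f,Y\rangle=\frac{d}{dt}|_0f(xe^{tY})$)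 is a Poisson Lie group; $(G^*,\{\,,\,\}_* )$ is the connected, simply connected dual Poisson Lie group, with Lie algebra $\mathfrak g^*$, $[A,B]_*=\mathrm{ad}^*_{R(A)}B-\mathrm{ad}^*_{R(B)}A$. $\varphi^+$ is the right dressing action of $G$ on $G^*$ and $\varphi^-$ the left dressing action of $G^*$ on $G$, with generators $\lambda^+(Y)(u)=\frac{d}{dt}|_0\varphi^+_{e^{tY}}(u)$, $\lambda^-(A)(x)=\frac{d}{dt}|_0\varphi^-_{e^{tA}}(x)$ determined by $\{\phi,\psi\}_*(u)=-d\phi(u)\lambda^+(T_1l_u^*d\psi(u))(u)$, $\{f,g\}_G(x)=df(x)\lambda^-(T_1r_x^*dg(x))(x)$. They satisfy $\varphi^+_x(uv)=\varphi^+_{\varphi^-_v(x)}(u)\varphi^+_x(v)$, $\varphi^-_u(xy)=\varphi^-_u(x)\varphi^-_{\varphi^+_x(u)}(y)$, and $\varphi^-_u(h)=h$ for $h\in H$. $G$ is assumed complete, i.e. $\varphi^\pm$ are globally defined. $I^*:G^*\to\mathfrak h^*$ is the Lie group morphism integrating $\iota^*:\mathfrak g^*\to\mathfrak h^*$. Groupoids. Lie groupoids have target $\alpha$, source $\beta$, unit $\epsilon$; $(x,y)$ composable iff $\beta(x)=\alpha(y)$. $X=\mathfrak h^*\times G\times\mathfrak h^*$: $\alpha_X(p,g,q)=p$, $\beta_X(p,g,q)=q$, $(p,g,q)(q,g',r)=(p,gg',r)$. $X^*=H\times\mathfrak h^*\times G^*$: $\alpha_{X^*}(h,p,u)=\mathrm{Ad}^*_{h^{-1}}p+I^*(u)$,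 $\beta_{X^*}(h,p,u)=p$, $\epsilon(q)=(1,q,1)$, $(h,\alpha_{X^*}(k,q,v),u)\cdot(k,q,v)=(hk,q,u\varphi^+_{h^{-1}}(v))$. $X^*_e=X^*\times H\rightrightarrows\mathfrak h^*$ is the product groupoid; $X_e=(H\times H)\times X\rightrightarrows H\times\mathfrak h^*$ is the product with the coarse groupoid $H\times H$ ($\alpha(h,k,p,g,q)=(h,p)$, $\beta(h,k,p,g,q)=(k,q)$). Actions. $X^*_e$ acts on $X$ from the left with moment map $J_+=\alpha_X$ by $\Psi^-_{(h,p,u,k)}(p,g,q)=(\mathrm{Ad}^*_{h^{-1}}p+I^*(u),\varphi^-_u(hgk^{-1}),\mathrm{Ad}^*_{k^{-1}}q+I^*(\varphi^+_{hgk^{-1}}(u)))$; $X_e$ acts on $X^*$ from the right with moment map $J_-(h,p,u)=(h,p)$ by $\Psi^+_{(h,k,p,g,q)}(h,p,u)=(k,q,\varphi^+_{hgk^{-1}}(u))$. Here $X^*_e\ast_{J_+}X$ (resp. $X^*\ast_{J_-}X_e$) is the set of pairs $(x,s)$ with $\beta(x)=J_+(s)$ (resp. $(s,y)$ with $J_-(s)=\alpha(y)$). The left action groupoid $X^*_e\ltimes X\rightrightarrows X$ has target $(x,s)\mapsto\Psi^-_x(s)$, source $(x,s)\mapsto s$, multiplication $(x_1,\Psi^-_{x_2}(s))\cdot(x_2,s)=(x_1x_2,s)$. The right action groupoid $X^*\rtimes X_e\rightrightarrows X^*$ has target $(s,y)\mapsto s$, source $(s,y)\mapsto\Psi^+_y(s)$,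 multiplication $(s,y_1)\cdot(\Psi^+_{y_1}(s),y_2)=(s,y_1y_2)$. Double Lie groupoid. A quadruple $(\mathcal S;\mathcal H,\mathcal V,B)$ where $\mathcal H,\mathcal V$ are Lie groupoids over $B$ and $\mathcal S$ is equipped with two Lie groupoid structures, a horizontal one with base $\mathcal V$ and a vertical one with base $\mathcal H$, such that the structure maps (source, target, multiplication, unit section, inversion) of each groupoid structure on $\mathcal S$ are morphisms with respect to the other. *)

theory Defs
  imports "HOL-Analysis.Analysis" "HOL-Algebra.Group"
begin

section \<open>Finite-dimensional real normed spaces\<close>

text \<open>Unlike the class \<open>euclidean_space\<close>, this class also admits zero-dimensional spaces, so that
  for instance the trivial Lie subgroup is not excluded.\<close>

class finite_dim_normed = real_normed_vector +
  assumes finite_spanning_set: "\<exists>B. finite B \<and> (\<forall>x. \<exists>c. x = (\<Sum>b\<in>B. c b *\<^sub>R b))"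

lemma finite_dim_iff:
  "(\<exists>B::'a::real_vector set. finite B \<and> (\<forall>x. \<exists>c. x = (\<Sum>b\<in>B. c b *\<^sub>R b))) \<longleftrightarrow>
   (\<exists>B::'a set. finite B \<and> span B = UNIV)"
proof -
  have "(\<forall>x. \<exists>c. x = (\<Sum>b\<in>B. c b *\<^sub>R b)) \<longleftrightarrow> span B = UNIV" if "finite B" for B :: "'a set"
    unfolding span_finite[OF that] by (auto simp: image_def set_eq_iff)
  then show ?thesis by blast
qed

lemma finite_dim: "\<exists>B::'a::finite_dim_normed set. finite B \<and> span B = UNIV"
  using finite_spanning_set by (simp only: finite_dim_iff)

instance real :: finite_dim_normed
proof
  have "x \<in> span {1::real}" for x
    using span_scale[OF span_base[of "1::real" "{1}"], of x] by simp
  then have "span {1::real} = UNIV" by auto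
  then have "\<exists>B::real set. finite B \<and> span B = UNIV" by (intro exI[of _ "{1}"]) simp
  then show "\<exists>B::real set. finite B \<and> (\<forall>x. \<exists>c. x = (\<Sum>b\<in>B. c b *\<^sub>R b))"
    by (simp only: finite_dim_iff)
qed

instance prod :: (finite_dim_normed, finite_dim_normed) finite_dim_normed
proof
  obtain A :: "'a set" where A: "finite A" "span A = UNIV" using finite_dim by blast
  obtain B :: "'b set" where B: "finite B" "span B = UNIV" using finite_dim by blast
  let ?C = "(\<lambda>a. (a, 0::'b)) ` A \<union> (\<lambda>b. (0::'a, b)) ` B"
  have lin1: "linear (\<lambda>a::'a. (a, 0::'b))" and lin2: "linear (\<lambda>b::'b. (0::'a, b))"
    by (auto intro!: linearI)
  have "x \<in> span ?C" for x :: "'a \<times> 'b"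
  proof -
    have "(fst x, 0) \<in> span ((\<lambda>a. (a, 0::'b)) ` A)"
      unfolding linear_span_image[OF lin1] A(2) by (rule rangeI)
    then have "(fst x, 0) \<in> span ?C" by (rule subsetD[OF span_mono[OF Un_upper1]])
    have "(0, snd x) \<in> span ((\<lambda>b. (0::'a, b)) ` B)"
      unfolding linear_span_image[OF lin2] B(2) by (rule rangeI)
    then have "(0, snd x) \<in> span ?C" by (rule subsetD[OF span_mono[OF Un_upper2]])
    with \<open>(fst x, 0) \<in> span ?C\<close> have "(fst x, 0) + (0, snd x) \<in> span ?C" by (rule span_add)
    then show ?thesis by simp
  qed
  then have "span ?C = UNIV" by auto
  moreover have "finite ?C" using A(1) B(1) by simp
  ultimately have "\<exists>C::('a \<times> 'b) set. finite C \<and> span C = UNIV" by (intro exI[of _ ?C] conjI)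
  then show "\<exists>C::('a \<times> 'b) set. finite C \<and> (\<forall>x. \<exists>c. x = (\<Sum>b\<in>C. c b *\<^sub>R b))"
    by (simp only: finite_dim_iff)
qed

lemma finite_dim_subspace:
  fixes W :: "'a::finite_dim_normed set"
  assumes "subspace W"
  shows "\<exists>B. finite B \<and> B \<subseteq> W \<and> span B = W"
proof -
  obtain A :: "'a set" where A: "finite A" "span A = UNIV" using finite_dim by blast
  obtain B where B: "B \<subseteq> W" "independent B" "W \<subseteq> span B"
    by (rule basis_exists[of W])
  have "B \<subseteq> span A" unfolding A(2) by (rule subset_UNIV)
  then have "finite B" by (rule conjunct1[OF independent_span_bound[OF A(1) B(2)]])
  moreover have "span B = W"
    by (rule subset_antisym[OF span_minimal[OF B(1) assms] B(3)])
  ultimately show ?thesis using B(1) by (intro exI[of _ B] conjI)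
qed

lemma blinfun_finite_dim_on:
  fixes B :: "'a::real_normed_vector set"
  assumes "finite B"
  shows "\<exists>C :: ('a \<Rightarrow>\<^sub>L 'b::finite_dim_normed) set. finite C \<and>
    (\<forall>f. \<exists>c\<in>span C. \<forall>b\<in>B. blinfun_apply f b = blinfun_apply c b)"
  using assms
proof (induction B)
  case empty
  then show ?case by (intro exI[of _ "{}"]) auto
next
  case (insert b B)
  from insert.IH obtain C :: "('a \<Rightarrow>\<^sub>L 'b) set" where C: "finite C"
    "\<And>f. \<exists>c\<in>span C. \<forall>b\<in>B. blinfun_apply f b = blinfun_apply c b" by (elim exE conjE) simp
  define K where "K = {f :: 'a \<Rightarrow>\<^sub>L 'b. \<forall>x\<in>B. blinfun_apply f x = 0}"
  have K: "subspace K"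
    by (auto simp: K_def subspace_def blinfun.add_left blinfun.scaleR_left)
  have lin: "linear (\<lambda>f::'a \<Rightarrow>\<^sub>L 'b. blinfun_apply f b)"
    by (auto intro!: linearI simp: blinfun.add_left blinfun.scaleR_left)
  have "subspace ((\<lambda>f. blinfun_apply f b) ` K)"
    by (rule linear_subspace_image[OF lin K])
  from finite_dim_subspace[OF this] obtain E where E: "finite E"
    "E \<subseteq> (\<lambda>f. blinfun_apply f b) ` K" "span E = (\<lambda>f. blinfun_apply f b) ` K" by (elim exE conjE)
  from finite_subset_image[OF E(1,2)] obtain D where D: "D \<subseteq> K" "finite D"
    "E = (\<lambda>f. blinfun_apply f b) ` D" by (elim exE conjE)
  have "\<exists>c\<in>span (C \<union> D). \<forall>x\<in>insert b B. blinfun_apply f x = blinfun_apply c x" for f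
  proof -
    from C(2)[of f] obtain c where c: "c \<in> span C" "\<forall>x\<in>B. blinfun_apply f x = blinfun_apply c x"
      by (elim bexE)
    have "f - c \<in> K" using c(2) by (simp add: K_def blinfun.diff_left)
    then have "blinfun_apply (f - c) b \<in> span E" unfolding E(3) by (rule imageI)
    then have "blinfun_apply (f - c) b \<in> (\<lambda>f. blinfun_apply f b) ` span D"
      unfolding D(3) linear_span_image[OF lin] .
    then obtain d where d: "d \<in> span D" "blinfun_apply (f - c) b = blinfun_apply d b"
      by (elim imageE)
    have "d \<in> K" using span_minimal[OF D(1) K] d(1) by (rule subsetD)
    then have "\<forall>x\<in>insert b B. blinfun_apply f x = blinfun_apply (c + d) x"
      using c(2) d(2) by (simp add: K_def blinfun.add_left blinfun.diff_left algebra_simps)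
    moreover have "c + d \<in> span (C \<union> D)"
      by (rule span_add; rule subsetD[OF span_mono]) (use c(1) d(1) in auto)
    ultimately show ?thesis by (intro bexI)
  qed
  moreover have "finite (C \<union> D)" using C(1) D(2) by simp
  ultimately show ?case by (intro exI[of _ "C \<union> D"] conjI allI)
qed

instance blinfun :: (finite_dim_normed, finite_dim_normed) finite_dim_normed
proof
  obtain A :: "'a set" where A: "finite A" "span A = UNIV" using finite_dim by blast
  obtain C :: "('a \<Rightarrow>\<^sub>L 'b) set" where C: "finite C"
    "\<And>f. \<exists>c\<in>span C. \<forall>b\<in>A. blinfun_apply f b = blinfun_apply c b"
    using blinfun_finite_dim_on[OF A(1), where 'b='b] by (elim exE conjE) simp
  have "f \<in> span C" for f
  proof -
    from C(2)[of f] obtain c where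
      c: "c \<in> span C" "\<forall>b\<in>A. blinfun_apply f b = blinfun_apply c b" by (elim bexE)
    have lin: "linear (blinfun_apply g)" for g :: "'a \<Rightarrow>\<^sub>L 'b"
      using blinfun.bounded_linear_right by (rule bounded_linear.linear)
    have "blinfun_apply f x = blinfun_apply c x" for x
    proof (rule linear_eq_on_span[OF lin lin])
      show "blinfun_apply f b = blinfun_apply c b" if "b \<in> A" for b using c that by blast
      show "x \<in> span A" using A by simp
    qed
    then have "f = c" by (rule blinfun_eqI)
    then show ?thesis using c by simp
  qed
  then have "span C = UNIV" by auto
  then have "\<exists>B::('a \<Rightarrow>\<^sub>L 'b) set. finite B \<and> span B = UNIV" using C(1) by (intro exI[of _ C] conjI)
  then show "\<exists>B::('a \<Rightarrow>\<^sub>L 'b) set. finite B \<and> (\<forall>x. \<exists>c. x = (\<Sum>b\<in>B. c b *\<^sub>R b))"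
    by (simp only: finite_dim_iff)
qed

text \<open>The dual of the space \<open>'v\<close> is \<open>'v \<Rightarrow>\<^sub>L real\<close>; in finite dimension every linear functional is
  bounded. The transpose of a linear map:\<close>

definition dual_map :: "('w::finite_dim_normed \<Rightarrow> 'v::finite_dim_normed) \<Rightarrow>
    ('v \<Rightarrow>\<^sub>L real) \<Rightarrow> ('w \<Rightarrow>\<^sub>L real)" where
  "dual_map T A = Blinfun (\<lambda>z. blinfun_apply A (T z))"

section \<open>Smooth manifolds\<close>

text \<open>The predicates \<open>C_k\<close> and \<open>C_infinity\<close> are only applied to open sets \<open>U\<close>.\<close>

primrec C_k :: "nat \<Rightarrow> 'a::finite_dim_normed set \<Rightarrow> ('a \<Rightarrow> 'b::finite_dim_normed) \<Rightarrow> bool" where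
  "C_k 0 U f \<longleftrightarrow> continuous_on U f"
| "C_k (Suc n) U f \<longleftrightarrow> (\<forall>x\<in>U. f differentiable (at x)) \<and>
     (\<forall>v. C_k n U (\<lambda>x. frechet_derivative f (at x) v))"

definition C_infinity :: "'a::finite_dim_normed set \<Rightarrow> ('a \<Rightarrow> 'b::finite_dim_normed) \<Rightarrow> bool" where
  "C_infinity U f \<longleftrightarrow> (\<forall>n. C_k n U f)"

text \<open>An atlas is a set of charts, given by their domain and coordinate map; the latter matters only
  on the domain. The topology of the manifold is the one induced by the atlas, so that a Lie subgroup
  may be a subset of the ambient group with a finer topology.\<close>

type_synonym ('p, 'e) atlas = "('p set \<times> ('p \<Rightarrow> 'e)) set"

definition points :: "('p, 'e) atlas \<Rightarrow> 'p set" where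
  "points A = (\<Union>(U, \<phi>)\<in>A. U)"

definition atlas_topology :: "('p, 'e::finite_dim_normed) atlas \<Rightarrow> 'p topology" where
  "atlas_topology A =
     topology (\<lambda>W. W \<subseteq> points A \<and> (\<forall>(U, \<phi>)\<in>A. open (\<phi> ` (U \<inter> W))))"

definition smooth_manifold :: "('p, 'e::finite_dim_normed) atlas \<Rightarrow> bool" where
  "smooth_manifold A \<longleftrightarrow>
     (\<forall>(U, \<phi>)\<in>A. inj_on \<phi> U \<and> open (\<phi> ` U)) \<and>
     (\<forall>(U, \<phi>)\<in>A. \<forall>(V, \<psi>)\<in>A.
        open (\<phi> ` (U \<inter> V)) \<and> C_infinity (\<phi> ` (U \<inter> V)) (\<psi> \<circ> inv_into U \<phi>)) \<and>
     Hausdorff_space (atlas_topology A) \<and> second_countable (atlas_topology A)"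

definition smooth_map :: "('p, 'e::finite_dim_normed) atlas \<Rightarrow> ('q, 'f::finite_dim_normed) atlas \<Rightarrow>
    ('p \<Rightarrow> 'q) \<Rightarrow> bool" where
  "smooth_map A B f \<longleftrightarrow> f ` points A \<subseteq> points B \<and>
     (\<forall>(U, \<phi>)\<in>A. \<forall>(V, \<psi>)\<in>B.
        open (\<phi> ` (U \<inter> f -` V)) \<and> C_infinity (\<phi> ` (U \<inter> f -` V)) (\<psi> \<circ> f \<circ> inv_into U \<phi>))"

definition submersion :: "('p, 'e::finite_dim_normed) atlas \<Rightarrow> ('q, 'f::finite_dim_normed) atlas \<Rightarrow>
    ('p \<Rightarrow> 'q) \<Rightarrow> bool" where
  "submersion A B f \<longleftrightarrow> smooth_map A B f \<and>
     (\<forall>(U, \<phi>)\<in>A. \<forall>(V, \<psi>)\<in>B. \<forall>x\<in>U \<inter> f -` V.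
        surj (frechet_derivative (\<psi> \<circ> f \<circ> inv_into U \<phi>) (at (\<phi> x))))"

definition immersion :: "('p, 'e::finite_dim_normed) atlas \<Rightarrow> ('q, 'f::finite_dim_normed) atlas \<Rightarrow>
    ('p \<Rightarrow> 'q) \<Rightarrow> bool" where
  "immersion A B f \<longleftrightarrow> smooth_map A B f \<and>
     (\<forall>(U, \<phi>)\<in>A. \<forall>(V, \<psi>)\<in>B. \<forall>x\<in>U \<inter> f -` V.
        inj (frechet_derivative (\<psi> \<circ> f \<circ> inv_into U \<phi>) (at (\<phi> x))))"

definition restrict_atlas :: "('p, 'e) atlas \<Rightarrow> 'p set \<Rightarrow> ('p, 'e) atlas" where
  "restrict_atlas A W = {(U \<inter> W, \<phi>) | U \<phi>. (U, \<phi>) \<in> A}"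

text \<open>Smoothness on a subset \<open>P\<close> of a manifold means having smooth extensions near every point of
  \<open>P\<close>. If \<open>P\<close> is an embedded submanifold, such as the set of composable pairs of a Lie groupoid, this
  is smoothness for the submanifold structure of \<open>P\<close>.\<close>

definition smooth_map_on :: "('p, 'e::finite_dim_normed) atlas \<Rightarrow> ('q, 'f::finite_dim_normed) atlas \<Rightarrow>
    'p set \<Rightarrow> ('p \<Rightarrow> 'q) \<Rightarrow> bool" where
  "smooth_map_on A B P f \<longleftrightarrow> P \<subseteq> points A \<and> f ` P \<subseteq> points B \<and>
     (\<forall>x\<in>P. \<exists>W F. openin (atlas_topology A) W \<and> x \<in> W \<and>
        smooth_map (restrict_atlas A W) B F \<and> (\<forall>y\<in>P \<inter> W. F y = f y))"

definition vec_atlas :: "('e::finite_dim_normed, 'e) atlas" where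
  "vec_atlas = {(UNIV, \<lambda>x. x)}"

definition prod_atlas :: "('p, 'e) atlas \<Rightarrow> ('q, 'f) atlas \<Rightarrow> ('p \<times> 'q, 'e \<times> 'f) atlas" where
  "prod_atlas A B = {(U \<times> V, map_prod \<phi> \<psi>) | U \<phi> V \<psi>. (U, \<phi>) \<in> A \<and> (V, \<psi>) \<in> B}"

text \<open>The structure on \<open>S\<close> for which a given bijection \<open>f\<close> from \<open>S\<close> to a manifold is a
  diffeomorphism.\<close>

definition pullback_atlas :: "('s \<Rightarrow> 'p) \<Rightarrow> 's set \<Rightarrow> ('p, 'e) atlas \<Rightarrow> ('s, 'e) atlas" where
  "pullback_atlas f S A = {(S \<inter> f -` U, \<phi> \<circ> f) | U \<phi>. (U, \<phi>) \<in> A}"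

definition C_inf :: "('p, 'e::finite_dim_normed) atlas \<Rightarrow> ('p \<Rightarrow> real) set" where
  "C_inf A = {f. smooth_map A vec_atlas f}"

text \<open>\<open>\<gamma>\<close> and \<open>\<delta>\<close> have the same initial point and the same tangent vector at time 0.\<close>

definition same_velocity :: "('p, 'e::finite_dim_normed) atlas \<Rightarrow> (real \<Rightarrow> 'p) \<Rightarrow> (real \<Rightarrow> 'p) \<Rightarrow> bool" where
  "same_velocity A \<gamma> \<delta> \<longleftrightarrow> \<gamma> 0 = \<delta> 0 \<and>
     (\<forall>(U, \<phi>)\<in>A. \<gamma> 0 \<in> U \<longrightarrow>
        (\<exists>v. ((\<phi> \<circ> \<gamma>) has_vector_derivative v) (at 0) \<and>
             ((\<phi> \<circ> \<delta>) has_vector_derivative v) (at 0)))"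

definition simply_connected_space :: "'p topology \<Rightarrow> bool" where
  "simply_connected_space X \<longleftrightarrow> path_connected_space X \<and>
     (\<forall>\<gamma>. pathin X \<gamma> \<and> \<gamma> 0 = \<gamma> 1 \<longrightarrow>
        homotopic_with (\<lambda>\<delta>. \<delta> 0 = \<gamma> 0 \<and> \<delta> 1 = \<gamma> 0) (top_of_set {0..1}) X \<gamma> (\<lambda>t. \<gamma> 0))"

section \<open>Lie groups\<close>

record ('a, 'e) liegrp = "'a monoid" +
  atlas :: "('a, 'e) atlas"

definition lie_group :: "('a, 'e::finite_dim_normed) liegrp \<Rightarrow> bool" where
  "lie_group G \<longleftrightarrow> group G \<and> smooth_manifold (atlas G) \<and> points (atlas G) = carrier G \<and>
     smooth_map (prod_atlas (atlas G) (atlas G)) (atlas G) (\<lambda>(x, y). x \<otimes>\<^bsub>G\<^esub> y) \<and>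
     smooth_map (atlas G) (atlas G) (\<lambda>x. inv\<^bsub>G\<^esub> x)"

definition connected_simply_connected :: "('a, 'e::finite_dim_normed) liegrp \<Rightarrow> bool" where
  "connected_simply_connected G \<longleftrightarrow>
     connected_space (atlas_topology (atlas G)) \<and> simply_connected_space (atlas_topology (atlas G))"

definition lie_subgroup :: "('a, 'w::finite_dim_normed) liegrp \<Rightarrow> ('a, 'v::finite_dim_normed) liegrp \<Rightarrow> bool" where
  "lie_subgroup H G \<longleftrightarrow> lie_group H \<and> subgroup (carrier H) G \<and> \<one>\<^bsub>H\<^esub> = \<one>\<^bsub>G\<^esub> \<and>
     (\<forall>x\<in>carrier H. \<forall>y\<in>carrier H. x \<otimes>\<^bsub>H\<^esub> y = x \<otimes>\<^bsub>G\<^esub> y) \<and>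
     immersion (atlas H) (atlas G) (\<lambda>x. x)"

text \<open>The Lie algebra of \<open>G\<close> is the space \<open>'v\<close> together with the exponential map \<open>e\<close>: the vector
  \<open>Y\<close> stands for the velocity at time 0 of the one-parameter subgroup \<open>t \<mapsto> e (t *\<^sub>R Y)\<close>. The last
  condition says that this identifies \<open>'v\<close> with the tangent space at the unit.\<close>

definition exponential :: "('a, 'v::finite_dim_normed) liegrp \<Rightarrow> ('v \<Rightarrow> 'a) \<Rightarrow> bool" where
  "exponential G e \<longleftrightarrow> smooth_map vec_atlas (atlas G) e \<and>
     (\<forall>Y s t. e ((s + t) *\<^sub>R Y) = e (s *\<^sub>R Y) \<otimes>\<^bsub>G\<^esub> e (t *\<^sub>R Y)) \<and>
     (\<forall>(U, \<phi>)\<in>atlas G. \<one>\<^bsub>G\<^esub> \<in> U \<longrightarrow> bij (frechet_derivative (\<phi> \<circ> e) (at 0)))"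

definition Ad :: "('a, 'v::finite_dim_normed) liegrp \<Rightarrow> ('v \<Rightarrow> 'a) \<Rightarrow> 'a \<Rightarrow> 'v \<Rightarrow> 'v" where
  "Ad G e x Y = (THE Z. same_velocity (atlas G)
     (\<lambda>t. x \<otimes>\<^bsub>G\<^esub> e (t *\<^sub>R Y) \<otimes>\<^bsub>G\<^esub> inv\<^bsub>G\<^esub> x) (\<lambda>t. e (t *\<^sub>R Z)))"

text \<open>\<open>ad G e Y Z\<close> is also the Lie bracket \<open>[Y, Z]\<close>.\<close>

definition ad :: "('a, 'v::finite_dim_normed) liegrp \<Rightarrow> ('v \<Rightarrow> 'a) \<Rightarrow> 'v \<Rightarrow> 'v \<Rightarrow> 'v" where
  "ad G e Y Z = vector_derivative (\<lambda>t. Ad G e (e (t *\<^sub>R Y)) Z) (at 0)"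

definition coAd :: "('a, 'v::finite_dim_normed) liegrp \<Rightarrow> ('v \<Rightarrow> 'a) \<Rightarrow> 'a \<Rightarrow> ('v \<Rightarrow>\<^sub>L real) \<Rightarrow> ('v \<Rightarrow>\<^sub>L real)" where
  "coAd G e x = dual_map (Ad G e x)"

definition coad :: "('a, 'v::finite_dim_normed) liegrp \<Rightarrow> ('v \<Rightarrow> 'a) \<Rightarrow> 'v \<Rightarrow> ('v \<Rightarrow>\<^sub>L real) \<Rightarrow> ('v \<Rightarrow>\<^sub>L real)" where
  "coad G e Y = dual_map (ad G e Y)"

section \<open>Poisson Lie groups and dressing actions\<close>

definition poisson_bracket :: "('p, 'e::finite_dim_normed) atlas \<Rightarrow>
    (('p \<Rightarrow> real) \<Rightarrow> ('p \<Rightarrow> real) \<Rightarrow> 'p \<Rightarrow> real) \<Rightarrow> bool" where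
  "poisson_bracket A P \<longleftrightarrow>
     (\<forall>f\<in>C_inf A. \<forall>g\<in>C_inf A. P f g \<in> C_inf A) \<and>
     (\<forall>f\<in>C_inf A. \<forall>g\<in>C_inf A. \<forall>h\<in>C_inf A. \<forall>x\<in>points A.
        (\<forall>a b. P (\<lambda>y. a * f y + b * g y) h x = a * P f h x + b * P g h x) \<and>
        P g f x = - P f g x \<and>
        P f (\<lambda>y. g y * h y) x = P f g x * h x + g x * P f h x \<and>
        P f (P g h) x + P g (P h f) x + P h (P f g) x = 0)"

text \<open>The second condition says that multiplication \<open>G \<times> G \<rightarrow> G\<close> is a Poisson map, with the product
  bracket \<open>{F, F'}(x, y) = {F(-, y), F'(-, y)}(x) + {F(x, -), F'(x, -)}(y)\<close> written out.\<close>

definition poisson_lie_group :: "('a, 'v::finite_dim_normed) liegrp \<Rightarrow>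
    (('a \<Rightarrow> real) \<Rightarrow> ('a \<Rightarrow> real) \<Rightarrow> 'a \<Rightarrow> real) \<Rightarrow> bool" where
  "poisson_lie_group G P \<longleftrightarrow> lie_group G \<and> poisson_bracket (atlas G) P \<and>
     (\<forall>f\<in>C_inf (atlas G). \<forall>g\<in>C_inf (atlas G). \<forall>x\<in>carrier G. \<forall>y\<in>carrier G.
        P f g (x \<otimes>\<^bsub>G\<^esub> y) =
          P (\<lambda>z. f (z \<otimes>\<^bsub>G\<^esub> y)) (\<lambda>z. g (z \<otimes>\<^bsub>G\<^esub> y)) x +
          P (\<lambda>z. f (x \<otimes>\<^bsub>G\<^esub> z)) (\<lambda>z. g (x \<otimes>\<^bsub>G\<^esub> z)) y)"

definition D_fun :: "('a, 'v::finite_dim_normed) liegrp \<Rightarrow> ('v \<Rightarrow> 'a) \<Rightarrow> ('a \<Rightarrow> real) \<Rightarrow> 'a \<Rightarrow> ('v \<Rightarrow>\<^sub>L real)" where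
  "D_fun G e f x = Blinfun (\<lambda>Y. deriv (\<lambda>t. f (e (t *\<^sub>R Y) \<otimes>\<^bsub>G\<^esub> x)) 0)"

definition D'_fun :: "('a, 'v::finite_dim_normed) liegrp \<Rightarrow> ('v \<Rightarrow> 'a) \<Rightarrow> ('a \<Rightarrow> real) \<Rightarrow> 'a \<Rightarrow> ('v \<Rightarrow>\<^sub>L real)" where
  "D'_fun G e f x = Blinfun (\<lambda>Y. deriv (\<lambda>t. f (x \<otimes>\<^bsub>G\<^esub> e (t *\<^sub>R Y))) 0)"

definition r_bracket :: "('a, 'v::finite_dim_normed) liegrp \<Rightarrow> ('v \<Rightarrow> 'a) \<Rightarrow> (('v \<Rightarrow>\<^sub>L real) \<Rightarrow> 'v) \<Rightarrow>
    ('a \<Rightarrow> real) \<Rightarrow> ('a \<Rightarrow> real) \<Rightarrow> 'a \<Rightarrow> real" where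
  "r_bracket G e R f g x =
     blinfun_apply (D_fun G e g x) (R (D_fun G e f x)) -
     blinfun_apply (D'_fun G e g x) (R (D'_fun G e f x))"

definition skew_map :: "(('v::finite_dim_normed \<Rightarrow>\<^sub>L real) \<Rightarrow> 'v) \<Rightarrow> bool" where
  "skew_map R \<longleftrightarrow> (\<forall>A B. blinfun_apply B (R A) = - blinfun_apply A (R B))"

definition kappa :: "('a, 'v::finite_dim_normed) liegrp \<Rightarrow> ('v \<Rightarrow> 'a) \<Rightarrow> (('v \<Rightarrow>\<^sub>L real) \<Rightarrow> 'v) \<Rightarrow>
    ('v \<Rightarrow>\<^sub>L real) \<Rightarrow> ('v \<Rightarrow>\<^sub>L real) \<Rightarrow> 'v" where
  "kappa G e R A B = - ad G e (R A) (R B) - R (coad G e (R A) B) + R (coad G e (R B) A)"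

text \<open>\<open>(Gs, Ps)\<close>, with Lie algebra \<open>'v \<Rightarrow>\<^sub>L real\<close> via \<open>es\<close>, is the connected, simply connected dual
  of \<open>(G, r_bracket G e R)\<close>. Its Lie bracket is \<open>[A, B]\<^sub>*\<close>, which is the linearization of
  \<open>r_bracket G e R\<close> at the unit, and the linearization of \<open>Ps\<close> at the unit is the Lie bracket of \<open>G\<close>;
  \<open>Y, Z :: 'v\<close> are the differentials of \<open>\<phi>, \<psi>\<close> at the unit, as elements of the bidual.\<close>

definition dual_poisson_lie_group :: "('a, 'v::finite_dim_normed) liegrp \<Rightarrow> ('v \<Rightarrow> 'a) \<Rightarrow>
    (('v \<Rightarrow>\<^sub>L real) \<Rightarrow> 'v) \<Rightarrow> ('d, 'v \<Rightarrow>\<^sub>L real) liegrp \<Rightarrow> (('v \<Rightarrow>\<^sub>L real) \<Rightarrow> 'd) \<Rightarrow>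
    (('d \<Rightarrow> real) \<Rightarrow> ('d \<Rightarrow> real) \<Rightarrow> 'd \<Rightarrow> real) \<Rightarrow> bool" where
  "dual_poisson_lie_group G e R Gs es Ps \<longleftrightarrow>
     poisson_lie_group Gs Ps \<and> connected_simply_connected Gs \<and> exponential Gs es \<and>
     (\<forall>A B. ad Gs es A B = coad G e (R A) B - coad G e (R B) A) \<and>
     (\<forall>\<phi>\<in>C_inf (atlas Gs). \<forall>\<psi>\<in>C_inf (atlas Gs). \<forall>Y Z.
        (\<forall>A. ((\<lambda>t. \<phi> (es (t *\<^sub>R A))) has_real_derivative blinfun_apply A Y) (at 0)) \<longrightarrow>
        (\<forall>A. ((\<lambda>t. \<psi> (es (t *\<^sub>R A))) has_real_derivative blinfun_apply A Z) (at 0)) \<longrightarrow>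
        (\<forall>A. ((\<lambda>t. Ps \<phi> \<psi> (es (t *\<^sub>R A))) has_real_derivative blinfun_apply A (ad G e Y Z)) (at 0)))"

text \<open>The generator \<open>\<lambda>\<^sup>+(Y)\<close> acts on \<open>\<phi>\<close> by differentiating \<open>\<phi> (dp (e (t *\<^sub>R Y)) u)\<close> at \<open>t = 0\<close>, and \<open>Y\<close>
  ranges over the element \<open>T\<^sub>1 l\<^sub>u\<^sup>* d\<psi>(u)\<close> of the bidual, identified with an element of \<open>'v\<close>.\<close>

definition right_dressing_action :: "('a, 'v::finite_dim_normed) liegrp \<Rightarrow> ('v \<Rightarrow> 'a) \<Rightarrow>
    ('d, 'v \<Rightarrow>\<^sub>L real) liegrp \<Rightarrow> (('v \<Rightarrow>\<^sub>L real) \<Rightarrow> 'd) \<Rightarrow>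
    (('d \<Rightarrow> real) \<Rightarrow> ('d \<Rightarrow> real) \<Rightarrow> 'd \<Rightarrow> real) \<Rightarrow> ('a \<Rightarrow> 'd \<Rightarrow> 'd) \<Rightarrow> bool" where
  "right_dressing_action G e Gs es Ps dp \<longleftrightarrow>
     smooth_map (prod_atlas (atlas G) (atlas Gs)) (atlas Gs) (\<lambda>(x, u). dp x u) \<and>
     (\<forall>u\<in>carrier Gs. dp \<one>\<^bsub>G\<^esub> u = u) \<and>
     (\<forall>x\<in>carrier G. \<forall>y\<in>carrier G. \<forall>u\<in>carrier Gs. dp (x \<otimes>\<^bsub>G\<^esub> y) u = dp y (dp x u)) \<and>
     (\<forall>\<phi>\<in>C_inf (atlas Gs). \<forall>\<psi>\<in>C_inf (atlas Gs). \<forall>u\<in>carrier Gs. \<forall>Y.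
        (\<forall>A. ((\<lambda>t. \<psi> (u \<otimes>\<^bsub>Gs\<^esub> es (t *\<^sub>R A))) has_real_derivative blinfun_apply A Y) (at 0)) \<longrightarrow>
        ((\<lambda>t. \<phi> (dp (e (t *\<^sub>R Y)) u)) has_real_derivative - Ps \<phi> \<psi> u) (at 0))"

text \<open>Here \<open>T\<^sub>1 r\<^sub>x\<^sup>* dg(x)\<close> is \<open>D_fun G e g x\<close>.\<close>

definition left_dressing_action :: "('a, 'v::finite_dim_normed) liegrp \<Rightarrow> ('v \<Rightarrow> 'a) \<Rightarrow>
    (('v \<Rightarrow>\<^sub>L real) \<Rightarrow> 'v) \<Rightarrow> ('d, 'v \<Rightarrow>\<^sub>L real) liegrp \<Rightarrow> (('v \<Rightarrow>\<^sub>L real) \<Rightarrow> 'd) \<Rightarrow>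
    ('d \<Rightarrow> 'a \<Rightarrow> 'a) \<Rightarrow> bool" where
  "left_dressing_action G e R Gs es dm \<longleftrightarrow>
     smooth_map (prod_atlas (atlas Gs) (atlas G)) (atlas G) (\<lambda>(u, x). dm u x) \<and>
     (\<forall>x\<in>carrier G. dm \<one>\<^bsub>Gs\<^esub> x = x) \<and>
     (\<forall>u\<in>carrier Gs. \<forall>v\<in>carrier Gs. \<forall>x\<in>carrier G. dm (u \<otimes>\<^bsub>Gs\<^esub> v) x = dm u (dm v x)) \<and>
     (\<forall>f\<in>C_inf (atlas G). \<forall>g\<in>C_inf (atlas G). \<forall>x\<in>carrier G.
        ((\<lambda>t. f (dm (es (t *\<^sub>R D_fun G e g x)) x)) has_real_derivative r_bracket G e R f g x) (at 0))"

section \<open>Lie groupoids\<close>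

text \<open>\<open>comp_arr x y\<close> is only meaningful if \<open>source x = target y\<close>.\<close>

record ('x, 'b) groupoid =
  arrows :: "'x set"
  objects :: "'b set"
  target :: "'x \<Rightarrow> 'b"
  source :: "'x \<Rightarrow> 'b"
  ident :: "'b \<Rightarrow> 'x"
  comp_arr :: "'x \<Rightarrow> 'x \<Rightarrow> 'x"

definition composable :: "('x, 'b) groupoid \<Rightarrow> ('x \<times> 'x) set" where
  "composable \<G> = {(x, y). x \<in> arrows \<G> \<and> y \<in> arrows \<G> \<and> source \<G> x = target \<G> y}"

definition is_inverse :: "('x, 'b) groupoid \<Rightarrow> 'x \<Rightarrow> 'x \<Rightarrow> bool" where
  "is_inverse \<G> x y \<longleftrightarrow> y \<in> arrows \<G> \<and> target \<G> y = source \<G> x \<and> source \<G> y = target \<G> x \<and>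
     comp_arr \<G> x y = ident \<G> (target \<G> x) \<and> comp_arr \<G> y x = ident \<G> (source \<G> x)"

definition is_groupoid :: "('x, 'b) groupoid \<Rightarrow> bool" where
  "is_groupoid \<G> \<longleftrightarrow>
     (\<forall>x\<in>arrows \<G>. target \<G> x \<in> objects \<G> \<and> source \<G> x \<in> objects \<G>) \<and>
     (\<forall>b\<in>objects \<G>. ident \<G> b \<in> arrows \<G> \<and> target \<G> (ident \<G> b) = b \<and> source \<G> (ident \<G> b) = b) \<and>
     (\<forall>(x, y)\<in>composable \<G>. comp_arr \<G> x y \<in> arrows \<G> \<and>
        target \<G> (comp_arr \<G> x y) = target \<G> x \<and> source \<G> (comp_arr \<G> x y) = source \<G> y) \<and>
     (\<forall>x y z. (x, y) \<in> composable \<G> \<and> (y, z) \<in> composable \<G> \<longrightarrow>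
        comp_arr \<G> (comp_arr \<G> x y) z = comp_arr \<G> x (comp_arr \<G> y z)) \<and>
     (\<forall>x\<in>arrows \<G>. comp_arr \<G> (ident \<G> (target \<G> x)) x = x \<and>
        comp_arr \<G> x (ident \<G> (source \<G> x)) = x) \<and>
     (\<forall>x\<in>arrows \<G>. \<exists>y. is_inverse \<G> x y)"

definition inv_arr :: "('x, 'b) groupoid \<Rightarrow> 'x \<Rightarrow> 'x" where
  "inv_arr \<G> x = (THE y. is_inverse \<G> x y)"

text \<open>\<open>A\<close> and \<open>B\<close> are the manifold structures on the arrows and on the objects.\<close>

definition lie_groupoid :: "('x, 'b) groupoid \<Rightarrow> ('x, 'e::finite_dim_normed) atlas \<Rightarrow>
    ('b, 'f::finite_dim_normed) atlas \<Rightarrow> bool" where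
  "lie_groupoid \<G> A B \<longleftrightarrow> is_groupoid \<G> \<and>
     smooth_manifold A \<and> points A = arrows \<G> \<and> smooth_manifold B \<and> points B = objects \<G> \<and>
     submersion A B (target \<G>) \<and> submersion A B (source \<G>) \<and>
     smooth_map B A (ident \<G>) \<and> smooth_map A A (inv_arr \<G>) \<and>
     smooth_map_on (prod_atlas A A) A (composable \<G>) (\<lambda>(x, y). comp_arr \<G> x y)"

text \<open>\<open>F\<close> is the map on arrows and \<open>f\<close> the map on objects. For the groupoids of composable pairs
  below, \<open>A\<close> and \<open>A0\<close> are manifold structures on ambient manifolds.\<close>

definition lie_groupoid_morphism ::
   "('x, 'b) groupoid \<Rightarrow> ('x, 'e::finite_dim_normed) atlas \<Rightarrow> ('b, 'f::finite_dim_normed) atlas \<Rightarrow>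
    ('y, 'c) groupoid \<Rightarrow> ('y, 'g::finite_dim_normed) atlas \<Rightarrow> ('c, 'h::finite_dim_normed) atlas \<Rightarrow>
    ('x \<Rightarrow> 'y) \<Rightarrow> ('b \<Rightarrow> 'c) \<Rightarrow> bool" where
  "lie_groupoid_morphism \<A> A A0 \<B> B B0 F f \<longleftrightarrow>
     smooth_map_on A B (arrows \<A>) F \<and> smooth_map_on A0 B0 (objects \<A>) f \<and>
     (\<forall>x\<in>arrows \<A>. F x \<in> arrows \<B> \<and>
        target \<B> (F x) = f (target \<A> x) \<and> source \<B> (F x) = f (source \<A> x)) \<and>
     (\<forall>b\<in>objects \<A>. f b \<in> objects \<B> \<and> F (ident \<A> b) = ident \<B> (f b)) \<and>
     (\<forall>(x, y)\<in>composable \<A>. F (comp_arr \<A> x y) = comp_arr \<B> (F x) (F y))"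

section \<open>Double Lie groupoids\<close>

text \<open>Let \<open>\<S>\<close> and \<open>\<T>\<close> be two groupoid structures on the same set, \<open>\<K>\<close> a groupoid on the objects of
  \<open>\<T>\<close>. The \<open>\<S>\<close>-composable pairs form a groupoid for \<open>\<T>\<close>, over the composable pairs of \<open>\<K>\<close>.\<close>

definition composable_groupoid :: "('s, 'x) groupoid \<Rightarrow> ('s, 'y) groupoid \<Rightarrow> ('y, 'b) groupoid \<Rightarrow>
    ('s \<times> 's, 'y \<times> 'y) groupoid" where
  "composable_groupoid \<S> \<T> \<K> =
     \<lparr>arrows = composable \<S>, objects = composable \<K>,
      target = map_prod (target \<T>) (target \<T>), source = map_prod (source \<T>) (source \<T>),
      ident = map_prod (ident \<T>) (ident \<T>),
      comp_arr = (\<lambda>(s, t) (s', t'). (comp_arr \<T> s s', comp_arr \<T> t t'))\<rparr>"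

text \<open>The structure maps of \<open>\<S>\<close> (with base \<open>\<L>\<close>) are morphisms with respect to \<open>\<T>\<close> (with base \<open>\<K>\<close>);
  each covers the corresponding structure map of \<open>\<K>\<close>.\<close>

definition structure_maps_morphisms ::
   "('s, 'x) groupoid \<Rightarrow> ('s, 'y) groupoid \<Rightarrow> ('y, 'b) groupoid \<Rightarrow> ('x, 'b) groupoid \<Rightarrow>
    ('s, 'e::finite_dim_normed) atlas \<Rightarrow> ('y, 'f::finite_dim_normed) atlas \<Rightarrow>
    ('x, 'g::finite_dim_normed) atlas \<Rightarrow> ('b, 'h::finite_dim_normed) atlas \<Rightarrow> bool" where
  "structure_maps_morphisms \<S> \<T> \<K> \<L> AS AK AL AB \<longleftrightarrow>
     lie_groupoid_morphism \<T> AS AK \<L> AL AB (source \<S>) (source \<K>) \<and>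
     lie_groupoid_morphism \<T> AS AK \<L> AL AB (target \<S>) (target \<K>) \<and>
     lie_groupoid_morphism (composable_groupoid \<S> \<T> \<K>) (prod_atlas AS AS) (prod_atlas AK AK)
       \<T> AS AK (\<lambda>(s, t). comp_arr \<S> s t) (\<lambda>(a, b). comp_arr \<K> a b) \<and>
     lie_groupoid_morphism \<L> AL AB \<T> AS AK (ident \<S>) (ident \<K>) \<and>
     lie_groupoid_morphism \<T> AS AK \<T> AS AK (inv_arr \<S>) (inv_arr \<K>)"

text \<open>\<open>Hor\<close> is the horizontal structure, with base \<open>\<V>\<close>, and \<open>Ver\<close> the vertical one, with base \<open>\<H>\<close>.\<close>

definition double_lie_groupoid ::
   "('s, 'x) groupoid \<Rightarrow> ('s, 'y) groupoid \<Rightarrow> ('y, 'b) groupoid \<Rightarrow> ('x, 'b) groupoid \<Rightarrow>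
    ('s, 'e::finite_dim_normed) atlas \<Rightarrow> ('y, 'f::finite_dim_normed) atlas \<Rightarrow>
    ('x, 'g::finite_dim_normed) atlas \<Rightarrow> ('b, 'h::finite_dim_normed) atlas \<Rightarrow> bool" where
  "double_lie_groupoid Hor Ver \<H> \<V> AS AH AV AB \<longleftrightarrow>
     lie_groupoid \<H> AH AB \<and> lie_groupoid \<V> AV AB \<and>
     lie_groupoid Hor AS AV \<and> lie_groupoid Ver AS AH \<and>
     structure_maps_morphisms Hor Ver \<H> \<V> AS AH AV AB \<and>
     structure_maps_morphisms Ver Hor \<V> \<H> AS AV AH AB"

section \<open>Action groupoids\<close>

definition left_action_groupoid :: "('x, 'b) groupoid \<Rightarrow> 'm set \<Rightarrow> ('m \<Rightarrow> 'b) \<Rightarrow> ('x \<Rightarrow> 'm \<Rightarrow> 'm) \<Rightarrow>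
    ('x \<times> 'm, 'm) groupoid" where
  "left_action_groupoid \<G> M J \<Psi> =
     \<lparr>arrows = {(x, s). x \<in> arrows \<G> \<and> s \<in> M \<and> source \<G> x = J s}, objects = M,
      target = (\<lambda>(x, s). \<Psi> x s), source = (\<lambda>(x, s). s),
      ident = (\<lambda>s. (ident \<G> (J s), s)),
      comp_arr = (\<lambda>(x1, s1) (x2, s2). (comp_arr \<G> x1 x2, s2))\<rparr>"

definition right_action_groupoid :: "('y, 'b) groupoid \<Rightarrow> 'm set \<Rightarrow> ('m \<Rightarrow> 'b) \<Rightarrow> ('m \<Rightarrow> 'y \<Rightarrow> 'm) \<Rightarrow>
    ('m \<times> 'y, 'm) groupoid" where
  "right_action_groupoid \<G> M J \<Psi> =
     \<lparr>arrows = {(s, y). s \<in> M \<and> y \<in> arrows \<G> \<and> J s = target \<G> y}, objects = M,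
      target = (\<lambda>(s, y). s), source = (\<lambda>(s, y). \<Psi> s y),
      ident = (\<lambda>s. (s, ident \<G> (J s))),
      comp_arr = (\<lambda>(s1, y1) (s2, y2). (s1, comp_arr \<G> y1 y2))\<rparr>"

text \<open>The groupoid structure on \<open>S\<close> for which a given bijection \<open>f\<close> from \<open>S\<close> to the arrows of \<open>\<G>\<close>
  is an isomorphism over the identity.\<close>

definition transport_groupoid :: "('s \<Rightarrow> 'x) \<Rightarrow> 's set \<Rightarrow> ('x, 'b) groupoid \<Rightarrow> ('s, 'b) groupoid" where
  "transport_groupoid f S \<G> =
     \<lparr>arrows = S, objects = objects \<G>,
      target = target \<G> \<circ> f, source = source \<G> \<circ> f,
      ident = inv_into S f \<circ> ident \<G>,
      comp_arr = (\<lambda>s t. inv_into S f (comp_arr \<G> (f s) (f t)))\<rparr>"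

section \<open>The groupoids \<open>X\<close>, \<open>X\<^sup>*\<close> and their actions\<close>

text \<open>\<open>eh\<close> is the exponential map of \<open>H\<close>, \<open>Is\<close> the map \<open>I\<^sup>*\<close>, \<open>dp\<close> and \<open>dm\<close> the actions \<open>\<phi>\<^sup>+\<close> and \<open>\<phi>\<^sup>-\<close>.\<close>

definition X_groupoid :: "('a, 'v::finite_dim_normed) liegrp \<Rightarrow>
    (('w::finite_dim_normed \<Rightarrow>\<^sub>L real) \<times> 'a \<times> ('w \<Rightarrow>\<^sub>L real), 'w \<Rightarrow>\<^sub>L real) groupoid" where
  "X_groupoid G =
     \<lparr>arrows = UNIV \<times> carrier G \<times> UNIV, objects = UNIV,
      target = (\<lambda>(p, g, q). p), source = (\<lambda>(p, g, q). q),
      ident = (\<lambda>p. (p, \<one>\<^bsub>G\<^esub>, p)),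
      comp_arr = (\<lambda>(p, g, q) (q', g', r). (p, g \<otimes>\<^bsub>G\<^esub> g', r))\<rparr>"

definition X_atlas :: "('a, 'v::finite_dim_normed) liegrp \<Rightarrow>
    (('w::finite_dim_normed \<Rightarrow>\<^sub>L real) \<times> 'a \<times> ('w \<Rightarrow>\<^sub>L real), ('w \<Rightarrow>\<^sub>L real) \<times> 'v \<times> ('w \<Rightarrow>\<^sub>L real)) atlas" where
  "X_atlas G = prod_atlas vec_atlas (prod_atlas (atlas G) vec_atlas)"

definition Xs_groupoid :: "('a, 'w::finite_dim_normed) liegrp \<Rightarrow> ('w \<Rightarrow> 'a) \<Rightarrow> ('d, 'c) liegrp \<Rightarrow>
    ('d \<Rightarrow> ('w \<Rightarrow>\<^sub>L real)) \<Rightarrow> ('a \<Rightarrow> 'd \<Rightarrow> 'd) \<Rightarrow>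
    ('a \<times> ('w \<Rightarrow>\<^sub>L real) \<times> 'd, 'w \<Rightarrow>\<^sub>L real) groupoid" where
  "Xs_groupoid H eh Gs Is dp =
     \<lparr>arrows = carrier H \<times> UNIV \<times> carrier Gs, objects = UNIV,
      target = (\<lambda>(h, p, u). coAd H eh (inv\<^bsub>H\<^esub> h) p + Is u), source = (\<lambda>(h, p, u). p),
      ident = (\<lambda>q. (\<one>\<^bsub>H\<^esub>, q, \<one>\<^bsub>Gs\<^esub>)),
      comp_arr = (\<lambda>(h, p, u) (k, q, v). (h \<otimes>\<^bsub>H\<^esub> k, q, u \<otimes>\<^bsub>Gs\<^esub> dp (inv\<^bsub>H\<^esub> h) v))\<rparr>"

definition Xs_atlas :: "('a, 'w::finite_dim_normed) liegrp \<Rightarrow> ('d, 'c::finite_dim_normed) liegrp \<Rightarrow>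
    ('a \<times> ('w \<Rightarrow>\<^sub>L real) \<times> 'd, 'w \<times> ('w \<Rightarrow>\<^sub>L real) \<times> 'c) atlas" where
  "Xs_atlas H Gs = prod_atlas (atlas H) (prod_atlas vec_atlas (atlas Gs))"

text \<open>The product of a groupoid \<open>\<X>\<close> with the group \<open>H\<close>.\<close>

definition Xse_groupoid :: "('a, 'w) liegrp \<Rightarrow> ('a \<times> 'p \<times> 'd, 'p) groupoid \<Rightarrow>
    ('a \<times> 'p \<times> 'd \<times> 'a, 'p) groupoid" where
  "Xse_groupoid H \<X> =
     \<lparr>arrows = {(h, p, u, k). (h, p, u) \<in> arrows \<X> \<and> k \<in> carrier H}, objects = objects \<X>,
      target = (\<lambda>(h, p, u, k). target \<X> (h, p, u)), source = (\<lambda>(h, p, u, k). source \<X> (h, p, u)),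
      ident = (\<lambda>b. case ident \<X> b of (h, p, u) \<Rightarrow> (h, p, u, \<one>\<^bsub>H\<^esub>)),
      comp_arr = (\<lambda>(h, p, u, k) (h', p', u', k').
        case comp_arr \<X> (h, p, u) (h', p', u') of (h'', p'', u'') \<Rightarrow> (h'', p'', u'', k \<otimes>\<^bsub>H\<^esub> k'))\<rparr>"

text \<open>The product of the coarse groupoid on \<open>H\<close> with a groupoid \<open>\<X>\<close>.\<close>

definition Xe_groupoid :: "('a, 'w) liegrp \<Rightarrow> ('p \<times> 'a \<times> 'p, 'p) groupoid \<Rightarrow>
    ('a \<times> 'a \<times> 'p \<times> 'a \<times> 'p, 'a \<times> 'p) groupoid" where
  "Xe_groupoid H \<X> =
     \<lparr>arrows = carrier H \<times> carrier H \<times> arrows \<X>, objects = carrier H \<times> objects \<X>,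
      target = (\<lambda>(h, k, x). (h, target \<X> x)), source = (\<lambda>(h, k, x). (k, source \<X> x)),
      ident = (\<lambda>(h, b). (h, h, ident \<X> b)),
      comp_arr = (\<lambda>(h, k, x) (k', l, y). (h, l, comp_arr \<X> x y))\<rparr>"

definition Psi_minus :: "('a, 'v::finite_dim_normed) liegrp \<Rightarrow> ('a, 'w::finite_dim_normed) liegrp \<Rightarrow>
    ('w \<Rightarrow> 'a) \<Rightarrow> ('d \<Rightarrow> ('w \<Rightarrow>\<^sub>L real)) \<Rightarrow> ('a \<Rightarrow> 'd \<Rightarrow> 'd) \<Rightarrow> ('d \<Rightarrow> 'a \<Rightarrow> 'a) \<Rightarrow>
    'a \<times> ('w \<Rightarrow>\<^sub>L real) \<times> 'd \<times> 'a \<Rightarrow> ('w \<Rightarrow>\<^sub>L real) \<times> 'a \<times> ('w \<Rightarrow>\<^sub>L real) \<Rightarrow>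
    ('w \<Rightarrow>\<^sub>L real) \<times> 'a \<times> ('w \<Rightarrow>\<^sub>L real)" where
  "Psi_minus G H eh Is dp dm = (\<lambda>(h, p, u, k) (p', g, q).
     (coAd H eh (inv\<^bsub>H\<^esub> h) p + Is u,
      dm u (h \<otimes>\<^bsub>G\<^esub> g \<otimes>\<^bsub>G\<^esub> inv\<^bsub>G\<^esub> k),
      coAd H eh (inv\<^bsub>H\<^esub> k) q + Is (dp (h \<otimes>\<^bsub>G\<^esub> g \<otimes>\<^bsub>G\<^esub> inv\<^bsub>G\<^esub> k) u)))"

definition Psi_plus :: "('a, 'v::finite_dim_normed) liegrp \<Rightarrow> ('a \<Rightarrow> 'd \<Rightarrow> 'd) \<Rightarrow>
    'a \<times> 'p \<times> 'd \<Rightarrow> 'a \<times> 'a \<times> 'p \<times> 'a \<times> 'p \<Rightarrow> 'a \<times> 'p \<times> 'd" where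
  "Psi_plus G dp = (\<lambda>(h, p, u) (h', k, p', g, q).
     (k, q, dp (h \<otimes>\<^bsub>G\<^esub> g \<otimes>\<^bsub>G\<^esub> inv\<^bsub>G\<^esub> k) u))"

definition horizontal_groupoid where
  "horizontal_groupoid G H eh Gs Is dp dm =
     left_action_groupoid (Xse_groupoid H (Xs_groupoid H eh Gs Is dp)) (arrows (X_groupoid G))
       (target (X_groupoid G)) (Psi_minus G H eh Is dp dm)"

text \<open>The right action groupoid, before its arrows are identified with those of
  \<^const>\<open>horizontal_groupoid\<close> by means of \<open>swap_factors\<close>.\<close>

definition right_groupoid where
  "right_groupoid G H eh Gs Is dp =
     right_action_groupoid (Xe_groupoid H (X_groupoid G)) (arrows (Xs_groupoid H eh Gs Is dp))
       (\<lambda>(h, p, u). (h, p)) (Psi_plus G dp)"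

definition swap_factors :: "('a \<times> 'p \<times> 'd \<times> 'a) \<times> ('p \<times> 'a \<times> 'p) \<Rightarrow>
    ('a \<times> 'p \<times> 'd) \<times> ('a \<times> 'a \<times> 'p \<times> 'a \<times> 'p)" where
  "swap_factors = (\<lambda>((h, p, u, k), (p', g, q)). ((h, p, u), (h, k, p', g, q)))"

definition vertical_groupoid where
  "vertical_groupoid G H eh Gs Is dp dm =
     transport_groupoid swap_factors (arrows (horizontal_groupoid G H eh Gs Is dp dm))
       (right_groupoid G H eh Gs Is dp)"

text \<open>An element \<open>((h, p, u, k), (p, g, q))\<close> of the fibre product, an embedded submanifold of the
  product since it is the set where two coordinates coincide, is determined by the independent
  coordinates \<open>h, p, u, k, g, q\<close>.\<close>

definition S_coords :: "('a \<times> 'p \<times> 'd \<times> 'a) \<times> ('p \<times> 'a \<times> 'p) \<Rightarrow> 'a \<times> 'p \<times> 'd \<times> 'a \<times> 'a \<times> 'p" where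
  "S_coords = (\<lambda>((h, p, u, k), (p', g, q)). (h, p, u, k, g, q))"

definition S_atlas where
  "S_atlas G H eh Gs Is dp dm =
     pullback_atlas S_coords (arrows (horizontal_groupoid G H eh Gs Is dp dm))
       (prod_atlas (atlas H) (prod_atlas vec_atlas (prod_atlas (atlas Gs)
         (prod_atlas (atlas H) (prod_atlas (atlas G) vec_atlas)))))"

end

theory Submission
  imports Defs
begin

text \<open>
  The algebra of the theorem rests on one observation: the left dressing action fixes \<open>H\<close> pointwise, so
  the twisted multiplicativity of \<open>\<phi>\<^sup>+\<close> and \<open>\<phi>\<^sup>-\<close> becomes honest multiplicativity along \<open>H\<close>. For
  \<open>h, k \<in> H\<close> the map \<open>\<phi>\<^sup>+\<^sub>h\<close> is an automorphism of \<open>G\<^sup>*\<close>, and \<open>\<phi>\<^sup>-\<^sub>u(h y k\<inverse>) = h \<phi>\<^sup>-\<^sub>v(y) k\<inverse>\<close> with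
  \<open>v = \<phi>\<^sup>+\<^sub>h(u)\<close>. From this, target and source of either structure on \<open>\<S>\<close> are multiplicative for the other
  one (\<open>Hor_target_comp\<close>, \<open>dm_conj2_mult\<close>, \<open>dp_conj2_mult\<close>). The two multiplications act on different
  coordinates of \<open>((h, p, u, k), (p, g, q))\<close>, so the interchange law is then immediate. It makes the
  multiplications morphisms, and by uniqueness of inverses also the inversions
  (\<open>comp_morphism_if_interchange\<close>, \<open>inv_morphism_if_interchange\<close>).

  One identity is not algebraic, and already the multiplication of \<open>X\<^sup>*\<close> needs it: the map
  \<open>I\<^sup>*\<close> is equivariant, \<open>I\<^sup>*(\<phi>\<^sup>+\<^sub>h(u)) = Ad\<^sup>*\<^sub>h I\<^sup>*(u)\<close> for \<open>h \<in> H\<close> (\<open>Is_dressing\<close>). Its proof looks at the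
  components \<open>F\<^sub>V(u) = \<langle>I\<^sup>*(u), V\<rangle>\<close>, \<open>V \<in> \<h>\<close>. They are additive, so the left-invariant
  differential of \<open>F\<^sub>V\<close> is the constant \<open>\<iota> V\<close>, and the definition of the dressing action says that
  \<open>\<phi>\<^sup>+\<close> differentiates \<open>F\<^sub>V\<close> in the direction \<open>\<iota> Z\<close> to \<open>-{F\<^sub>V, F\<^sub>Z}\<close>. Multiplicativity of the Poisson
  bracket makes \<open>{F\<^sub>V, F\<^sub>Z}\<close> additive as well, and its linearization at the unit is the Lie bracket;
  an additive smooth function on a connected group is determined by its derivative at the unit, so
  \<open>{F\<^sub>V, F\<^sub>Z}\<close> is the component for \<open>[V, Z]\<close>. Hence \<open>\<langle>I\<^sup>*(\<phi>\<^sup>+\<^sub>h(u)), Ad\<^sub>k V\<rangle>\<close> with \<open>k = h\<inverse>\<close> has zero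
  derivative along every \<open>h e\<^sup>t\<^sup>Z\<close> and is constant, since \<open>H\<close> is connected.

  Smoothness is a matter of composing smooth maps: all four multiplications are given by formulas that
  make sense and are smooth for arbitrary pairs of arrows. For the submersion condition it suffices
  that through every arrow there passes a smooth section of the source or of the target map. What this
  requires of calculus on finite-dimensional normed spaces and of manifolds comes first.
\<close>

section \<open>Finite-dimensional normed spaces\<close>

text \<open>The coefficients with absolute values summing to 1 form a compact set by Tychonoff's theorem, so
  the norm has a positive minimum on it. This is the one place where compactness enters; it makes the
  coordinates with respect to a basis bounded, hence every linear map continuous.\<close>

lemma sum_coefficients_le_norm:
  fixes B :: "'a::real_normed_vector set"
  assumes fin: "finite B" and ind: "independent B"
  shows "\<exists>c>0. \<forall>f. c * (\<Sum>b\<in>B. \<bar>f b\<bar>) \<le> norm (\<Sum>b\<in>B. f b *\<^sub>R b)"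
proof (cases "B = {}")
  case True
  then show ?thesis by (intro exI[of _ 1]) auto
next
  case False
  let ?N = "\<lambda>f. norm (\<Sum>b\<in>B. f b *\<^sub>R b)" and ?s = "\<lambda>f. \<Sum>b\<in>B. \<bar>f b :: real\<bar>"
  define K where "K = (\<Pi>\<^sub>E b\<in>UNIV. if b \<in> B then {-1..1::real} else {0})"
  define S where "S = K \<inter> {f. ?s f = 1}"
  have "compactin (product_topology (\<lambda>b::'a. euclidean) UNIV) K"
    unfolding K_def by (subst compactin_PiE) auto
  then have "compact K" by (simp add: euclidean_product_topology)
  moreover have "closed {f. ?s f = 1}"
    by (intro closed_Collect_eq continuous_intros continuous_on_product_coordinates)
  ultimately have S: "compact S" unfolding S_def by (rule compact_Int_closed)
  obtain b0 where b0: "b0 \<in> B" using False by blast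
  have "?s (\<lambda>b. if b = b0 then 1 else 0) = 1"
    using b0 fin by (simp add: sum.remove[OF fin b0])
  then have "(\<lambda>b. if b = b0 then 1 else 0) \<in> S" using b0 by (auto simp: S_def K_def)
  then have ne: "S \<noteq> {}" by blast
  have "continuous_on S ?N"
    by (intro continuous_intros continuous_on_product_coordinates
        continuous_on_subset[OF continuous_on_product_coordinates]) auto
  from continuous_attains_inf[OF S ne this] obtain g where g: "g \<in> S" "\<And>f. f \<in> S \<Longrightarrow> ?N g \<le> ?N f"
    by blast
  have "?N g > 0"
  proof (rule ccontr)
    assume "\<not> ?N g > 0"
    then have "(\<Sum>b\<in>B. g b *\<^sub>R b) = 0" by simp
    then have "\<forall>b\<in>B. g b = 0" using ind independent_explicit_finite_subsets[of B] fin by blast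
    then show False using g(1) by (simp add: S_def)
  qed
  moreover have "?N g * ?s f \<le> ?N f" for f
  proof (cases "?s f = 0")
    case True
    then show ?thesis by simp
  next
    case False
    then have pos: "?s f > 0" by (simp add: order_less_le sum_nonneg)
    define h where "h b = (if b \<in> B then f b / ?s f else 0)" for b
    have "\<bar>f b\<bar> \<le> ?s f" if "b \<in> B" for b by (rule member_le_sum) (use fin that in auto)
    then have "h b \<in> (if b \<in> B then {-1..1} else {0})" for b
      using pos by (force simp: h_def divide_le_eq le_divide_eq abs_le_iff)
    then have "h \<in> K" by (auto simp: K_def)
    moreover have "?s h = 1"
    proof -
      have "?s h = (\<Sum>b\<in>B. \<bar>f b\<bar> / ?s f)" using pos by (intro sum.cong) (auto simp: h_def)
      also have "\<dots> = 1" using pos by (simp flip: sum_divide_distrib)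
      finally show ?thesis .
    qed
    ultimately have "?N g \<le> ?N h" by (intro g(2)) (simp add: S_def)
    also have "(\<Sum>b\<in>B. h b *\<^sub>R b) = (1 / ?s f) *\<^sub>R (\<Sum>b\<in>B. f b *\<^sub>R b)"
      by (auto simp: h_def scaleR_sum_right intro!: sum.cong)
    finally show ?thesis using pos by (simp add: field_simps)
  qed
  ultimately show ?thesis by blast
qed

lemma finite_dim_coordinates:
  obtains B :: "'a::finite_dim_normed set" and k where "finite B"
    "\<And>b. bounded_linear (k b)" "\<And>x. (\<Sum>b\<in>B. k b x *\<^sub>R b) = x"
proof -
  obtain A :: "'a set" where A: "finite A" "span A = UNIV" using finite_dim by blast
  obtain B where B: "B \<subseteq> A" "independent B" "span A = span B"
    using maximal_independent_subset[of A] span_mono span_span by (metis span_eq span_superset subset_trans)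
  have fin: "finite B" using A(1) B(1) by (rule rev_finite_subset)
  have span: "span B = UNIV" using A(2) B(3) by simp
  define k where "k b x = representation B x b" for b x
  have eq: "(\<Sum>b\<in>B. k b x *\<^sub>R b) = x" for x
    unfolding k_def by (rule sum_representation_eq) (use B fin span in auto)
  have lin: "linear (k b)" for b
    unfolding k_def using B(2) span
    by (intro linearI) (simp_all add: representation_add representation_scale)
  obtain c where c: "c > 0" "\<And>f. c * (\<Sum>b\<in>B. \<bar>f b\<bar>) \<le> norm (\<Sum>b\<in>B. f b *\<^sub>R b)"
    using sum_coefficients_le_norm[OF fin B(2)] by blast
  have bnd: "\<bar>k b x\<bar> \<le> norm x * (1 / c)" for b x
  proof (cases "b \<in> B")
    case True
    have "\<bar>k b x\<bar> \<le> (\<Sum>b\<in>B. \<bar>k b x\<bar>)" by (rule member_le_sum) (use fin True in auto)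
    then have "c * \<bar>k b x\<bar> \<le> c * (\<Sum>b\<in>B. \<bar>k b x\<bar>)" using c(1) by simp
    also have "\<dots> \<le> norm x" using c(2)[of "\<lambda>b. k b x"] by (simp add: eq)
    finally show ?thesis using c(1) by (simp add: field_simps)
  next
    case False
    then have "k b x = 0" using representation_ne_zero[of B x b] by (auto simp: k_def)
    then show ?thesis using c(1) by simp
  qed
  have "bounded_linear (k b)" for b
    using lin bnd by (intro bounded_linear_intro[where K = "1/c"]) (auto simp: linear_add linear_scale)
  with fin eq that show ?thesis by blast
qed

lemma linear_imp_bounded_linear:
  fixes f :: "'a::finite_dim_normed \<Rightarrow> 'b::real_normed_vector"
  assumes "linear f"
  shows "bounded_linear f"
proof -
  obtain B :: "'a set" and k where B: "finite B" "\<And>b. bounded_linear (k b)"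
    "\<And>x. (\<Sum>b\<in>B. k b x *\<^sub>R b) = x" using finite_dim_coordinates by blast
  have "f = (\<lambda>x. \<Sum>b\<in>B. k b x *\<^sub>R f b)"
  proof
    fix x
    show "f x = (\<Sum>b\<in>B. k b x *\<^sub>R f b)"
      using assms by (subst B(3)[symmetric, of x]) (simp add: linear_sum linear_scale)
  qed
  moreover have "bounded_linear (\<lambda>x. \<Sum>b\<in>B. k b x *\<^sub>R f b)"
    by (intro bounded_linear_sum bounded_linear_compose[OF bounded_linear_scaleR_left B(2)])
  ultimately show ?thesis by simp
qed

lemma second_countable_euclidean:
  "second_countable (euclidean :: 'a::finite_dim_normed topology)"
proof -
  obtain B :: "'a set" and k where B: "finite B" "\<And>b. bounded_linear (k b)"
    "\<And>x. (\<Sum>b\<in>B. k b x *\<^sub>R b) = x" using finite_dim_coordinates by blast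
  define D where "D = (\<lambda>q. \<Sum>b\<in>B. q b *\<^sub>R b) ` (B \<rightarrow>\<^sub>E \<rat>)"
  have D: "countable D" unfolding D_def using B(1) by (auto intro!: countable_PiE countable_rat)
  have dense: "\<exists>d\<in>D. dist d x < r" if r: "r > 0" for x :: 'a and r
  proof -
    define s where "s = r / (1 + (\<Sum>b\<in>B. norm b))"
    have pos: "1 + (\<Sum>b\<in>B. norm b) > 0" by (simp add: add_pos_nonneg sum_nonneg)
    then have "s > 0" using r by (simp add: s_def)
    then have "\<exists>q\<in>\<rat>. \<bar>q - k b x\<bar> < s" for b
    proof -
      obtain q where "q \<in> \<rat>" "k b x < q" "q < k b x + s"
        using Rats_dense_in_real[of "k b x" "k b x + s"] \<open>s > 0\<close> by auto
      then show ?thesis by (intro bexI[of _ q]) auto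
    qed
    then obtain q where q: "\<And>b. q b \<in> \<rat>" "\<And>b. \<bar>q b - k b x\<bar> < s" by metis
    have "dist (\<Sum>b\<in>B. restrict q B b *\<^sub>R b) x = norm (\<Sum>b\<in>B. (q b - k b x) *\<^sub>R b)"
      by (subst B(3)[symmetric, of x]) (simp add: dist_norm scaleR_diff_left sum_subtractf)
    also have "\<dots> \<le> (\<Sum>b\<in>B. s * norm b)"
    proof (rule sum_norm_le)
      show "norm ((q b - k b x) *\<^sub>R b) \<le> s * norm b" for b
        using mult_right_mono[OF less_imp_le[OF q(2)[of b]] norm_ge_zero[of b]] by simp
    qed
    also have "\<dots> = s * (\<Sum>b\<in>B. norm b)" by (simp add: sum_distrib_left)
    also have "\<dots> < s * (1 + (\<Sum>b\<in>B. norm b))" using \<open>s > 0\<close> by simp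
    also have "\<dots> = r" using pos by (simp add: s_def)
    finally have "dist (\<Sum>b\<in>B. restrict q B b *\<^sub>R b) x < r" .
    moreover have "(\<Sum>b\<in>B. restrict q B b *\<^sub>R b) \<in> D"
      unfolding D_def by (rule image_eqI[OF refl]) (use q(1) in auto)
    ultimately show ?thesis by blast
  qed
  define \<B> where "\<B> = (\<lambda>(d, n). ball d (1 / real (Suc n))) ` (D \<times> (UNIV :: nat set))"
  have "\<exists>V\<in>\<B>. x \<in> V \<and> V \<subseteq> U" if U: "open U" "x \<in> U" for U and x :: 'a
  proof -
    obtain r where r: "r > 0" "ball x r \<subseteq> U" using U open_contains_ball by blast
    obtain n where n: "1 / real (Suc n) < r / 2" using r(1) nat_approx_posE[of "r/2"] by auto
    obtain d where d: "d \<in> D" "dist d x < 1 / real (Suc n)" using dense[of "1 / real (Suc n)" x] by auto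
    have "y \<in> ball x r" if "y \<in> ball d (1 / real (Suc n))" for y
      using that d(2) n dist_triangle[of x y d] by (simp add: dist_commute)
    then show ?thesis using d r(2) by (intro bexI[of _ "ball d (1 / real (Suc n))"]) (auto simp: \<B>_def)
  qed
  moreover have "countable \<B>" using D by (auto simp: \<B>_def)
  moreover have "\<forall>V\<in>\<B>. open V" by (auto simp: \<B>_def)
  ultimately show ?thesis unfolding second_countable_def by (intro exI[of _ \<B>]) auto
qed

section \<open>Calculus of smooth functions\<close>

text \<open>The functions \<open>C_k n U f\<close> speaks about are differentiable in the ambient space, so \<open>U\<close> has to be
  open for the property to depend on the values of \<open>f\<close> on \<open>U\<close> only.\<close>

lemma C_k_cong:
  assumes "open U" "\<And>x. x \<in> U \<Longrightarrow> f x = g x" "C_k n U f"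
  shows "C_k n U g"
  using assms(2,3)
proof (induction n arbitrary: f g)
  case 0
  then show ?case by (simp cong: continuous_on_cong)
next
  case (Suc n)
  have "g differentiable (at x)" if "x \<in> U" for x
  proof -
    from Suc.prems that obtain f' where "(f has_derivative f') (at x)" by (auto simp: differentiable_def)
    from has_derivative_transform_within_open[OF this assms(1) that Suc.prems(1)]
    show ?thesis by (auto simp: differentiable_def)
  qed
  moreover have "C_k n U (\<lambda>x. frechet_derivative g (at x) v)" for v
  proof (rule Suc.IH[of "\<lambda>x. frechet_derivative f (at x) v"])
    show "frechet_derivative f (at x) v = frechet_derivative g (at x) v" if "x \<in> U" for x
      using frechet_derivative_transform_within_open[of f x, OF _ assms(1) that Suc.prems(1)]
        Suc.prems(2) that by simp
  qed (use Suc.prems in auto)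
  ultimately show ?case by simp
qed

lemma C_k_subset: "C_k n U f \<Longrightarrow> V \<subseteq> U \<Longrightarrow> C_k n V f"
  by (induction n arbitrary: f) (auto intro: continuous_on_subset)

lemma C_k_Suc_imp: "C_k (Suc n) U f \<Longrightarrow> C_k n U f"
proof (induction n arbitrary: f)
  case 0
  then show ?case
    by (auto intro!: continuous_at_imp_continuous_on differentiable_imp_continuous_within)
next
  case (Suc n)
  have "C_k (Suc n) U (\<lambda>x. frechet_derivative f (at x) v)" for v
    using Suc.prems unfolding C_k.simps(2)[of "Suc n"] by blast
  then have "C_k n U (\<lambda>x. frechet_derivative f (at x) v)" for v by (rule Suc.IH)
  moreover have "\<forall>x\<in>U. f differentiable at x" using Suc.prems by simp
  ultimately show ?case by simp
qed

lemma C_k_local: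
  assumes "\<And>x. x \<in> U \<Longrightarrow> \<exists>V. open V \<and> x \<in> V \<and> C_k n V f"
  shows "C_k n U f"
  using assms
proof (induction n arbitrary: f)
  case 0
  then show ?case
    by (force intro!: continuous_at_imp_continuous_on simp: continuous_on_eq_continuous_at)
next
  case (Suc n)
  show ?case unfolding C_k.simps
  proof (intro conjI ballI allI)
    show "f differentiable at x" if "x \<in> U" for x using Suc.prems[OF that] by auto
    show "C_k n U (\<lambda>x. frechet_derivative f (at x) v)" for v
      using Suc.prems by (intro Suc.IH) (fastforce)
  qed
qed

lemma C_k_const: "C_k n U (\<lambda>x. c)"
  by (induction n arbitrary: c) auto

lemma C_k_linear_compose:
  assumes L: "bounded_linear L" and "C_k n U f" "open U"
  shows "C_k n U (\<lambda>x. L (f x))"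
  using assms(2)
proof (induction n arbitrary: f)
  case 0
  then show ?case by (simp add: bounded_linear.continuous_on[OF L])
next
  case (Suc n)
  have D: "((\<lambda>x. L (f x)) has_derivative (\<lambda>v. L (frechet_derivative f (at x) v))) (at x)"
    if "x \<in> U" for x
    using Suc.prems that by (intro bounded_linear.has_derivative[OF L]) (auto simp: frechet_derivative_works)
  have "C_k n U (\<lambda>x. frechet_derivative (\<lambda>x. L (f x)) (at x) v)" for v
    by (rule C_k_cong[OF assms(3) _ Suc.IH[of "\<lambda>x. frechet_derivative f (at x) v"]])
      (use Suc.prems in \<open>auto simp: frechet_derivative_at[OF D, symmetric]\<close>)
  with D show ?case by (auto simp: differentiable_def)
qed

lemma C_k_add:
  assumes "C_k n U f" "C_k n U g" "open U"
  shows "C_k n U (\<lambda>x. f x + g x)"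
  using assms(1,2)
proof (induction n arbitrary: f g)
  case 0
  then show ?case by (simp add: continuous_on_add)
next
  case (Suc n)
  have D: "((\<lambda>x. f x + g x) has_derivative
      (\<lambda>v. frechet_derivative f (at x) v + frechet_derivative g (at x) v)) (at x)"
    if "x \<in> U" for x
    using Suc.prems that by (intro has_derivative_add) (auto simp: frechet_derivative_works)
  have "C_k n U (\<lambda>x. frechet_derivative (\<lambda>x. f x + g x) (at x) v)" for v
    by (rule C_k_cong[OF assms(3) _ Suc.IH[of "\<lambda>x. frechet_derivative f (at x) v"
          "\<lambda>x. frechet_derivative g (at x) v"]])
      (use Suc.prems in \<open>auto simp: frechet_derivative_at[OF D, symmetric]\<close>)
  with D show ?case by (auto simp: differentiable_def)
qed

lemma C_k_sum:
  assumes "\<And>i. i \<in> I \<Longrightarrow> C_k n U (f i)" "open U"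
  shows "C_k n U (\<lambda>x. \<Sum>i\<in>I. f i x)"
  using assms(1) by (induction I rule: infinite_finite_induct) (auto intro: C_k_const C_k_add assms(2))

lemma C_k_bilinear:
  fixes p :: "'b::finite_dim_normed \<Rightarrow> 'c::finite_dim_normed \<Rightarrow> 'd::finite_dim_normed"
  assumes p: "bounded_bilinear p" and "C_k n U f" "C_k n U g" "open U"
  shows "C_k n U (\<lambda>x. p (f x) (g x))"
  using assms(2,3)
proof (induction n arbitrary: f g)
  case 0
  then show ?case by (simp add: bounded_bilinear.continuous_on[OF p])
next
  case (Suc n)
  have D: "((\<lambda>x. p (f x) (g x)) has_derivative
      (\<lambda>v. p (f x) (frechet_derivative g (at x) v) + p (frechet_derivative f (at x) v) (g x))) (at x)"
    if "x \<in> U" for x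
    using Suc.prems that by (intro bounded_bilinear.FDERIV[OF p]) (auto simp: frechet_derivative_works)
  have "C_k n U (\<lambda>x. frechet_derivative (\<lambda>x. p (f x) (g x)) (at x) v)" for v
  proof (rule C_k_cong[OF assms(4)])
    show "C_k n U (\<lambda>x. p (f x) (frechet_derivative g (at x) v) + p (frechet_derivative f (at x) v) (g x))"
      using Suc.prems by (intro C_k_add Suc.IH assms(4)) (auto simp: C_k_Suc_imp)
  qed (simp add: frechet_derivative_at[OF D, symmetric])
  with D show ?case by (auto simp: differentiable_def)
qed

text \<open>Smoothness is defined by iterated directional derivatives, and the direction
  \<open>frechet_derivative f (at x) v\<close> in the chain rule depends on \<open>x\<close>. Expanding it in a basis turns the
  derivative of the composition into a sum of products to which the induction hypothesis applies.\<close>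

lemma C_k_compose:
  fixes f :: "'a::finite_dim_normed \<Rightarrow> 'b::finite_dim_normed" and g :: "'b \<Rightarrow> 'c::finite_dim_normed"
  assumes "C_k n U f" "C_k n V g" "f ` U \<subseteq> V" "open U" "open V"
  shows "C_k n U (\<lambda>x. g (f x))"
  using assms(1,2)
proof (induction n arbitrary: g)
  case 0
  then show ?case using assms(3) by (auto intro: continuous_on_compose2)
next
  case (Suc n)
  obtain B :: "'b set" and k where B: "finite B" "\<And>b. bounded_linear (k b)"
    "\<And>x. (\<Sum>b\<in>B. k b x *\<^sub>R b) = x" using finite_dim_coordinates by blast
  have D: "((\<lambda>x. g (f x)) has_derivative
      (\<lambda>v. frechet_derivative g (at (f x)) (frechet_derivative f (at x) v))) (at x)"
    if "x \<in> U" for x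
  proof -
    have "(f has_derivative frechet_derivative f (at x)) (at x)"
      using Suc.prems(1) that by (simp add: frechet_derivative_works)
    moreover have "(g has_derivative frechet_derivative g (at (f x))) (at (f x))"
      using Suc.prems(2) assms(3) that by (auto simp: frechet_derivative_works)
    ultimately show ?thesis by (rule has_derivative_compose)
  qed
  have expand: "frechet_derivative g (at (f x)) (frechet_derivative f (at x) v) =
      (\<Sum>b\<in>B. k b (frechet_derivative f (at x) v) *\<^sub>R frechet_derivative g (at (f x)) b)"
    if "x \<in> U" for x v
  proof -
    have "linear (frechet_derivative g (at (f x)))"
      using Suc.prems that assms(3) by (intro linear_frechet_derivative) auto
    then show ?thesis
      by (subst B(3)[symmetric, of "frechet_derivative f (at x) v"]) (simp add: linear_sum linear_scale)
  qed
  have "C_k n U (\<lambda>x. frechet_derivative (\<lambda>x. g (f x)) (at x) v)" for v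
  proof (rule C_k_cong[OF assms(4)])
    have "C_k n U f" using Suc.prems(1) by (rule C_k_Suc_imp)
    then show "C_k n U (\<lambda>x. \<Sum>b\<in>B. k b (frechet_derivative f (at x) v) *\<^sub>R frechet_derivative g (at (f x)) b)"
      using Suc.prems
      by (intro C_k_sum C_k_bilinear[OF bounded_bilinear_scaleR] assms C_k_linear_compose[OF B(2)]
          Suc.IH[of "\<lambda>y. frechet_derivative g (at y) b" for b]) auto
  qed (simp add: frechet_derivative_at[OF D, symmetric] expand)
  with D show ?case by (auto simp: differentiable_def)
qed

lemma C_infinity_cong: "open U \<Longrightarrow> (\<And>x. x \<in> U \<Longrightarrow> f x = g x) \<Longrightarrow> C_infinity U f \<Longrightarrow> C_infinity U g"
  unfolding C_infinity_def using C_k_cong by blast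

lemma C_infinity_subset: "C_infinity U f \<Longrightarrow> V \<subseteq> U \<Longrightarrow> C_infinity V f"
  unfolding C_infinity_def using C_k_subset by blast

lemma C_infinity_local:
  assumes "\<And>x. x \<in> U \<Longrightarrow> \<exists>V. open V \<and> x \<in> V \<and> C_infinity V f"
  shows "C_infinity U f"
  unfolding C_infinity_def
proof
  show "C_k n U f" for n
    by (rule C_k_local) (use assms in \<open>fastforce simp: C_infinity_def\<close>)
qed

lemma C_infinity_const: "C_infinity U (\<lambda>x. c)"
  by (simp add: C_infinity_def C_k_const)

lemma C_infinity_id: "C_infinity U (\<lambda>x. x)"
proof -
  have "C_k n U (\<lambda>x. x)" for n
    by (cases n) (auto simp: C_k_const)
  then show ?thesis by (simp add: C_infinity_def)
qed

lemma C_infinity_linear: "bounded_linear L \<Longrightarrow> open U \<Longrightarrow> C_infinity U f \<Longrightarrow> C_infinity U (\<lambda>x. L (f x))"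
  by (simp add: C_infinity_def C_k_linear_compose)

lemma C_infinity_add:
  "C_infinity U f \<Longrightarrow> C_infinity U g \<Longrightarrow> open U \<Longrightarrow> C_infinity U (\<lambda>x. f x + g x)"
  by (simp add: C_infinity_def C_k_add)

lemma C_infinity_bilinear:
  fixes p :: "'b::finite_dim_normed \<Rightarrow> 'c::finite_dim_normed \<Rightarrow> 'd::finite_dim_normed"
  shows "bounded_bilinear p \<Longrightarrow> C_infinity U f \<Longrightarrow> C_infinity U g \<Longrightarrow> open U \<Longrightarrow>
    C_infinity U (\<lambda>x. p (f x) (g x))"
  by (simp add: C_infinity_def C_k_bilinear)

lemma C_infinity_compose:
  "C_infinity U f \<Longrightarrow> C_infinity V g \<Longrightarrow> f ` U \<subseteq> V \<Longrightarrow> open U \<Longrightarrow> open V \<Longrightarrow> C_infinity U (\<lambda>x. g (f x))"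
  by (simp add: C_infinity_def C_k_compose[where V = V])

lemma C_infinity_Pair:
  fixes f :: "'a::finite_dim_normed \<Rightarrow> 'b::finite_dim_normed" and g :: "'a \<Rightarrow> 'c::finite_dim_normed"
  assumes "C_infinity U f" "C_infinity U g" "open U"
  shows "C_infinity U (\<lambda>x. (f x, g x))"
proof -
  have "C_infinity U (\<lambda>x. (f x, 0::'c) + (0::'b, g x))"
    using assms
    by (intro C_infinity_add C_infinity_linear[where L = "\<lambda>y. (y, 0::'c)"]
        C_infinity_linear[where L = "\<lambda>y. (0::'b, y)"] bounded_linear_Pair
        bounded_linear_ident bounded_linear_zero)
  then show ?thesis by simp
qed

lemma C_infinity_imp_continuous: "C_infinity U f \<Longrightarrow> continuous_on U f"
  by (simp add: C_infinity_def) (metis C_k.simps(1))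

lemma C_infinity_imp_differentiable: "C_infinity U f \<Longrightarrow> x \<in> U \<Longrightarrow> f differentiable (at x)"
  by (simp add: C_infinity_def) (metis C_k.simps(2))

lemma C_infinity_has_derivative:
  "C_infinity U f \<Longrightarrow> x \<in> U \<Longrightarrow> (f has_derivative frechet_derivative f (at x)) (at x)"
  using C_infinity_imp_differentiable frechet_derivative_works by blast

lemma C_infinity_derivative: "C_infinity U f \<Longrightarrow> C_infinity U (\<lambda>x. frechet_derivative f (at x) v)"
  by (simp add: C_infinity_def) (metis C_k.simps(2))

lemma has_vector_derivative_compose:
  assumes "(\<gamma> has_vector_derivative v) (at t)" "(f has_derivative f') (at (\<gamma> t))"
  shows "((\<lambda>s. f (\<gamma> s)) has_vector_derivative f' v) (at t)"
proof -
  have "((\<lambda>s. f (\<gamma> s)) has_derivative (\<lambda>s. f' (s *\<^sub>R v))) (at t)"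
    using assms(1) assms(2) unfolding has_vector_derivative_def by (rule has_derivative_compose)
  then show ?thesis
    using has_derivative_bounded_linear[OF assms(2)]
    by (simp add: has_vector_derivative_def linear_simps bounded_linear.linear linear_scale)
qed

section \<open>Smooth maps between manifolds\<close>

text \<open>The part of \<^const>\<open>smooth_manifold\<close> on which the calculus of smooth maps relies. It is separated
  because smooth maps are used to prove that products and pullbacks are manifolds.\<close>

definition charts :: "('p, 'e::finite_dim_normed) atlas \<Rightarrow> bool" where
  "charts A \<longleftrightarrow> (\<forall>(U, \<phi>)\<in>A. inj_on \<phi> U \<and> open (\<phi> ` U))"

lemma charts_inj: "charts A \<Longrightarrow> (U, \<phi>) \<in> A \<Longrightarrow> inj_on \<phi> U"
  and charts_open: "charts A \<Longrightarrow> (U, \<phi>) \<in> A \<Longrightarrow> open (\<phi> ` U)"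
  and chart_subset: "(U, \<phi>) \<in> A \<Longrightarrow> U \<subseteq> points A"
  by (auto simp: charts_def points_def)

lemma in_points_iff: "x \<in> points A \<longleftrightarrow> (\<exists>U \<phi>. (U, \<phi>) \<in> A \<and> x \<in> U)"
  by (auto simp: points_def)

lemmas point_in_chart = iffD1[OF in_points_iff]

lemma in_prod_atlas:
  "(P, \<rho>) \<in> prod_atlas A B \<longleftrightarrow>
    (\<exists>U \<phi> V \<psi>. P = U \<times> V \<and> \<rho> = map_prod \<phi> \<psi> \<and> (U, \<phi>) \<in> A \<and> (V, \<psi>) \<in> B)"
  by (simp add: prod_atlas_def)

lemma in_pullback_atlas:
  "(P, \<rho>) \<in> pullback_atlas f S A \<longleftrightarrow> (\<exists>U \<phi>. P = S \<inter> f -` U \<and> \<rho> = \<phi> \<circ> f \<and> (U, \<phi>) \<in> A)"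
  by (simp add: pullback_atlas_def)

lemma smooth_mapD:
  assumes "smooth_map A B f" "(U, \<phi>) \<in> A" "(V, \<psi>) \<in> B"
  shows "open (\<phi> ` (U \<inter> f -` V))" "C_infinity (\<phi> ` (U \<inter> f -` V)) (\<psi> \<circ> f \<circ> inv_into U \<phi>)"
  using assms by (auto simp: smooth_map_def)

lemma smooth_map_into: "smooth_map A B f \<Longrightarrow> x \<in> points A \<Longrightarrow> f x \<in> points B"
  by (auto simp: smooth_map_def)

lemma smooth_map_localI:
  assumes "\<And>x. x \<in> points A \<Longrightarrow> f x \<in> points B"
    and "\<And>U \<phi> V \<psi> x. (U, \<phi>) \<in> A \<Longrightarrow> (V, \<psi>) \<in> B \<Longrightarrow> x \<in> U \<Longrightarrow> f x \<in> V \<Longrightarrow>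
      \<exists>N. open N \<and> \<phi> x \<in> N \<and> N \<subseteq> \<phi> ` (U \<inter> f -` V) \<and> C_infinity N (\<psi> \<circ> f \<circ> inv_into U \<phi>)"
  shows "smooth_map A B f"
  unfolding smooth_map_def
proof (intro conjI ballI; clarify?)
  fix U \<phi> V \<psi> assume c: "(U, \<phi>) \<in> A" "(V, \<psi>) \<in> B"
  have *: "\<exists>N. open N \<and> y \<in> N \<and> N \<subseteq> \<phi> ` (U \<inter> f -` V) \<and> C_infinity N (\<psi> \<circ> f \<circ> inv_into U \<phi>)"
    if "y \<in> \<phi> ` (U \<inter> f -` V)" for y
  proof -
    from that obtain x where x: "y = \<phi> x" "x \<in> U" "f x \<in> V" by blast
    show ?thesis unfolding x(1) by (rule assms(2)[OF c x(2,3)])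
  qed
  show "open (\<phi> ` (U \<inter> f -` V)) \<and> C_infinity (\<phi> ` (U \<inter> f -` V)) (\<psi> \<circ> f \<circ> inv_into U \<phi>)"
  proof
    show "open (\<phi> ` (U \<inter> f -` V))"
    proof (subst open_subopen, intro ballI)
      fix y assume "y \<in> \<phi> ` (U \<inter> f -` V)"
      from *[OF this] show "\<exists>T. open T \<and> y \<in> T \<and> T \<subseteq> \<phi> ` (U \<inter> f -` V)" by (elim exE conjE) (intro exI conjI)
    qed
    show "C_infinity (\<phi> ` (U \<inter> f -` V)) (\<psi> \<circ> f \<circ> inv_into U \<phi>)"
    proof (rule C_infinity_local)
      fix y assume "y \<in> \<phi> ` (U \<inter> f -` V)"
      from *[OF this] show "\<exists>N. open N \<and> y \<in> N \<and> C_infinity N (\<psi> \<circ> f \<circ> inv_into U \<phi>)"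
        by (elim exE conjE) (intro exI conjI)
    qed
  qed
qed (use assms(1) in auto)

lemma smooth_map_cong:
  assumes "charts A" "\<And>x. x \<in> points A \<Longrightarrow> f x = g x" "smooth_map A B f"
  shows "smooth_map A B g"
proof (rule smooth_map_localI)
  show "g x \<in> points B" if "x \<in> points A" for x
    using smooth_map_into[OF assms(3) that] assms(2)[OF that] by simp
  fix U \<phi> V \<psi> x assume c: "(U, \<phi>) \<in> A" "(V, \<psi>) \<in> B" "x \<in> U" "g x \<in> V"
  have eq: "U \<inter> f -` V = U \<inter> g -` V" using assms(2) chart_subset[OF c(1)] by auto
  note D = smooth_mapD[OF assms(3) c(1,2)]
  have "C_infinity (\<phi> ` (U \<inter> f -` V)) (\<psi> \<circ> g \<circ> inv_into U \<phi>)"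
    using D(1) by (rule C_infinity_cong[OF _ _ D(2)])
      (use assms(2) chart_subset[OF c(1)] in \<open>auto simp: inv_into_f_f[OF charts_inj[OF assms(1) c(1)]]\<close>)
  then show "\<exists>N. open N \<and> \<phi> x \<in> N \<and> N \<subseteq> \<phi> ` (U \<inter> g -` V) \<and> C_infinity N (\<psi> \<circ> g \<circ> inv_into U \<phi>)"
    using D(1) c by (intro exI[of _ "\<phi> ` (U \<inter> f -` V)"]) (auto simp: eq)
qed

text \<open>A chart of the middle manifold is chosen around each point; smoothness being local, the smaller
  domain on which the composition factors through that chart is enough.\<close>

lemma smooth_map_compose:
  assumes "charts A" "charts B" "smooth_map A B f" "smooth_map B C g"
  shows "smooth_map A C (\<lambda>x. g (f x))"
proof (rule smooth_map_localI)
  show "g (f x) \<in> points C" if "x \<in> points A" for x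
    using that assms(3,4) by (auto dest!: smooth_map_into)
  fix U \<phi> W \<theta> x assume c: "(U, \<phi>) \<in> A" "(W, \<theta>) \<in> C" "x \<in> U" "g (f x) \<in> W"
  have "f x \<in> points B" using smooth_map_into[OF assms(3)] chart_subset c by blast
  from point_in_chart[OF this] obtain V \<psi> where V: "(V, \<psi>) \<in> B" "f x \<in> V" by (elim exE conjE)
  note f = smooth_mapD[OF assms(3) c(1) V(1)] and g = smooth_mapD[OF assms(4) V(1) c(2)]
  note inv = inv_into_f_f[OF charts_inj[OF assms(1) c(1)]] inv_into_f_f[OF charts_inj[OF assms(2) V(1)]]
  define N where "N = \<phi> ` (U \<inter> f -` V) \<inter> (\<psi> \<circ> f \<circ> inv_into U \<phi>) -` (\<psi> ` (V \<inter> g -` W))"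
  have N: "open N" unfolding N_def
    by (rule continuous_open_preimage[OF C_infinity_imp_continuous[OF f(2)] f(1) g(1)])
  have mem: "\<exists>u. y = \<phi> u \<and> u \<in> U \<and> f u \<in> V \<and> g (f u) \<in> W" if "y \<in> N" for y
    using that inj_onD[OF charts_inj[OF assms(2) V(1)]] by (fastforce simp: N_def inv)
  have "C_infinity N (\<lambda>y. (\<theta> \<circ> g \<circ> inv_into V \<psi>) ((\<psi> \<circ> f \<circ> inv_into U \<phi>) y))"
    by (rule C_infinity_compose[OF C_infinity_subset[OF f(2)] g(2) _ N g(1)]) (auto simp: N_def)
  then have "C_infinity N (\<theta> \<circ> (\<lambda>x. g (f x)) \<circ> inv_into U \<phi>)"
    by (rule C_infinity_cong[OF N, rotated]) (use mem in \<open>fastforce simp: inv\<close>)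
  moreover have "\<phi> x \<in> N" using c V by (auto simp: N_def inv)
  moreover have "N \<subseteq> \<phi> ` (U \<inter> (\<lambda>x. g (f x)) -` W)" using mem by fast
  ultimately show "\<exists>N. open N \<and> \<phi> x \<in> N \<and> N \<subseteq> \<phi> ` (U \<inter> (\<lambda>x. g (f x)) -` W) \<and>
      C_infinity N (\<theta> \<circ> (\<lambda>x. g (f x)) \<circ> inv_into U \<phi>)" using N by blast
qed

lemma smooth_map_const:
  assumes "charts A" "c \<in> points B"
  shows "smooth_map A B (\<lambda>x. c)"
proof (rule smooth_map_localI)
  fix U \<phi> V \<psi> x assume "(U, \<phi>) \<in> A" "(V, \<psi>) \<in> B" "x \<in> U" "c \<in> V"
  then show "\<exists>N. open N \<and> \<phi> x \<in> N \<and> N \<subseteq> \<phi> ` (U \<inter> (\<lambda>x. c) -` V) \<and>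
      C_infinity N (\<psi> \<circ> (\<lambda>x. c) \<circ> inv_into U \<phi>)"
    using charts_open[OF assms(1)]
    by (intro exI[of _ "\<phi> ` U"]) (auto simp: comp_def C_infinity_const)
qed (use assms in auto)

subsection \<open>Products and pullbacks\<close>

lemma points_prod_atlas: "points (prod_atlas A B) = points A \<times> points B"
proof (intro subset_antisym subrelI subsetI)
  fix z assume "z \<in> points A \<times> points B"
  then obtain U \<phi> V \<psi> where "(U, \<phi>) \<in> A" "fst z \<in> U" "(V, \<psi>) \<in> B" "snd z \<in> V"
    by (auto simp: in_points_iff)
  then have "(U \<times> V, map_prod \<phi> \<psi>) \<in> prod_atlas A B" "z \<in> U \<times> V"
    by (auto simp: prod_atlas_def mem_Times_iff)
  then show "z \<in> points (prod_atlas A B)" unfolding in_points_iff by (intro exI conjI)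
qed (auto simp: in_points_iff in_prod_atlas)

lemma charts_prod_atlas:
  assumes "charts A" "charts B"
  shows "charts (prod_atlas A B)"
  unfolding charts_def
proof clarify
  fix P \<rho> assume "(P, \<rho>) \<in> prod_atlas A B"
  then obtain U \<phi> V \<psi> where uv: "P = U \<times> V" "\<rho> = map_prod \<phi> \<psi>" "(U, \<phi>) \<in> A" "(V, \<psi>) \<in> B"
    unfolding in_prod_atlas by (elim exE conjE)
  show "inj_on \<rho> P \<and> open (\<rho> ` P)"
    unfolding uv map_prod_surj_on[OF refl refl]
    using charts_inj[OF assms(1) uv(3)] charts_inj[OF assms(2) uv(4)]
      charts_open[OF assms(1) uv(3)] charts_open[OF assms(2) uv(4)]
    by (intro conjI map_prod_inj_on open_Times)
qed

lemma inv_into_map_prod: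
  assumes "inj_on \<phi> U" "inj_on \<psi> V" "a \<in> \<phi> ` U" "b \<in> \<psi> ` V"
  shows "inv_into (U \<times> V) (map_prod \<phi> \<psi>) (a, b) = (inv_into U \<phi> a, inv_into V \<psi> b)"
  by (rule inv_into_f_eq[OF map_prod_inj_on[OF assms(1,2)]]) (use assms in \<open>auto simp: inv_into_f_f\<close>)

lemma smooth_map_fst_chart:
  assumes "charts A" "charts B" "smooth_map A A (\<lambda>x. x)"
  shows "smooth_map (prod_atlas A B) A fst"
proof (rule smooth_map_localI)
  fix P \<rho> W \<theta> x assume c: "(P, \<rho>) \<in> prod_atlas A B" "(W, \<theta>) \<in> A" "x \<in> P" "fst x \<in> W"
  then obtain U \<phi> V \<psi> where uv: "P = U \<times> V" "\<rho> = map_prod \<phi> \<psi>" "(U, \<phi>) \<in> A" "(V, \<psi>) \<in> B"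
    unfolding in_prod_atlas by (elim exE conjE)
  note D = smooth_mapD[OF assms(3) uv(3) c(2)]
  note inj = charts_inj[OF assms(1) uv(3)] charts_inj[OF assms(2) uv(4)]
  define N where "N = \<phi> ` (U \<inter> W) \<times> \<psi> ` V"
  have N: "open N" using D(1) charts_open[OF assms(2) uv(4)] by (simp add: N_def open_Times)
  have "C_infinity N (\<lambda>y. (\<theta> \<circ> (\<lambda>x. x) \<circ> inv_into U \<phi>) (fst y))"
    by (rule C_infinity_compose[OF C_infinity_linear[OF bounded_linear_fst N C_infinity_id] D(2) _ N D(1)])
      (auto simp: N_def)
  then have "C_infinity N (\<theta> \<circ> fst \<circ> inv_into P \<rho>)"
    by (rule C_infinity_cong[OF N, rotated]) (auto simp: N_def uv inv_into_map_prod[OF inj])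
  then show "\<exists>N. open N \<and> \<rho> x \<in> N \<and> N \<subseteq> \<rho> ` (P \<inter> fst -` W) \<and> C_infinity N (\<theta> \<circ> fst \<circ> inv_into P \<rho>)"
    using N c by (intro exI[of _ N]) (fastforce simp: N_def uv)
qed (auto simp: points_prod_atlas)

lemma smooth_map_snd_chart:
  assumes "charts A" "charts B" "smooth_map B B (\<lambda>x. x)"
  shows "smooth_map (prod_atlas A B) B snd"
proof (rule smooth_map_localI)
  fix P \<rho> W \<theta> x assume c: "(P, \<rho>) \<in> prod_atlas A B" "(W, \<theta>) \<in> B" "x \<in> P" "snd x \<in> W"
  then obtain U \<phi> V \<psi> where uv: "P = U \<times> V" "\<rho> = map_prod \<phi> \<psi>" "(U, \<phi>) \<in> A" "(V, \<psi>) \<in> B"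
    unfolding in_prod_atlas by (elim exE conjE)
  note D = smooth_mapD[OF assms(3) uv(4) c(2)]
  note inj = charts_inj[OF assms(1) uv(3)] charts_inj[OF assms(2) uv(4)]
  define N where "N = \<phi> ` U \<times> \<psi> ` (V \<inter> W)"
  have N: "open N" using D(1) charts_open[OF assms(1) uv(3)] by (simp add: N_def open_Times)
  have "C_infinity N (\<lambda>y. (\<theta> \<circ> (\<lambda>x. x) \<circ> inv_into V \<psi>) (snd y))"
    by (rule C_infinity_compose[OF C_infinity_linear[OF bounded_linear_snd N C_infinity_id] D(2) _ N D(1)])
      (auto simp: N_def)
  then have "C_infinity N (\<theta> \<circ> snd \<circ> inv_into P \<rho>)"
    by (rule C_infinity_cong[OF N, rotated]) (auto simp: N_def uv inv_into_map_prod[OF inj])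
  then show "\<exists>N. open N \<and> \<rho> x \<in> N \<and> N \<subseteq> \<rho> ` (P \<inter> snd -` W) \<and> C_infinity N (\<theta> \<circ> snd \<circ> inv_into P \<rho>)"
    using N c by (intro exI[of _ N]) (fastforce simp: N_def uv)
qed (auto simp: points_prod_atlas)

lemma smooth_map_Pair:
  assumes "charts M" "smooth_map M A f" "smooth_map M B g"
  shows "smooth_map M (prod_atlas A B) (\<lambda>x. (f x, g x))"
proof (rule smooth_map_localI)
  show "(f x, g x) \<in> points (prod_atlas A B)" if "x \<in> points M" for x
    using that assms by (auto simp: points_prod_atlas smooth_map_into)
  fix U \<phi> P \<rho> x assume c: "(U, \<phi>) \<in> M" "(P, \<rho>) \<in> prod_atlas A B" "x \<in> U" "(f x, g x) \<in> P"
  then obtain V \<psi> W \<theta> where vw: "P = V \<times> W" "\<rho> = map_prod \<psi> \<theta>" "(V, \<psi>) \<in> A" "(W, \<theta>) \<in> B"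
    unfolding in_prod_atlas by (elim exE conjE)
  note f = smooth_mapD[OF assms(2) c(1) vw(3)] and g = smooth_mapD[OF assms(3) c(1) vw(4)]
  define N where "N = \<phi> ` (U \<inter> f -` V) \<inter> \<phi> ` (U \<inter> g -` W)"
  have N: "open N" using f(1) g(1) by (auto simp: N_def)
  have "N = \<phi> ` ((U \<inter> f -` V) \<inter> (U \<inter> g -` W))"
    unfolding N_def by (rule inj_on_image_Int[OF charts_inj[OF assms(1) c(1)], symmetric]) auto
  then have sub: "N = \<phi> ` (U \<inter> (\<lambda>x. (f x, g x)) -` P)" by (auto simp: vw intro!: image_cong)
  have "C_infinity N (\<lambda>y. ((\<psi> \<circ> f \<circ> inv_into U \<phi>) y, (\<theta> \<circ> g \<circ> inv_into U \<phi>) y))"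
    by (intro C_infinity_Pair N C_infinity_subset[OF f(2)] C_infinity_subset[OF g(2)]) (auto simp: N_def)
  then have "C_infinity N (\<rho> \<circ> (\<lambda>x. (f x, g x)) \<circ> inv_into U \<phi>)" by (simp add: vw comp_def)
  then show "\<exists>N. open N \<and> \<phi> x \<in> N \<and> N \<subseteq> \<phi> ` (U \<inter> (\<lambda>x. (f x, g x)) -` P) \<and>
      C_infinity N (\<rho> \<circ> (\<lambda>x. (f x, g x)) \<circ> inv_into U \<phi>)"
    using N c by (intro exI[of _ N]) (auto simp: sub)
qed

lemma points_pullback_atlas:
  assumes "f ` S = points A"
  shows "points (pullback_atlas f S A) = S"
proof -
  have "\<exists>U \<phi>. (U, \<phi>) \<in> A \<and> f s \<in> U" if "s \<in> S" for s using assms that by (intro point_in_chart) auto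
  then have "\<exists>P \<rho>. (P, \<rho>) \<in> pullback_atlas f S A \<and> s \<in> P" if "s \<in> S" for s
    using that unfolding in_pullback_atlas by (metis IntI vimageI)
  then show ?thesis by (auto simp: in_points_iff in_pullback_atlas)
qed

lemma pullback_chart_image:
  assumes "f ` S = points A" "U \<subseteq> points A"
  shows "(\<phi> \<circ> f) ` (S \<inter> f -` U) = \<phi> ` U"
proof -
  have "f ` (S \<inter> f -` U) = f ` S \<inter> U" by auto
  then have "f ` (S \<inter> f -` U) = U" using assms by (simp add: Int_absorb1)
  then show ?thesis by (metis image_comp)
qed

lemma charts_pullback_atlas:
  assumes "charts A" "inj_on f S" "f ` S = points A"
  shows "charts (pullback_atlas f S A)"
  unfolding charts_def
proof safe
  fix P \<rho> assume "(P, \<rho>) \<in> pullback_atlas f S A"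
  then obtain U \<phi> where u: "(U, \<phi>) \<in> A" "P = S \<inter> f -` U" "\<rho> = \<phi> \<circ> f" unfolding in_pullback_atlas by (elim exE conjE)
  show "inj_on \<rho> P" unfolding u(2,3)
    by (rule comp_inj_on) (use assms(2) charts_inj[OF assms(1) u(1)] in \<open>auto simp: inj_on_def\<close>)
  show "open (\<rho> ` P)" unfolding u(2,3) pullback_chart_image[OF assms(3) chart_subset[OF u(1)]]
    by (rule charts_open[OF assms(1) u(1)])
qed

lemma smooth_map_pullback_coords:
  assumes "charts A" "inj_on f S" "f ` S = points A" "smooth_map A A (\<lambda>x. x)"
  shows "smooth_map (pullback_atlas f S A) A f"
proof (rule smooth_map_localI)
  show "f x \<in> points A" if "x \<in> points (pullback_atlas f S A)" for x
    using that assms(3) by (auto simp: points_pullback_atlas)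
  fix P \<rho> V \<psi> x assume c: "(P, \<rho>) \<in> pullback_atlas f S A" "(V, \<psi>) \<in> A" "x \<in> P" "f x \<in> V"
  then obtain U \<phi> where u: "(U, \<phi>) \<in> A" "P = S \<inter> f -` U" "\<rho> = \<phi> \<circ> f" unfolding in_pullback_atlas by (elim exE conjE)
  note D = smooth_mapD[OF assms(4) u(1) c(2)]
  have inj: "inj_on \<rho> P" using charts_pullback_atlas[OF assms(1-3)] c(1) by (rule charts_inj)
  have im: "\<rho> ` (P \<inter> f -` V) = \<phi> ` (U \<inter> V)"
    using pullback_chart_image[OF assms(3), of "U \<inter> V" \<phi>] chart_subset[OF u(1)]
    by (auto simp: u vimage_Int Int_assoc)
  have "C_infinity (\<phi> ` (U \<inter> V)) (\<psi> \<circ> f \<circ> inv_into P \<rho>)"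
  proof (rule C_infinity_cong)
    show "open (\<phi> ` (U \<inter> V))" "C_infinity (\<phi> ` (U \<inter> V)) (\<psi> \<circ> (\<lambda>x. x) \<circ> inv_into U \<phi>)"
      using D by auto
    fix y assume "y \<in> \<phi> ` (U \<inter> V)"
    then obtain s where s: "s \<in> P" "y = \<phi> (f s)" "f s \<in> U" by (auto simp flip: im simp: u)
    then have "inv_into P \<rho> y = s" using inj by (intro inv_into_f_eq) (auto simp: u)
    then show "(\<psi> \<circ> (\<lambda>x. x) \<circ> inv_into U \<phi>) y = (\<psi> \<circ> f \<circ> inv_into P \<rho>) y"
      using s charts_inj[OF assms(1) u(1)] by (simp add: inv_into_f_f)
  qed
  then show "\<exists>N. open N \<and> \<rho> x \<in> N \<and> N \<subseteq> \<rho> ` (P \<inter> f -` V) \<and> C_infinity N (\<psi> \<circ> f \<circ> inv_into P \<rho>)"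
    using D(1) c by (intro exI[of _ "\<phi> ` (U \<inter> V)"]) (auto simp flip: im)
qed

lemma smooth_map_into_pullback:
  assumes "charts B" "g ` points B \<subseteq> S" "f ` S = points A" "smooth_map B A (\<lambda>x. f (g x))"
  shows "smooth_map B (pullback_atlas f S A) g"
proof (rule smooth_map_localI)
  show "g x \<in> points (pullback_atlas f S A)" if "x \<in> points B" for x
    using that assms(2) by (auto simp: points_pullback_atlas[OF assms(3)])
  fix U \<phi> P \<rho> x assume c: "(U, \<phi>) \<in> B" "(P, \<rho>) \<in> pullback_atlas f S A" "x \<in> U" "g x \<in> P"
  then obtain V \<psi> where v: "(V, \<psi>) \<in> A" "P = S \<inter> f -` V" "\<rho> = \<psi> \<circ> f" unfolding in_pullback_atlas by (elim exE conjE)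
  have "U \<inter> (\<lambda>x. f (g x)) -` V = U \<inter> g -` P" using assms(2) chart_subset[OF c(1)] by (auto simp: v)
  then show "\<exists>N. open N \<and> \<phi> x \<in> N \<and> N \<subseteq> \<phi> ` (U \<inter> g -` P) \<and> C_infinity N (\<rho> \<circ> g \<circ> inv_into U \<phi>)"
    using smooth_mapD[OF assms(4) c(1) v(1)] c
    by (intro exI[of _ "\<phi> ` (U \<inter> g -` P)"]) (auto simp: v comp_def)
qed

subsection \<open>The topology of a manifold\<close>

lemma openin_atlas_topology:
  assumes "charts A"
  shows "openin (atlas_topology A) W \<longleftrightarrow>
    W \<subseteq> points A \<and> (\<forall>U \<phi>. (U, \<phi>) \<in> A \<longrightarrow> open (\<phi> ` (U \<inter> W)))"
proof -
  have "istopology (\<lambda>W. W \<subseteq> points A \<and> (\<forall>(U, \<phi>)\<in>A. open (\<phi> ` (U \<inter> W))))"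
    unfolding istopology_def
  proof (intro conjI allI impI)
    fix S T assume S: "S \<subseteq> points A \<and> (\<forall>(U, \<phi>)\<in>A. open (\<phi> ` (U \<inter> S)))"
      and T: "T \<subseteq> points A \<and> (\<forall>(U, \<phi>)\<in>A. open (\<phi> ` (U \<inter> T)))"
    show "S \<inter> T \<subseteq> points A" using S by blast
    show "\<forall>(U, \<phi>)\<in>A. open (\<phi> ` (U \<inter> (S \<inter> T)))"
    proof clarify
      fix U \<phi> assume u: "(U, \<phi>) \<in> A"
      have "\<phi> ` ((U \<inter> S) \<inter> (U \<inter> T)) = \<phi> ` (U \<inter> S) \<inter> \<phi> ` (U \<inter> T)"
        by (rule inj_on_image_Int[OF charts_inj[OF assms u]]) auto
      moreover have "(U \<inter> S) \<inter> (U \<inter> T) = U \<inter> (S \<inter> T)" by blast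
      ultimately show "open (\<phi> ` (U \<inter> (S \<inter> T)))" using S T u by (auto simp: open_Int)
    qed
  next
    fix \<K> assume K: "\<forall>K\<in>\<K>. K \<subseteq> points A \<and> (\<forall>(U, \<phi>)\<in>A. open (\<phi> ` (U \<inter> K)))"
    show "\<Union> \<K> \<subseteq> points A" using K by blast
    show "\<forall>(U, \<phi>)\<in>A. open (\<phi> ` (U \<inter> \<Union> \<K>))"
    proof clarify
      fix U \<phi> assume u: "(U, \<phi>) \<in> A"
      have "\<phi> ` (U \<inter> \<Union> \<K>) = (\<Union>K\<in>\<K>. \<phi> ` (U \<inter> K))" by blast
      moreover have "open (\<phi> ` (U \<inter> K))" if "K \<in> \<K>" for K using bspec[OF K that] u by auto
      ultimately show "open (\<phi> ` (U \<inter> \<Union> \<K>))" by (simp add: open_UN)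
    qed
  qed
  then show ?thesis unfolding atlas_topology_def by (simp add: split_beta) auto
qed

lemma topspace_atlas_topology:
  assumes "charts A"
  shows "topspace (atlas_topology A) = points A"
proof -
  have "openin (atlas_topology A) (points A)"
    using charts_open[OF assms] chart_subset
    by (fastforce simp: openin_atlas_topology[OF assms] Int_absorb2)
  then show ?thesis
    using openin_atlas_topology[OF assms] by (metis openin_subset openin_topspace subset_antisym)
qed

text \<open>Charts are homeomorphisms onto their images: continuity comes from the transition maps.\<close>

lemma openin_chart_preimage:
  assumes "charts A" "smooth_map A A (\<lambda>x. x)" "(U, \<phi>) \<in> A" "open T"
  shows "openin (atlas_topology A) (U \<inter> \<phi> -` T)"
  unfolding openin_atlas_topology[OF assms(1)]
proof safe
  fix V \<psi> assume v: "(V, \<psi>) \<in> A"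
  note D = smooth_mapD[OF assms(2) v assms(3)]
  have "\<psi> ` (V \<inter> (U \<inter> \<phi> -` T)) = \<psi> ` (V \<inter> (\<lambda>x. x) -` U) \<inter> (\<phi> \<circ> (\<lambda>x. x) \<circ> inv_into V \<psi>) -` T"
    using charts_inj[OF assms(1) v] by (auto simp: inv_into_f_f)
  also have "open \<dots>" by (rule continuous_open_preimage[OF C_infinity_imp_continuous[OF D(2)] D(1) assms(4)])
  finally show "open (\<psi> ` (V \<inter> (U \<inter> \<phi> -` T)))" .
qed (use chart_subset[OF assms(3)] in auto)

lemma atlas_topology_prod:
  assumes A: "charts A" "smooth_map A A (\<lambda>x. x)" and B: "charts B" "smooth_map B B (\<lambda>x. x)"
  shows "atlas_topology (prod_atlas A B) = prod_topology (atlas_topology A) (atlas_topology B)"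
  unfolding topology_eq
proof
  fix W
  note op = openin_atlas_topology[OF A(1)] openin_atlas_topology[OF B(1)]
    openin_atlas_topology[OF charts_prod_atlas[OF A(1) B(1)]]
  show "openin (atlas_topology (prod_atlas A B)) W \<longleftrightarrow>
    openin (prod_topology (atlas_topology A) (atlas_topology B)) W"
  proof
    assume W: "openin (atlas_topology (prod_atlas A B)) W"
    show "openin (prod_topology (atlas_topology A) (atlas_topology B)) W"
      unfolding openin_prod_topology_alt
    proof (intro allI impI)
      fix x y assume xy: "(x, y) \<in> W"
      then have "x \<in> points A" "y \<in> points B" using W by (auto simp: op points_prod_atlas)
      then obtain U \<phi> V \<psi> where u: "(U, \<phi>) \<in> A" "x \<in> U" and v: "(V, \<psi>) \<in> B" "y \<in> V"
        by (metis point_in_chart)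
      have "(U \<times> V, map_prod \<phi> \<psi>) \<in> prod_atlas A B" using u v by (auto simp: prod_atlas_def)
      then have "open (map_prod \<phi> \<psi> ` ((U \<times> V) \<inter> W))" using W by (auto simp: op)
      moreover have "(\<phi> x, \<psi> y) \<in> map_prod \<phi> \<psi> ` ((U \<times> V) \<inter> W)" using xy u v by force
      ultimately obtain S T where st: "open S" "open T" "\<phi> x \<in> S" "\<psi> y \<in> T"
        "S \<times> T \<subseteq> map_prod \<phi> \<psi> ` ((U \<times> V) \<inter> W)" unfolding open_prod_def by (metis mem_Sigma_iff)
      have "(a, b) \<in> W" if "a \<in> U" "\<phi> a \<in> S" "b \<in> V" "\<psi> b \<in> T" for a b
      proof -
        have "(\<phi> a, \<psi> b) \<in> map_prod \<phi> \<psi> ` ((U \<times> V) \<inter> W)" using st(5) that by blast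
        then obtain a' b' where "(a', b') \<in> W" "a' \<in> U" "b' \<in> V" "\<phi> a' = \<phi> a" "\<psi> b' = \<psi> b" by auto
        then show ?thesis
          using charts_inj[OF A(1) u(1)] charts_inj[OF B(1) v(1)] that by (auto simp: inj_on_def)
      qed
      then have "(U \<inter> \<phi> -` S) \<times> (V \<inter> \<psi> -` T) \<subseteq> W" by auto
      then show "\<exists>U V. openin (atlas_topology A) U \<and> openin (atlas_topology B) V \<and>
          x \<in> U \<and> y \<in> V \<and> U \<times> V \<subseteq> W"
        using openin_chart_preimage[OF A u(1) st(1)] openin_chart_preimage[OF B v(1) st(2)] u v st
        by (intro exI[of _ "U \<inter> \<phi> -` S"] exI[of _ "V \<inter> \<psi> -` T"]) auto
    qed
  next
    assume W: "openin (prod_topology (atlas_topology A) (atlas_topology B)) W"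
    have rect: "openin (atlas_topology (prod_atlas A B)) (S \<times> T)"
      if "openin (atlas_topology A) S" "openin (atlas_topology B) T" for S T
      unfolding op
    proof safe
      fix P \<rho> assume "(P, \<rho>) \<in> prod_atlas A B"
      then obtain U \<phi> V \<psi> where uv: "P = U \<times> V" "\<rho> = map_prod \<phi> \<psi>" "(U, \<phi>) \<in> A" "(V, \<psi>) \<in> B"
        unfolding in_prod_atlas by (elim exE conjE)
      have "\<rho> ` (P \<inter> S \<times> T) = \<phi> ` (U \<inter> S) \<times> \<psi> ` (V \<inter> T)" by (force simp: uv)
      then show "open (\<rho> ` (P \<inter> S \<times> T))" using that uv by (auto simp: op open_Times)
    qed (use that in \<open>auto simp: op points_prod_atlas\<close>)
    have "\<forall>z\<in>W. \<exists>T. openin (atlas_topology (prod_atlas A B)) T \<and> z \<in> T \<and> T \<subseteq> W"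
    proof
      fix z assume "z \<in> W"
      then have "\<exists>U V. openin (atlas_topology A) U \<and> openin (atlas_topology B) V \<and>
          fst z \<in> U \<and> snd z \<in> V \<and> U \<times> V \<subseteq> W"
        using W unfolding openin_prod_topology_alt by (metis prod.collapse)
      then show "\<exists>T. openin (atlas_topology (prod_atlas A B)) T \<and> z \<in> T \<and> T \<subseteq> W"
        using rect by (metis mem_Times_iff)
    qed
    then show "openin (atlas_topology (prod_atlas A B)) W" by (subst openin_subopen) blast
  qed
qed

lemma second_countable_prod_topology:
  assumes "second_countable X" "second_countable Y"
  shows "second_countable (prod_topology X Y)"
proof -
  obtain \<A> where A: "countable \<A>" "\<And>V. V \<in> \<A> \<Longrightarrow> openin X V"
    "\<And>U x. openin X U \<Longrightarrow> x \<in> U \<Longrightarrow> \<exists>V\<in>\<A>. x \<in> V \<and> V \<subseteq> U"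
    using assms(1) unfolding second_countable_def by metis
  obtain \<B> where B: "countable \<B>" "\<And>V. V \<in> \<B> \<Longrightarrow> openin Y V"
    "\<And>U x. openin Y U \<Longrightarrow> x \<in> U \<Longrightarrow> \<exists>V\<in>\<B>. x \<in> V \<and> V \<subseteq> U"
    using assms(2) unfolding second_countable_def by metis
  let ?C = "(\<lambda>(S, T). S \<times> T) ` (\<A> \<times> \<B>)"
  have "\<exists>V\<in>?C. z \<in> V \<and> V \<subseteq> W" if W: "openin (prod_topology X Y) W" "z \<in> W" for W z
  proof -
    obtain x y where z: "z = (x, y)" by (cases z)
    obtain U V where uv: "openin X U" "openin Y V" "x \<in> U" "y \<in> V" "U \<times> V \<subseteq> W"
      using W unfolding openin_prod_topology_alt z by metis
    obtain S T where st: "S \<in> \<A>" "x \<in> S" "S \<subseteq> U" "T \<in> \<B>" "y \<in> T" "T \<subseteq> V"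
      using A(3)[OF uv(1,3)] B(3)[OF uv(2,4)] by metis
    have "S \<times> T \<in> ?C" "z \<in> S \<times> T" using st z by auto
    moreover have "S \<times> T \<subseteq> W" using st uv(5) by blast
    ultimately show ?thesis by blast
  qed
  moreover have "countable ?C" using A(1) B(1) by auto
  moreover have "\<forall>V\<in>?C. openin (prod_topology X Y) V" using A(2) B(2) by (auto simp: openin_prod_Times_iff)
  ultimately show ?thesis unfolding second_countable_def by blast
qed

text \<open>Compatibility of the charts is the same condition as smoothness of the identity. Being a manifold is
  thereby inherited by products and pullbacks through the rules for smooth maps into and out of them.\<close>

lemma smooth_manifold_iff:
  "smooth_manifold A \<longleftrightarrow> charts A \<and> smooth_map A A (\<lambda>x. x) \<and>
     Hausdorff_space (atlas_topology A) \<and> second_countable (atlas_topology A)"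
  by (simp add: smooth_manifold_def charts_def smooth_map_def vimage_def comp_def Int_def)

lemma manifold_charts: "smooth_manifold A \<Longrightarrow> charts A"
  and smooth_map_id: "smooth_manifold A \<Longrightarrow> smooth_map A A (\<lambda>x. x)"
  by (simp_all add: smooth_manifold_iff)

lemma smooth_manifold_prod:
  assumes "smooth_manifold A" "smooth_manifold B"
  shows "smooth_manifold (prod_atlas A B)"
proof -
  note A = assms(1)[unfolded smooth_manifold_iff] and B = assms(2)[unfolded smooth_manifold_iff]
  have c: "charts (prod_atlas A B)" using A B charts_prod_atlas by blast
  have "smooth_map (prod_atlas A B) (prod_atlas A B) (\<lambda>x. (fst x, snd x))"
    using A B by (intro smooth_map_Pair[OF c] smooth_map_fst_chart smooth_map_snd_chart) auto
  with c A B show ?thesis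
    by (simp add: smooth_manifold_iff atlas_topology_prod Hausdorff_space_prod_topology second_countable_prod_topology)
qed

lemma smooth_manifold_pullback:
  assumes "smooth_manifold A" "bij_betw f S (points A)"
  shows "smooth_manifold (pullback_atlas f S A)"
proof -
  let ?P = "pullback_atlas f S A"
  note A = assms(1)[unfolded smooth_manifold_iff]
  have f: "inj_on f S" "f ` S = points A" using assms(2) by (auto simp: bij_betw_def)
  have c: "charts ?P" using A f by (intro charts_pullback_atlas) auto
  have "smooth_map ?P A f" using A f by (intro smooth_map_pullback_coords) auto
  then have id: "smooth_map ?P ?P (\<lambda>x. x)"
    using f by (intro smooth_map_into_pullback c) (auto simp: points_pullback_atlas)
  have pP: "points ?P = S" using f by (intro points_pullback_atlas)
  have op: "openin (atlas_topology ?P) W \<longleftrightarrow> openin (atlas_topology A) (f ` W)" if "W \<subseteq> S" for W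
  proof -
    have "f ` (S \<inter> f -` U \<inter> W) = U \<inter> f ` W" for U using that by auto
    then have im: "(\<phi> \<circ> f) ` (S \<inter> f -` U \<inter> W) = \<phi> ` (U \<inter> f ` W)" for U \<phi> by (metis image_comp)
    have "(\<forall>U \<phi>. (U, \<phi>) \<in> ?P \<longrightarrow> open (\<phi> ` (U \<inter> W))) \<longleftrightarrow>
        (\<forall>U \<phi>. (U, \<phi>) \<in> A \<longrightarrow> open (\<phi> ` (U \<inter> f ` W)))"
      unfolding in_pullback_atlas im[symmetric] by blast
    moreover have "f ` W \<subseteq> points A" using that f(2) by blast
    ultimately show ?thesis
      using that A by (simp add: openin_atlas_topology c pP)
  qed
  have "homeomorphic_map (atlas_topology ?P) (atlas_topology A) f"
  proof (rule bijective_open_imp_homeomorphic_map)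
    have top: "topspace (atlas_topology ?P) = S" "topspace (atlas_topology A) = points A"
      using A c by (simp_all add: topspace_atlas_topology pP)
    show "f ` topspace (atlas_topology ?P) = topspace (atlas_topology A)"
      "inj_on f (topspace (atlas_topology ?P))" using f by (simp_all add: top)
    show "open_map (atlas_topology ?P) (atlas_topology A) f"
      unfolding open_map_def using op openin_subset[of "atlas_topology ?P"] by (auto simp: top)
    show "continuous_map (atlas_topology ?P) (atlas_topology A) f"
      unfolding continuous_map_def top
    proof (intro conjI allI impI)
      fix V assume V: "openin (atlas_topology A) V"
      then have "V \<subseteq> f ` S" using openin_subset[OF V] f(2) by (simp add: top)
      then have "f ` {x \<in> S. f x \<in> V} = V" by blast
      then show "openin (atlas_topology ?P) {x \<in> S. f x \<in> V}" using V by (subst op) auto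
    qed (use f(2) in auto)
  qed
  then have "atlas_topology ?P homeomorphic_space atlas_topology A"
    by (meson homeomorphic_map_imp_homeomorphic_space)
  with A c id show ?thesis
    by (simp add: smooth_manifold_iff homeomorphic_Hausdorff_space homeomorphic_space_second_countability)
qed

lemma points_vec_atlas [simp]: "points vec_atlas = UNIV"
  by (auto simp: points_def vec_atlas_def)

lemma charts_vec_atlas: "charts vec_atlas"
  by (auto simp: charts_def vec_atlas_def)

lemma inv_into_ident [simp]: "inv_into UNIV (\<lambda>x. x) = (\<lambda>x. x)"
  by (rule ext) (simp add: inv_into_f_eq)

lemma smooth_map_to_vec:
  "smooth_map A vec_atlas f \<longleftrightarrow> (\<forall>(U, \<phi>)\<in>A. open (\<phi> ` U) \<and> C_infinity (\<phi> ` U) (f \<circ> inv_into U \<phi>))"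
proof -
  have "f ` points A \<subseteq> points vec_atlas" by simp
  then show ?thesis unfolding smooth_map_def by (simp add: vec_atlas_def comp_def)
qed

lemma smooth_map_from_vec:
  "smooth_map vec_atlas A f \<longleftrightarrow> range f \<subseteq> points A \<and> (\<forall>(U, \<phi>)\<in>A. open (f -` U) \<and> C_infinity (f -` U) (\<phi> \<circ> f))"
  unfolding smooth_map_def points_vec_atlas by (simp add: vec_atlas_def comp_def)

lemma smooth_map_vec_vec: "smooth_map vec_atlas vec_atlas f \<longleftrightarrow> C_infinity UNIV f"
  unfolding smooth_map_to_vec by (simp add: vec_atlas_def comp_def)

lemma smooth_manifold_vec: "smooth_manifold (vec_atlas :: ('e::finite_dim_normed, 'e) atlas)"
proof -
  have "atlas_topology vec_atlas = (euclidean :: 'e topology)"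
    unfolding topology_eq openin_atlas_topology[OF charts_vec_atlas] points_vec_atlas
    by (simp add: vec_atlas_def)
  then show ?thesis
    by (simp add: smooth_manifold_iff charts_vec_atlas smooth_map_vec_vec C_infinity_id second_countable_euclidean)
qed

lemma prod_vec_atlas: "prod_atlas vec_atlas vec_atlas = vec_atlas"
  by (auto simp: prod_atlas_def vec_atlas_def map_prod_def)

lemma smooth_map_fst: "smooth_manifold A \<Longrightarrow> smooth_manifold B \<Longrightarrow> smooth_map (prod_atlas A B) A fst"
  by (simp add: smooth_map_fst_chart smooth_manifold_iff)

lemma smooth_map_snd: "smooth_manifold A \<Longrightarrow> smooth_manifold B \<Longrightarrow> smooth_map (prod_atlas A B) B snd"
  by (simp add: smooth_map_snd_chart smooth_manifold_iff)

lemma smooth_map_vec_compose: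
  assumes "charts M" "C_infinity UNIV F" "smooth_map M vec_atlas f"
  shows "smooth_map M vec_atlas (\<lambda>x. F (f x))"
  using assms(2) by (intro smooth_map_compose[OF assms(1) charts_vec_atlas assms(3)])
    (simp add: smooth_map_vec_vec)

lemma smooth_map_bilinear:
  fixes p :: "'b::finite_dim_normed \<Rightarrow> 'c::finite_dim_normed \<Rightarrow> 'd::finite_dim_normed"
  assumes "charts M" "bounded_bilinear p" "smooth_map M vec_atlas f" "smooth_map M vec_atlas g"
  shows "smooth_map M vec_atlas (\<lambda>x. p (f x) (g x))"
proof -
  have "smooth_map M vec_atlas (\<lambda>x. (f x, g x))"
    using smooth_map_Pair[OF assms(1,3,4)] by (simp add: prod_vec_atlas)
  moreover have "C_infinity UNIV (\<lambda>z. p (fst z) (snd z))"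
    by (intro C_infinity_bilinear[OF assms(2)] C_infinity_linear[OF bounded_linear_fst]
        C_infinity_linear[OF bounded_linear_snd] C_infinity_id open_UNIV)
  ultimately show ?thesis using smooth_map_vec_compose[OF assms(1)] by fastforce
qed

lemma smooth_map_add:
  assumes "charts M" "smooth_map M vec_atlas f" "smooth_map M vec_atlas g"
  shows "smooth_map M vec_atlas (\<lambda>x. f x + g x)"
proof -
  have "smooth_map M vec_atlas (\<lambda>x. (f x, g x))"
    using smooth_map_Pair[OF assms] by (simp add: prod_vec_atlas)
  moreover have "C_infinity UNIV (\<lambda>z. fst z + snd z)"
    by (intro C_infinity_add C_infinity_linear[OF bounded_linear_fst]
        C_infinity_linear[OF bounded_linear_snd] C_infinity_id open_UNIV)
  ultimately show ?thesis using smooth_map_vec_compose[OF assms(1)] by fastforce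
qed

lemma smooth_map_sum:
  assumes "charts M" "\<And>i. i \<in> I \<Longrightarrow> smooth_map M vec_atlas (f i)"
  shows "smooth_map M vec_atlas (\<lambda>x. \<Sum>i\<in>I. f i x)"
  using assms(2)
  by (induction I rule: infinite_finite_induct)
    (auto intro: smooth_map_const[OF assms(1)] smooth_map_add[OF assms(1)])

lemma smooth_map_linear:
  fixes L :: "'b::finite_dim_normed \<Rightarrow> 'c::finite_dim_normed"
  assumes "charts M" "linear L" "smooth_map M vec_atlas f"
  shows "smooth_map M vec_atlas (\<lambda>x. L (f x))"
  by (rule smooth_map_vec_compose[OF assms(1) _ assms(3)])
    (intro C_infinity_linear[OF linear_imp_bounded_linear[OF assms(2)]] C_infinity_id open_UNIV)

text \<open>In a basis, a functional is a linear combination, with its values on the basis as coefficients, of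
  the coordinate functionals.\<close>

lemma smooth_map_blinfunI:
  fixes F :: "'p \<Rightarrow> ('w::finite_dim_normed \<Rightarrow>\<^sub>L real)"
  assumes "charts M" "\<And>V. smooth_map M vec_atlas (\<lambda>x. blinfun_apply (F x) V)"
  shows "smooth_map M vec_atlas F"
proof -
  obtain B :: "'w set" and k where B: "finite B" "\<And>b. bounded_linear (k b)"
    "\<And>x. (\<Sum>b\<in>B. k b x *\<^sub>R b) = x" using finite_dim_coordinates by blast
  have "F x = (\<Sum>b\<in>B. blinfun_apply (F x) b *\<^sub>R Blinfun (k b))" for x
  proof (rule blinfun_eqI)
    fix y
    show "blinfun_apply (F x) y = blinfun_apply (\<Sum>b\<in>B. blinfun_apply (F x) b *\<^sub>R Blinfun (k b)) y"
      by (subst B(3)[symmetric, of y])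
        (simp add: blinfun.sum_left blinfun.sum_right blinfun.scaleR_left blinfun.scaleR_right
          bounded_linear_Blinfun_apply[OF B(2)] mult.commute)
  qed
  then have "F = (\<lambda>x. \<Sum>b\<in>B. blinfun_apply (F x) b *\<^sub>R Blinfun (k b))" by blast
  moreover have "smooth_map M vec_atlas (\<lambda>x. \<Sum>b\<in>B. blinfun_apply (F x) b *\<^sub>R Blinfun (k b))"
    by (intro smooth_map_sum smooth_map_linear[where L = "\<lambda>r. r *\<^sub>R Blinfun (k b)" for b] assms)
      (auto intro!: linearI simp: scaleR_add_left)
  ultimately show ?thesis by simp
qed

subsection \<open>Submersions and maps on subsets\<close>

text \<open>A smooth map on the whole manifold serves as the local extension at every point of \<open>P\<close>.\<close>

lemma smooth_map_onI:
  assumes "smooth_manifold A" "smooth_map A B F" "P \<subseteq> points A" "\<And>x. x \<in> P \<Longrightarrow> F x = f x"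
  shows "smooth_map_on A B P f"
  unfolding smooth_map_on_def
proof (intro conjI ballI)
  show "f ` P \<subseteq> points B" using assms smooth_map_into[OF assms(2)] by force
  fix x assume x: "x \<in> P"
  have "(U, \<phi>) \<in> restrict_atlas A (points A) \<longleftrightarrow> (U, \<phi>) \<in> A" for U \<phi>
    unfolding restrict_atlas_def using chart_subset[of _ \<phi> A] by (auto simp: Int_absorb2)
  then have "restrict_atlas A (points A) = A" by auto
  moreover have "openin (atlas_topology A) (points A)"
    using topspace_atlas_topology[OF manifold_charts[OF assms(1)]] openin_topspace by metis
  ultimately show "\<exists>W F. openin (atlas_topology A) W \<and> x \<in> W \<and> smooth_map (restrict_atlas A W) B F \<and>
      (\<forall>y\<in>P \<inter> W. F y = f y)"
    using x assms by (intro exI[of _ "points A"] exI[of _ F]) auto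
qed (fact assms)

text \<open>Through every point there passes a smooth section; a convenient way to obtain submersions, because
  the sections needed later are given by formulas.\<close>

definition sectioned :: "('p, 'e::finite_dim_normed) atlas \<Rightarrow> ('q, 'f::finite_dim_normed) atlas \<Rightarrow>
    ('p \<Rightarrow> 'q) \<Rightarrow> bool" where
  "sectioned A B f \<longleftrightarrow> smooth_map A B f \<and>
     (\<forall>x\<in>points A. \<exists>s. smooth_map B A s \<and> s (f x) = x \<and> (\<forall>b\<in>points B. f (s b) = b))"

lemma sectionedI:
  assumes "smooth_map A B f" "\<And>x. x \<in> points A \<Longrightarrow> smooth_map B A (s x)"
    "\<And>x. x \<in> points A \<Longrightarrow> s x (f x) = x" "\<And>x b. x \<in> points A \<Longrightarrow> b \<in> points B \<Longrightarrow> f (s x b) = b"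
  shows "sectioned A B f"
  using assms unfolding sectioned_def by blast

text \<open>By the chain rule the derivative of the section is a right inverse of the derivative of \<open>f\<close>.\<close>

lemma sectioned_imp_submersion:
  assumes "charts A" "charts B" "sectioned A B f"
  shows "submersion A B f"
  unfolding submersion_def
proof (intro conjI ballI; clarify?)
  show f: "smooth_map A B f" using assms(3) by (simp add: sectioned_def)
  fix U \<phi> V \<psi> x assume c: "(U, \<phi>) \<in> A" "(V, \<psi>) \<in> B" "x \<in> U" "f x \<in> V"
  have "x \<in> points A" using c chart_subset by blast
  then obtain s where s: "smooth_map B A s" "s (f x) = x" "\<And>b. b \<in> points B \<Longrightarrow> f (s b) = b"
    using assms(3) unfolding sectioned_def by blast
  note df = smooth_mapD[OF f c(1,2)] and ds = smooth_mapD[OF s(1) c(2,1)]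
  note inv = inv_into_f_f[OF charts_inj[OF assms(1) c(1)]] inv_into_f_f[OF charts_inj[OF assms(2) c(2)]]
  let ?F = "\<psi> \<circ> f \<circ> inv_into U \<phi>" and ?S = "\<phi> \<circ> s \<circ> inv_into V \<psi>" and ?y = "\<psi> (f x)"
  let ?D = "\<psi> ` (V \<inter> s -` U)"
  have y: "?y \<in> ?D" "?S ?y = \<phi> x" using c s(2) by (auto simp: inv)
  have "(?S has_derivative frechet_derivative ?S (at ?y)) (at ?y)"
    by (rule C_infinity_has_derivative[OF ds(2) y(1)])
  moreover have "(?F has_derivative frechet_derivative ?F (at (\<phi> x))) (at (?S ?y))"
    unfolding y(2) by (rule C_infinity_has_derivative[OF df(2)]) (use c in auto)
  ultimately have "((\<lambda>z. ?F (?S z)) has_derivative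
      (\<lambda>v. frechet_derivative ?F (at (\<phi> x)) (frechet_derivative ?S (at ?y) v))) (at ?y)"
    by (rule has_derivative_compose)
  moreover have "((\<lambda>z. ?F (?S z)) has_derivative (\<lambda>v. v)) (at ?y)"
  proof (rule has_derivative_transform_within_open[OF _ ds(1) y(1)])
    show "((\<lambda>z. z) has_derivative (\<lambda>v. v)) (at ?y)" by (rule has_derivative_ident)
    show "z = ?F (?S z)" if "z \<in> ?D" for z
      using that s(3) chart_subset[OF c(2)] by (auto simp: inv subset_iff)
  qed
  ultimately have "(\<lambda>v. frechet_derivative ?F (at (\<phi> x)) (frechet_derivative ?S (at ?y) v)) = (\<lambda>v. v)"
    by (rule has_derivative_unique)
  then show "surj (frechet_derivative ?F (at (\<phi> x)))" by (metis surjI)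
qed

text \<open>Meant for the inversion \<open>i\<close> of a groupoid, which exchanges source and target.\<close>

lemma sectioned_compose_involution:
  assumes "charts A" "charts B" "sectioned A B f" "smooth_map A A i" "\<And>x. x \<in> points A \<Longrightarrow> i (i x) = x"
    "\<And>x. x \<in> points A \<Longrightarrow> g x = f (i x)"
  shows "sectioned A B g"
  unfolding sectioned_def
proof (intro conjI ballI)
  have f: "smooth_map A B f" using assms(3) by (simp add: sectioned_def)
  have "smooth_map A B (\<lambda>x. f (i x))" by (rule smooth_map_compose[OF assms(1,1,4) f])
  then show "smooth_map A B g" by (rule smooth_map_cong[OF assms(1), rotated]) (simp add: assms(6))
  fix x assume x: "x \<in> points A"
  then have "i x \<in> points A" using assms(4) by (rule smooth_map_into[rotated])
  then obtain s where s: "smooth_map B A s" "s (f (i x)) = i x" "\<And>b. b \<in> points B \<Longrightarrow> f (s b) = b"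
    using assms(3) unfolding sectioned_def by blast
  have "smooth_map B A (\<lambda>b. i (s b))" by (rule smooth_map_compose[OF assms(2,1) s(1) assms(4)])
  then show "\<exists>s. smooth_map B A s \<and> s (g x) = x \<and> (\<forall>b\<in>points B. g (s b) = b)"
    using x s assms(4-6) by (intro exI[of _ "\<lambda>b. i (s b)"]) (simp add: smooth_map_into)
qed

section \<open>Lie groupoids with globally given structure maps\<close>

lemma is_inverse_sym:
  assumes "x \<in> arrows \<G>" "is_inverse \<G> x y"
  shows "is_inverse \<G> y x"
  using assms by (auto simp: is_inverse_def)

lemma is_inverse_unique:
  assumes \<G>: "is_groupoid \<G>" and x: "x \<in> arrows \<G>" and y: "is_inverse \<G> x y" and z: "is_inverse \<G> x z"
  shows "y = z"
proof -
  have c: "(y, x) \<in> composable \<G>" "(x, z) \<in> composable \<G>"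
    using x y z by (auto simp: composable_def is_inverse_def)
  have "comp_arr \<G> (comp_arr \<G> y x) z = comp_arr \<G> y (comp_arr \<G> x z)"
    using \<G> c unfolding is_groupoid_def by blast
  moreover have "comp_arr \<G> (ident \<G> (target \<G> z)) z = z" "comp_arr \<G> y (ident \<G> (source \<G> y)) = y"
    using \<G> y z unfolding is_groupoid_def is_inverse_def by blast+
  ultimately show ?thesis using y z by (simp add: is_inverse_def)
qed

lemma inv_arr_eq:
  assumes "is_groupoid \<G>" "x \<in> arrows \<G>" "is_inverse \<G> x y"
  shows "inv_arr \<G> x = y"
  unfolding inv_arr_def
  using assms(3) is_inverse_unique[OF assms(1,2) _ assms(3)] by (rule the_equality)

text \<open>The multiplication is given by a formula that is smooth on all pairs of arrows, and is restricted to
  the composable ones. Inversion turns sections of the source into sections of the target and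
  conversely.\<close>

lemma lie_groupoidI:
  assumes "is_groupoid \<G>"
    and A: "smooth_manifold A" "points A = arrows \<G>" and B: "smooth_manifold B" "points B = objects \<G>"
    and inv: "\<And>x. x \<in> arrows \<G> \<Longrightarrow> is_inverse \<G> x (i x)" "smooth_map A A i"
    and sec: "sectioned A B (source \<G>) \<or> sectioned A B (target \<G>)"
    and "smooth_map B A (ident \<G>)" "smooth_map (prod_atlas A A) A (\<lambda>z. comp_arr \<G> (fst z) (snd z))"
  shows "lie_groupoid \<G> A B"
proof -
  note ch = manifold_charts[OF A(1)] manifold_charts[OF B(1)]
  have eq: "inv_arr \<G> x = i x" if "x \<in> points A" for x
    using assms(1) inv(1) that A(2) by (intro inv_arr_eq) auto
  have i2: "i (i x) = x" if "x \<in> points A" for x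
  proof -
    have x: "x \<in> arrows \<G>" "is_inverse \<G> x (i x)" using that inv(1) A(2) by auto
    then have ix: "i x \<in> arrows \<G>" by (simp add: is_inverse_def)
    show ?thesis by (rule is_inverse_unique[OF assms(1) ix inv(1)[OF ix] is_inverse_sym[OF x]])
  qed
  have st: "source \<G> x = target \<G> (i x)" "target \<G> x = source \<G> (i x)" if "x \<in> points A" for x
    using inv(1)[of x] that A(2) by (auto simp: is_inverse_def)
  have "sectioned A B (source \<G>)" if "sectioned A B (target \<G>)"
    by (rule sectioned_compose_involution[where i = i, OF ch that]) (use inv(2) i2 st in auto)
  moreover have "sectioned A B (target \<G>)" if "sectioned A B (source \<G>)"
    by (rule sectioned_compose_involution[where i = i, OF ch that]) (use inv(2) i2 st in auto)
  ultimately have "submersion A B (target \<G>)" "submersion A B (source \<G>)"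
    using sec sectioned_imp_submersion[OF ch] by metis+
  moreover have "smooth_map A A (inv_arr \<G>)"
    by (rule smooth_map_cong[OF ch(1) _ inv(2)]) (simp add: eq)
  moreover have "smooth_map_on (prod_atlas A A) A (composable \<G>) (\<lambda>(x, y). comp_arr \<G> x y)"
    by (rule smooth_map_onI[OF smooth_manifold_prod[OF A(1) A(1)] assms(10)])
      (auto simp: composable_def points_prod_atlas A)
  ultimately show ?thesis using assms by (simp add: lie_groupoid_def)
qed

section \<open>Velocities of curves\<close>

lemma curve_has_velocity:
  assumes "smooth_map vec_atlas A \<gamma>" "(U, \<phi>) \<in> A" "\<gamma> t \<in> U"
  shows "((\<phi> \<circ> \<gamma>) has_vector_derivative vector_derivative (\<phi> \<circ> \<gamma>) (at t)) (at t)"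
proof -
  have "C_infinity (\<gamma> -` U) (\<phi> \<circ> \<gamma>)" using assms by (auto simp: smooth_map_from_vec)
  then have "(\<phi> \<circ> \<gamma>) differentiable (at t)" by (rule C_infinity_imp_differentiable) (use assms in auto)
  then show ?thesis by (simp add: vector_derivative_works)
qed

text \<open>One chart suffices to compare velocities, since transition maps, and smooth maps in general, act on
  velocities through their derivative. The curves are assumed to be smooth so that they stay in the
  chart for small times; a derivative of the coordinate expression alone would not ensure this.\<close>

lemma same_velocity_pushI:
  assumes A: "charts A" and \<gamma>: "smooth_map vec_atlas A \<gamma>" and \<delta>: "smooth_map vec_atlas A \<delta>"
    and eq: "\<gamma> 0 = \<delta> 0" and c: "(U, \<phi>) \<in> A" "\<gamma> 0 \<in> U"
    and v: "((\<phi> \<circ> \<gamma>) has_vector_derivative v) (at 0)" "((\<phi> \<circ> \<delta>) has_vector_derivative v) (at 0)"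
    and f: "smooth_map A B f"
  shows "same_velocity B (\<lambda>t. f (\<gamma> t)) (\<lambda>t. f (\<delta> t))"
  unfolding same_velocity_def
proof (intro conjI ballI; clarify?)
  show "f (\<gamma> 0) = f (\<delta> 0)" by (simp add: eq)
  fix V \<psi> assume V: "(V, \<psi>) \<in> B" "f (\<gamma> 0) \<in> V"
  note D = smooth_mapD[OF f c(1) V(1)]
  let ?F = "\<psi> \<circ> f \<circ> inv_into U \<phi>"
  have F: "(?F has_derivative frechet_derivative ?F (at (\<phi> (\<gamma> 0)))) (at (\<phi> (\<gamma> 0)))"
    by (rule C_infinity_has_derivative[OF D(2)]) (use c V in auto)
  have "((\<psi> \<circ> (\<lambda>t. f (\<epsilon> t))) has_vector_derivative frechet_derivative ?F (at (\<phi> (\<gamma> 0))) v) (at 0)"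
    if \<epsilon>: "smooth_map vec_atlas A \<epsilon>" "\<epsilon> 0 = \<gamma> 0" "((\<phi> \<circ> \<epsilon>) has_vector_derivative v) (at 0)" for \<epsilon>
  proof (rule has_vector_derivative_transform_within_open)
    show "((\<lambda>t. ?F ((\<phi> \<circ> \<epsilon>) t)) has_vector_derivative frechet_derivative ?F (at (\<phi> (\<gamma> 0))) v) (at 0)"
      by (rule has_vector_derivative_compose[OF \<epsilon>(3)]) (unfold comp_apply[of \<phi> \<epsilon>] \<epsilon>(2), rule F)
    show "open (\<epsilon> -` U)" using \<epsilon>(1) c(1) by (auto simp: smooth_map_from_vec)
    show "?F ((\<phi> \<circ> \<epsilon>) t) = (\<psi> \<circ> (\<lambda>t. f (\<epsilon> t))) t" if "t \<in> \<epsilon> -` U" for t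
      using that by (simp add: inv_into_f_f[OF charts_inj[OF A c(1)]])
  qed (use c(2) \<epsilon>(2) in simp)
  from this[OF \<gamma> refl v(1)] this[OF \<delta> eq[symmetric] v(2)]
  show "\<exists>v. ((\<psi> \<circ> (\<lambda>t. f (\<gamma> t))) has_vector_derivative v) (at 0) \<and>
      ((\<psi> \<circ> (\<lambda>t. f (\<delta> t))) has_vector_derivative v) (at 0)" by blast
qed

lemma same_velocity_push:
  assumes A: "charts A" and \<gamma>: "smooth_map vec_atlas A \<gamma>" "smooth_map vec_atlas A \<delta>"
    and s: "same_velocity A \<gamma> \<delta>" and f: "smooth_map A B f"
  shows "same_velocity B (\<lambda>t. f (\<gamma> t)) (\<lambda>t. f (\<delta> t))"
proof -
  have "\<gamma> 0 \<in> points A" by (rule smooth_map_into[OF \<gamma>(1)]) simp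
  from point_in_chart[OF this] obtain U \<phi> where c: "(U, \<phi>) \<in> A" "\<gamma> 0 \<in> U" by (elim exE conjE)
  obtain v where v: "((\<phi> \<circ> \<gamma>) has_vector_derivative v) (at 0)" "((\<phi> \<circ> \<delta>) has_vector_derivative v) (at 0)"
    using s c by (auto simp: same_velocity_def)
  have "\<gamma> 0 = \<delta> 0" using s by (simp add: same_velocity_def)
  from same_velocity_pushI[OF A \<gamma> this c v f] show ?thesis .
qed

lemma same_velocity_trans:
  assumes "same_velocity A \<gamma> \<delta>" "same_velocity A \<delta> \<epsilon>"
  shows "same_velocity A \<gamma> \<epsilon>"
  unfolding same_velocity_def
proof (intro conjI ballI; clarify?)
  show "\<gamma> 0 = \<epsilon> 0" using assms by (simp add: same_velocity_def)
  fix U \<phi> assume c: "(U, \<phi>) \<in> A" "\<gamma> 0 \<in> U"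
  obtain v where v: "((\<phi> \<circ> \<gamma>) has_vector_derivative v) (at 0)" "((\<phi> \<circ> \<delta>) has_vector_derivative v) (at 0)"
    using assms(1) c by (auto simp: same_velocity_def)
  obtain w where w: "((\<phi> \<circ> \<delta>) has_vector_derivative w) (at 0)" "((\<phi> \<circ> \<epsilon>) has_vector_derivative w) (at 0)"
    using assms c by (auto simp: same_velocity_def)
  have "v = w" using v(2) w(1) by (rule vector_derivative_unique_at)
  with v w show "\<exists>v. ((\<phi> \<circ> \<gamma>) has_vector_derivative v) (at 0) \<and> ((\<phi> \<circ> \<epsilon>) has_vector_derivative v) (at 0)"
    by blast
qed

lemma vec_line_derivative: "((\<lambda>t. t *\<^sub>R Y) has_vector_derivative Y) (at t)"
  using has_vector_derivative_scaleR[OF DERIV_ident has_vector_derivative_const[of Y], of t UNIV] by simp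

lemma smooth_line: "smooth_map vec_atlas vec_atlas (\<lambda>t::real. t *\<^sub>R (Y::'v::finite_dim_normed))"
  by (rule smooth_map_linear[OF charts_vec_atlas _ smooth_map_id[OF smooth_manifold_vec]])
    (auto intro!: linearI simp: scaleR_add_left)

lemma linear_inv_into:
  assumes "linear L" "bij L"
  shows "linear (inv_into UNIV L)"
proof (rule linearI)
  note inv = surj_f_inv_f[OF bij_is_surj[OF assms(2)]]
  show "inv_into UNIV L (x + y) = inv_into UNIV L x + inv_into UNIV L y" for x y
    by (rule inv_f_eq[OF bij_is_inj[OF assms(2)]]) (simp add: linear_add[OF assms(1)] inv)
  show "inv_into UNIV L (r *\<^sub>R x) = r *\<^sub>R inv_into UNIV L x" for r x
    by (rule inv_f_eq[OF bij_is_inj[OF assms(2)]]) (simp add: linear_scale[OF assms(1)] inv)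
qed

section \<open>Lie groups with an exponential map\<close>

locale lie_group_exp =
  fixes G :: "('a, 'v::finite_dim_normed) liegrp" (structure) and e :: "'v \<Rightarrow> 'a"
  assumes lie_group: "lie_group G" and exponential: "exponential G e"

sublocale lie_group_exp \<subseteq> group G
  using lie_group by (simp add: lie_group_def)

context lie_group_exp
begin

lemma manifold: "smooth_manifold (atlas G)"
  and points: "points (atlas G) = carrier G"
  using lie_group by (simp_all add: lie_group_def)

lemmas charts = manifold_charts[OF manifold]

lemma chart_inD: "(U, \<phi>) \<in> atlas G \<Longrightarrow> x \<in> U \<Longrightarrow> x \<in> carrier G"
  using chart_subset points by blast

lemma smooth_mult:
  assumes "charts M" "smooth_map M (atlas G) f" "smooth_map M (atlas G) g"
  shows "smooth_map M (atlas G) (\<lambda>x. f x \<otimes> g x)"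
proof -
  have m: "smooth_map (prod_atlas (atlas G) (atlas G)) (atlas G) (\<lambda>z. fst z \<otimes> snd z)"
    using lie_group by (simp add: lie_group_def case_prod_unfold)
  show ?thesis
    using smooth_map_compose[OF assms(1) charts_prod_atlas[OF charts charts] smooth_map_Pair[OF assms] m] by simp
qed

lemma smooth_inv:
  assumes "charts M" "smooth_map M (atlas G) f"
  shows "smooth_map M (atlas G) (\<lambda>x. inv f x)"
  by (rule smooth_map_compose[OF assms(1) charts assms(2)]) (use lie_group in \<open>simp add: lie_group_def\<close>)

lemma smooth_const: "charts M \<Longrightarrow> x \<in> carrier G \<Longrightarrow> smooth_map M (atlas G) (\<lambda>_. x)"
  by (rule smooth_map_const) (auto simp: points)

lemma smooth_exp: "charts M \<Longrightarrow> smooth_map M vec_atlas f \<Longrightarrow> smooth_map M (atlas G) (\<lambda>x. e (f x))"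
  by (rule smooth_map_compose[OF _ charts_vec_atlas]) (use exponential in \<open>auto simp: exponential_def\<close>)

lemma smooth_ident: "smooth_map (atlas G) (atlas G) (\<lambda>x. x)"
  by (rule smooth_map_id[OF manifold])

lemma exp_closed [simp]: "e Y \<in> carrier G"
  using smooth_map_into[of vec_atlas "atlas G" e Y] exponential points by (simp add: exponential_def)

lemma exp_zero [simp]: "e 0 = \<one>"
proof -
  have "e ((0 + 0) *\<^sub>R 0) = e (0 *\<^sub>R 0) \<otimes> e (0 *\<^sub>R 0)"
    using exponential unfolding exponential_def by blast
  then show ?thesis by simp
qed

lemma exp_uminus: "e (- Y) = inv (e Y)"
proof -
  have "e ((1 + - 1) *\<^sub>R Y) = e (1 *\<^sub>R Y) \<otimes> e ((- 1) *\<^sub>R Y)"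
    using exponential unfolding exponential_def by blast
  then have "e Y \<otimes> e (- Y) = \<one>" by simp
  then show ?thesis by (metis exp_closed inv_equality inv_inv inv_closed inv_comm)
qed

lemma smooth_one_parameter: "smooth_map vec_atlas (atlas G) (\<lambda>t. e (t *\<^sub>R Y))"
  by (rule smooth_exp[OF charts_vec_atlas smooth_line])

lemma smooth_translation: "x \<in> carrier G \<Longrightarrow> smooth_map (atlas G) (atlas G) (\<lambda>y. x \<otimes> y)"
  by (intro smooth_mult charts smooth_const smooth_ident)

lemma smooth_conjugation: "x \<in> carrier G \<Longrightarrow> smooth_map (atlas G) (atlas G) (\<lambda>y. x \<otimes> y \<otimes> inv x)"
  by (intro smooth_mult charts smooth_const smooth_ident inv_closed)

lemma exp_in_chart:
  assumes "(U, \<phi>) \<in> atlas G" "\<one> \<in> U"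
  shows "bij (frechet_derivative (\<phi> \<circ> e) (at 0))"
    and "((\<phi> \<circ> e) has_derivative frechet_derivative (\<phi> \<circ> e) (at 0)) (at 0)"
    and "((\<phi> \<circ> (\<lambda>t. e (t *\<^sub>R Y))) has_vector_derivative frechet_derivative (\<phi> \<circ> e) (at 0) Y) (at 0)"
proof -
  show "bij (frechet_derivative (\<phi> \<circ> e) (at 0))" using exponential assms unfolding exponential_def by blast
  have "smooth_map vec_atlas (atlas G) e" using exponential by (simp add: exponential_def)
  then have "C_infinity (e -` U) (\<phi> \<circ> e)" using assms by (auto simp: smooth_map_from_vec)
  then show D: "((\<phi> \<circ> e) has_derivative frechet_derivative (\<phi> \<circ> e) (at 0)) (at 0)"
    by (rule C_infinity_has_derivative) (use assms in simp)
  show "((\<phi> \<circ> (\<lambda>t. e (t *\<^sub>R Y))) has_vector_derivative frechet_derivative (\<phi> \<circ> e) (at 0) Y) (at 0)"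
    using has_vector_derivative_compose[OF vec_line_derivative[of Y 0], of "\<phi> \<circ> e"] D by (simp add: comp_def)
qed

lemma one_in_chart: "\<exists>U \<phi>. (U, \<phi>) \<in> atlas G \<and> \<one> \<in> U"
  by (rule point_in_chart) (simp add: points)

text \<open>The derivative of \<open>e\<close> at 0 is bijective in every chart at the unit, so each velocity at the unit
  is that of exactly one one-parameter subgroup. This makes the description in \<^const>\<open>Ad\<close> unique.\<close>

lemma unique_generator:
  assumes \<gamma>: "smooth_map vec_atlas (atlas G) \<gamma>" "\<gamma> 0 = \<one>"
  shows "\<exists>!Z. same_velocity (atlas G) \<gamma> (\<lambda>t. e (t *\<^sub>R Z))"
proof -
  from one_in_chart obtain U \<phi> where c: "(U, \<phi>) \<in> atlas G" "\<one> \<in> U" by (elim exE conjE)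
  let ?L = "frechet_derivative (\<phi> \<circ> e) (at 0)"
  note L = exp_in_chart[OF c]
  have v: "((\<phi> \<circ> \<gamma>) has_vector_derivative vector_derivative (\<phi> \<circ> \<gamma>) (at 0)) (at 0)"
    by (rule curve_has_velocity[OF \<gamma>(1) c(1)]) (simp add: \<gamma> c)
  obtain Z where Z: "?L Z = vector_derivative (\<phi> \<circ> \<gamma>) (at 0)" using L(1) by (metis bij_pointE)
  have "same_velocity (atlas G) \<gamma> (\<lambda>t. e (t *\<^sub>R Z))"
    using same_velocity_pushI[OF charts \<gamma>(1) smooth_one_parameter[of Z] _ c(1) _ v _ smooth_ident] L(3)[of Z] Z
      \<gamma>(2) c(2) by simp
  moreover have "Z1 = Z2" if "same_velocity (atlas G) \<gamma> (\<lambda>t. e (t *\<^sub>R Z1))"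
    "same_velocity (atlas G) \<gamma> (\<lambda>t. e (t *\<^sub>R Z2))" for Z1 Z2
  proof -
    have "?L Z' = vector_derivative (\<phi> \<circ> \<gamma>) (at 0)"
      if sv: "same_velocity (atlas G) \<gamma> (\<lambda>t. e (t *\<^sub>R Z'))" for Z'
    proof -
      obtain w where w: "((\<phi> \<circ> \<gamma>) has_vector_derivative w) (at 0)"
        "((\<phi> \<circ> (\<lambda>t. e (t *\<^sub>R Z'))) has_vector_derivative w) (at 0)"
        using sv c \<gamma>(2) by (auto simp: same_velocity_def)
      then show ?thesis using vector_derivative_unique_at[OF w(1) v] vector_derivative_unique_at[OF w(2) L(3)] by simp
    qed
    from this[OF that(1)] this[OF that(2)] have "?L Z1 = ?L Z2" by simp
    then show ?thesis using L(1) by (simp add: bij_def inj_eq)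
  qed
  ultimately show ?thesis by blast
qed

lemma smooth_conjugated_line:
  "x \<in> carrier G \<Longrightarrow> smooth_map vec_atlas (atlas G) (\<lambda>t. x \<otimes> e (t *\<^sub>R Y) \<otimes> inv x)"
  by (intro smooth_mult charts_vec_atlas smooth_const smooth_one_parameter inv_closed)

lemma Ad_velocity:
  assumes "x \<in> carrier G"
  shows "same_velocity (atlas G) (\<lambda>t. x \<otimes> e (t *\<^sub>R Y) \<otimes> inv x) (\<lambda>t. e (t *\<^sub>R Ad G e x Y))"
  unfolding Ad_def by (rule theI'[OF unique_generator[OF smooth_conjugated_line]]) (use assms in auto)

lemma Ad_eqI:
  assumes "x \<in> carrier G" "same_velocity (atlas G) (\<lambda>t. x \<otimes> e (t *\<^sub>R Y) \<otimes> inv x) (\<lambda>t. e (t *\<^sub>R Z))"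
  shows "Ad G e x Y = Z"
  unfolding Ad_def
  by (rule the1_equality[OF unique_generator[OF smooth_conjugated_line[OF assms(1)]] assms(2)]) (use assms in simp)

lemma Ad_one [simp]: "Ad G e \<one> Y = Y"
proof (rule Ad_eqI)
  from one_in_chart obtain U \<phi> where c: "(U, \<phi>) \<in> atlas G" "\<one> \<in> U" by (elim exE conjE)
  show "same_velocity (atlas G) (\<lambda>t. \<one> \<otimes> e (t *\<^sub>R Y) \<otimes> inv \<one>) (\<lambda>t. e (t *\<^sub>R Y))"
    using same_velocity_pushI[OF charts smooth_one_parameter[of Y] smooth_one_parameter[of Y] refl c(1) _
        exp_in_chart(3)[OF c] exp_in_chart(3)[OF c] smooth_ident] c(2) by simp
qed simp

lemma Ad_mult:
  assumes x: "x \<in> carrier G" and y: "y \<in> carrier G"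
  shows "Ad G e (x \<otimes> y) Y = Ad G e x (Ad G e y Y)"
proof (rule Ad_eqI)
  have "same_velocity (atlas G) (\<lambda>t. x \<otimes> (y \<otimes> e (t *\<^sub>R Y) \<otimes> inv y) \<otimes> inv x)
      (\<lambda>t. x \<otimes> e (t *\<^sub>R Ad G e y Y) \<otimes> inv x)"
    by (rule same_velocity_push[OF charts smooth_conjugated_line[OF y] smooth_one_parameter
          Ad_velocity[OF y] smooth_conjugation[OF x]])
  from same_velocity_trans[OF this Ad_velocity[OF x]]
  show "same_velocity (atlas G) (\<lambda>t. x \<otimes> y \<otimes> e (t *\<^sub>R Y) \<otimes> inv (x \<otimes> y))
      (\<lambda>t. e (t *\<^sub>R Ad G e x (Ad G e y Y)))"
    using x y by (simp add: inv_mult_group m_assoc)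
qed (use x y in simp)

text \<open>In charts around \<open>x\<close> and \<open>\<one>\<close> the map \<open>(x, Y) \<mapsto> x e\<^sup>Y x\<^sup>-\<^sup>1\<close> is a smooth function \<open>F\<close>, and \<open>Ad\<close> is its partial
  derivative at \<open>Y = 0\<close>. Both the linearity and the smoothness of \<open>Ad\<close> come from this.\<close>

lemma Ad_as_partial_derivative:
  assumes c: "(U, \<phi>) \<in> atlas G" and c1: "(U1, \<phi>1) \<in> atlas G" "\<one> \<in> U1"
  obtains \<Omega> F where "open \<Omega>" "C_infinity \<Omega> F" "\<And>x. x \<in> U \<Longrightarrow> (\<phi> x, 0) \<in> \<Omega>"
    "\<And>x Y. x \<in> U \<Longrightarrow> frechet_derivative (\<phi>1 \<circ> e) (at 0) (Ad G e x Y) = frechet_derivative F (at (\<phi> x, 0)) (0, Y)"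
proof -
  define k where "k z = fst z \<otimes> e (snd z) \<otimes> inv (fst z)" for z :: "'a \<times> 'v"
  let ?P = "prod_atlas (atlas G) (vec_atlas :: ('v, 'v) atlas)"
  have "charts ?P" by (rule charts_prod_atlas[OF charts charts_vec_atlas])
  then have k: "smooth_map ?P (atlas G) k"
    unfolding k_def
    by (intro smooth_mult smooth_inv smooth_exp smooth_map_fst smooth_map_snd manifold smooth_manifold_vec)
  let ?V = "U \<times> (UNIV :: 'v set)" and ?\<psi> = "map_prod \<phi> (\<lambda>y::'v. y)"
  have V: "(?V, ?\<psi>) \<in> ?P" using c by (auto simp: in_prod_atlas vec_atlas_def)
  define \<Omega> where "\<Omega> = ?\<psi> ` (?V \<inter> k -` U1)"
  define F where "F = \<phi>1 \<circ> k \<circ> inv_into ?V ?\<psi>"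
  note D = smooth_mapD[OF k V c1(1), folded \<Omega>_def F_def]
  have F: "F (\<phi> x, Y) = \<phi>1 (x \<otimes> e Y \<otimes> inv x)" if "x \<in> U" for x Y
    using that charts_inj[OF charts c]
    by (simp add: F_def inv_into_map_prod k_def inv_into_f_f)
  have mem: "(\<phi> x, 0) \<in> \<Omega>" if "x \<in> U" for x
  proof -
    have "(x, 0) \<in> ?V \<inter> k -` U1" using that c1 chart_inD[OF c that] by (simp add: k_def)
    then show ?thesis unfolding \<Omega>_def by (rule rev_image_eqI) simp
  qed
  have "frechet_derivative (\<phi>1 \<circ> e) (at 0) (Ad G e x Y) = frechet_derivative F (at (\<phi> x, 0)) (0, Y)"
    if x: "x \<in> U" for x Y
  proof -
    have xG: "x \<in> carrier G" by (rule chart_inD[OF c x])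
    have "((\<lambda>t. (\<phi> x, t *\<^sub>R Y)) has_vector_derivative (0, Y)) (at 0)"
      by (intro has_vector_derivative_Pair has_vector_derivative_const vec_line_derivative)
    from has_vector_derivative_compose[OF this, of F] C_infinity_has_derivative[OF D(2) mem[OF x]]
    have "((\<lambda>t. F (\<phi> x, t *\<^sub>R Y)) has_vector_derivative frechet_derivative F (at (\<phi> x, 0)) (0, Y)) (at 0)" by simp
    then have 1: "((\<phi>1 \<circ> (\<lambda>t. x \<otimes> e (t *\<^sub>R Y) \<otimes> inv x)) has_vector_derivative
        frechet_derivative F (at (\<phi> x, 0)) (0, Y)) (at 0)"
      by (simp add: F[OF x] comp_def)
    obtain v where v: "((\<phi>1 \<circ> (\<lambda>t. x \<otimes> e (t *\<^sub>R Y) \<otimes> inv x)) has_vector_derivative v) (at 0)"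
      "((\<phi>1 \<circ> (\<lambda>t. e (t *\<^sub>R Ad G e x Y))) has_vector_derivative v) (at 0)"
      using Ad_velocity[OF xG, of Y] c1 xG by (auto simp: same_velocity_def)
    show ?thesis
      using vector_derivative_unique_at[OF v(1) 1] vector_derivative_unique_at[OF v(2) exp_in_chart(3)[OF c1]]
      by simp
  qed
  with D mem that show ?thesis by blast
qed

lemma linear_Ad:
  assumes x: "x \<in> carrier G"
  shows "linear (Ad G e x)"
proof -
  from one_in_chart obtain U1 \<phi>1 where c1: "(U1, \<phi>1) \<in> atlas G" "\<one> \<in> U1" by (elim exE conjE)
  have "x \<in> points (atlas G)" using x by (simp add: points)
  from point_in_chart[OF this] obtain U \<phi> where c: "(U, \<phi>) \<in> atlas G" "x \<in> U" by (elim exE conjE)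
  obtain \<Omega> F where F: "open \<Omega>" "C_infinity \<Omega> F" "\<And>x. x \<in> U \<Longrightarrow> (\<phi> x, 0) \<in> \<Omega>"
    "\<And>x Y. x \<in> U \<Longrightarrow> frechet_derivative (\<phi>1 \<circ> e) (at 0) (Ad G e x Y) = frechet_derivative F (at (\<phi> x, 0)) (0, Y)"
    using Ad_as_partial_derivative[OF c(1) c1] by blast
  let ?L = "frechet_derivative (\<phi>1 \<circ> e) (at 0)" and ?D = "frechet_derivative F (at (\<phi> x, 0))"
  have L: "linear ?L" "inj ?L"
    using has_derivative_linear[OF exp_in_chart(2)[OF c1]] exp_in_chart(1)[OF c1] by (auto simp: bij_def)
  have D: "linear ?D" using C_infinity_has_derivative[OF F(2) F(3)[OF c(2)]] by (rule has_derivative_linear)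
  show ?thesis
  proof (rule linearI)
    fix Y Z
    have "?L (Ad G e x (Y + Z)) = ?D ((0, Y) + (0, Z))" by (simp add: F(4)[OF c(2)])
    also have "\<dots> = ?L (Ad G e x Y + Ad G e x Z)" by (simp only: linear_add[OF D] linear_add[OF L(1)] F(4)[OF c(2)])
    finally show "Ad G e x (Y + Z) = Ad G e x Y + Ad G e x Z" using L(2) by (simp add: inj_eq)
  next
    fix r Y
    have "?L (Ad G e x (r *\<^sub>R Y)) = ?D (r *\<^sub>R (0, Y))" by (simp add: F(4)[OF c(2)])
    also have "\<dots> = ?L (r *\<^sub>R Ad G e x Y)" by (simp only: linear_scale[OF D] linear_scale[OF L(1)] F(4)[OF c(2)])
    finally show "Ad G e x (r *\<^sub>R Y) = r *\<^sub>R Ad G e x Y" using L(2) by (simp add: inj_eq)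
  qed
qed

lemma smooth_Ad: "smooth_map (atlas G) vec_atlas (\<lambda>x. Ad G e x Y)"
  unfolding smooth_map_to_vec
proof (intro ballI; clarify)
  fix U \<phi> assume c: "(U, \<phi>) \<in> atlas G"
  from one_in_chart obtain U1 \<phi>1 where c1: "(U1, \<phi>1) \<in> atlas G" "\<one> \<in> U1" by (elim exE conjE)
  obtain \<Omega> F where F: "open \<Omega>" "C_infinity \<Omega> F" "\<And>x. x \<in> U \<Longrightarrow> (\<phi> x, 0) \<in> \<Omega>"
    "\<And>x Y. x \<in> U \<Longrightarrow> frechet_derivative (\<phi>1 \<circ> e) (at 0) (Ad G e x Y) = frechet_derivative F (at (\<phi> x, 0)) (0, Y)"
    using Ad_as_partial_derivative[OF c c1] by blast
  let ?L = "frechet_derivative (\<phi>1 \<circ> e) (at 0)"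
  have o: "open (\<phi> ` U)" by (rule charts_open[OF charts c])
  have lin: "linear ?L" and bij: "bij ?L"
    using has_derivative_linear[OF exp_in_chart(2)[OF c1]] exp_in_chart(1)[OF c1] by auto
  have "linear (inv_into UNIV ?L)" by (rule linear_inv_into[OF lin bij])
  then have inv: "bounded_linear (inv_into UNIV ?L)" by (rule linear_imp_bounded_linear)
  have "C_infinity (\<phi> ` U) (\<lambda>a. frechet_derivative F (at (a, 0)) (0, Y))"
    by (rule C_infinity_compose[OF C_infinity_Pair[OF C_infinity_id C_infinity_const o]
          C_infinity_derivative[OF F(2)] _ o F(1)]) (use F(3) in auto)
  then have "C_infinity (\<phi> ` U) (\<lambda>a. inv_into UNIV ?L (frechet_derivative F (at (a, 0)) (0, Y)))"
    by (rule C_infinity_linear[OF inv o])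
  then have "C_infinity (\<phi> ` U) ((\<lambda>x. Ad G e x Y) \<circ> inv_into U \<phi>)"
  proof (rule C_infinity_cong[OF o, rotated])
    fix a assume "a \<in> \<phi> ` U"
    then obtain x where x: "a = \<phi> x" "x \<in> U" by blast
    then show "inv_into UNIV ?L (frechet_derivative F (at (a, 0)) (0, Y)) = ((\<lambda>x. Ad G e x Y) \<circ> inv_into U \<phi>) a"
      using charts_inj[OF charts c] by (simp add: inv_into_f_f F(4)[symmetric] inv_f_f[OF bij_is_inj[OF bij]])
  qed
  with o show "open (\<phi> ` U) \<and> C_infinity (\<phi> ` U) ((\<lambda>x. Ad G e x Y) \<circ> inv_into U \<phi>)" by blast
qed

lemma ad_has_vector_derivative:
  "((\<lambda>t. Ad G e (e (t *\<^sub>R Y)) Z) has_vector_derivative ad G e Y Z) (at 0)"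
proof -
  have "smooth_map vec_atlas vec_atlas (\<lambda>t. Ad G e (e (t *\<^sub>R Y)) Z)"
    by (rule smooth_map_compose[OF charts_vec_atlas charts smooth_one_parameter smooth_Ad])
  then have "(\<lambda>t. Ad G e (e (t *\<^sub>R Y)) Z) differentiable (at 0)"
    by (auto simp: smooth_map_vec_vec intro: C_infinity_imp_differentiable)
  then show ?thesis by (simp add: ad_def vector_derivative_works)
qed

end

section \<open>Functions with vanishing derivatives\<close>

context lie_group_exp
begin

text \<open>Left translation by \<open>x\<close> moves \<open>x\<close> to the unit, where the velocities of the one-parameter
  subgroups exhaust the tangent space. So the derivatives along the curves \<open>x e\<^sup>t\<^sup>Y\<close> determine the
  full derivative of \<open>f\<close> at \<open>x\<close>.\<close>

lemma chart_derivative_zero: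
  assumes f: "smooth_map (atlas G) vec_atlas f" and c: "(U, \<phi>) \<in> atlas G" "x \<in> U"
    and zero: "\<And>Y. ((\<lambda>t. f (x \<otimes> e (t *\<^sub>R Y))) has_vector_derivative 0) (at 0)"
  shows "((f \<circ> inv_into U \<phi>) has_derivative (\<lambda>_. 0)) (at (\<phi> x))"
proof -
  have x: "x \<in> carrier G" by (rule chart_inD[OF c])
  from one_in_chart obtain U1 \<phi>1 where c1: "(U1, \<phi>1) \<in> atlas G" "\<one> \<in> U1" by (elim exE conjE)
  note inj1 = inv_into_f_f[OF charts_inj[OF charts c1(1)]]
  let ?L = "frechet_derivative (\<phi>1 \<circ> e) (at 0)"
  let ?F = "(\<lambda>y. f (x \<otimes> y)) \<circ> inv_into U1 \<phi>1"
  have "smooth_map (atlas G) vec_atlas (\<lambda>y. f (x \<otimes> y))"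
    by (rule smooth_map_compose[OF charts charts smooth_translation[OF x] f])
  then have "C_infinity (\<phi>1 ` U1) ?F" using c1(1) by (auto simp: smooth_map_to_vec)
  then have F: "(?F has_derivative frechet_derivative ?F (at (\<phi>1 \<one>))) (at (\<phi>1 \<one>))"
    by (rule C_infinity_has_derivative) (use c1 in simp)
  have "frechet_derivative ?F (at (\<phi>1 \<one>)) (?L Y) = 0" for Y
  proof -
    let ?c = "\<lambda>t. e (t *\<^sub>R Y)"
    have "((\<lambda>t. ?F ((\<phi>1 \<circ> ?c) t)) has_vector_derivative frechet_derivative ?F (at (\<phi>1 \<one>)) (?L Y)) (at 0)"
      by (rule has_vector_derivative_compose[OF exp_in_chart(3)[OF c1]]) (simp only: comp_apply[of \<phi>1 ?c] scaleR_zero_left exp_zero F)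
    then have "((\<lambda>t. f (x \<otimes> ?c t)) has_vector_derivative frechet_derivative ?F (at (\<phi>1 \<one>)) (?L Y)) (at 0)"
    proof (rule has_vector_derivative_transform_within_open)
      show "open (?c -` U1)" using smooth_one_parameter[of Y] c1(1) by (auto simp: smooth_map_from_vec)
    qed (use c1(2) inj1 in auto)
    from vector_derivative_unique_at[OF this zero] show ?thesis .
  qed
  moreover have "\<exists>Y. v = ?L Y" for v using bij_is_surj[OF exp_in_chart(1)[OF c1]] by (rule surjE) blast
  ultimately have "frechet_derivative ?F (at (\<phi>1 \<one>)) v = 0" for v by metis
  then have "frechet_derivative ?F (at (\<phi>1 \<one>)) = (\<lambda>_. 0)" by (rule ext)
  with F have F0: "(?F has_derivative (\<lambda>_. 0)) (at (\<phi>1 \<one>))" by (simp only:)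
  let ?T = "\<phi>1 \<circ> (\<lambda>y. inv x \<otimes> y) \<circ> inv_into U \<phi>" and ?D = "\<phi> ` (U \<inter> (\<lambda>y. inv x \<otimes> y) -` U1)"
  note inj = inv_into_f_f[OF charts_inj[OF charts c(1)]]
  note T = smooth_mapD[OF smooth_translation[OF inv_closed[OF x]] c(1) c1(1)]
  have xD: "\<phi> x \<in> ?D" using c c1 x by simp
  have Tx: "?T (\<phi> x) = \<phi>1 \<one>" using c x by (simp add: inj)
  have "((\<lambda>z. ?F (?T z)) has_derivative (\<lambda>_. 0)) (at (\<phi> x))"
    using has_derivative_compose[OF C_infinity_has_derivative[OF T(2) xD], of ?F "\<lambda>_. 0"] F0 unfolding Tx .
  then show ?thesis
  proof (rule has_derivative_transform_within_open[OF _ T(1) xD])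
    fix z assume "z \<in> ?D"
    then obtain u where u: "z = \<phi> u" "u \<in> U" "inv x \<otimes> u \<in> U1" by blast
    have "x \<otimes> (inv x \<otimes> u) = u" using x chart_inD[OF c(1) u(2)] by (simp flip: m_assoc)
    then show "?F (?T z) = (f \<circ> inv_into U \<phi>) z" using u by (simp add: inj inj1)
  qed
qed

text \<open>In each chart \<open>f\<close> is locally constant, so all its level sets are open, hence also closed.\<close>

lemma constant_if_derivatives_zero:
  assumes conn: "connected_space (atlas_topology (atlas G))" and f: "smooth_map (atlas G) vec_atlas f"
    and zero: "\<And>x Y. x \<in> carrier G \<Longrightarrow> ((\<lambda>t. f (x \<otimes> e (t *\<^sub>R Y))) has_vector_derivative 0) (at 0)"
    and x: "x \<in> carrier G" and y: "y \<in> carrier G"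
  shows "f x = f y"
proof -
  have op: "openin (atlas_topology (atlas G)) {z \<in> carrier G. f z \<in> Q}" for Q
    unfolding openin_atlas_topology[OF charts]
  proof (intro conjI allI impI)
    show "{z \<in> carrier G. f z \<in> Q} \<subseteq> points (atlas G)" by (auto simp: points)
    fix U \<phi> assume c: "(U, \<phi>) \<in> atlas G"
    note inj = inv_into_f_f[OF charts_inj[OF charts c]]
    let ?F = "f \<circ> inv_into U \<phi>"
    have o: "open (\<phi> ` U)" by (rule charts_open[OF charts c])
    have eq: "\<phi> ` (U \<inter> {z \<in> carrier G. f z \<in> Q}) = {a \<in> \<phi> ` U. ?F a \<in> Q}"
      using chart_inD[OF c] by (auto simp: inj)
    show "open (\<phi> ` (U \<inter> {z \<in> carrier G. f z \<in> Q}))"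
      unfolding eq
    proof (subst open_subopen, intro ballI)
      fix a assume a: "a \<in> {a \<in> \<phi> ` U. ?F a \<in> Q}"
      then obtain r where r: "r > 0" "ball a r \<subseteq> \<phi> ` U" using o open_contains_ball by blast
      have "?F b = ?F a" if "b \<in> ball a r" for b
      proof (rule has_derivative_zero_unique_connected[of "ball a r"])
        show "(?F has_derivative (\<lambda>_. 0)) (at w)" if w: "w \<in> ball a r" for w
        proof -
          obtain u where u: "w = \<phi> u" "u \<in> U" using w r by blast
          show ?thesis unfolding u(1)
            by (rule chart_derivative_zero[OF f c u(2) zero[OF chart_inD[OF c u(2)]]])
        qed
      qed (use that r in auto)
      then have "ball a r \<subseteq> {a \<in> \<phi> ` U. ?F a \<in> Q}" using a r(2) by auto
      then show "\<exists>T. open T \<and> a \<in> T \<and> T \<subseteq> {a \<in> \<phi> ` U. ?F a \<in> Q}"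
        using r(1) by (intro exI[of _ "ball a r"]) simp
    qed
  qed
  have top: "topspace (atlas_topology (atlas G)) = carrier G"
    using topspace_atlas_topology[OF charts] by (simp add: points)
  let ?S = "{z \<in> carrier G. f z \<in> {f x}}"
  have "carrier G - ?S = {z \<in> carrier G. f z \<in> - {f x}}" by auto
  then have "closedin (atlas_topology (atlas G)) ?S" using op[of "- {f x}"] by (auto simp: closedin_def top)
  with op[of "{f x}"] conn have "?S = {} \<or> ?S = carrier G"
    unfolding connected_space_clopen_in top by blast
  with x have "?S = carrier G" by blast
  with y have "y \<in> ?S" by (simp only:)
  then show ?thesis by simp
qed

text \<open>By additivity the derivative along \<open>x e\<^sup>t\<^sup>Y\<close> does not depend on \<open>x\<close>. The lemma replaces the
  uniqueness of a Lie group morphism with given differential, for morphisms to the real line.\<close>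

lemma additive_zero_if_derivatives_zero:
  fixes f :: "'a \<Rightarrow> real"
  assumes conn: "connected_space (atlas_topology (atlas G))" and f: "smooth_map (atlas G) vec_atlas f"
    and add: "\<And>x y. x \<in> carrier G \<Longrightarrow> y \<in> carrier G \<Longrightarrow> f (x \<otimes> y) = f x + f y"
    and zero: "\<And>Y. ((\<lambda>t. f (e (t *\<^sub>R Y))) has_vector_derivative 0) (at 0)"
    and x: "x \<in> carrier G"
  shows "f x = 0"
proof -
  have "f \<one> = 0" using add[of \<one> \<one>] by simp
  moreover have "f x = f \<one>"
  proof (rule constant_if_derivatives_zero[OF conn f])
    show "((\<lambda>t. f (z \<otimes> e (t *\<^sub>R Y))) has_vector_derivative 0) (at 0)" if "z \<in> carrier G" for z Y
      using has_vector_derivative_add[OF has_vector_derivative_const zero, of "f z"] that by (simp add: add)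
  qed (use x in auto)
  ultimately show ?thesis by simp
qed

end

section \<open>Coadjoint action\<close>

lemma dual_map_apply: "linear T \<Longrightarrow> blinfun_apply (dual_map T A) z = blinfun_apply A (T z)"
  unfolding dual_map_def
  by (subst bounded_linear_Blinfun_apply)
    (auto intro: bounded_linear_compose[OF blinfun.bounded_linear_right linear_imp_bounded_linear])

context lie_group_exp
begin

lemma coAd_apply: "x \<in> carrier G \<Longrightarrow> blinfun_apply (coAd G e x p) V = blinfun_apply p (Ad G e x V)"
  by (simp add: coAd_def dual_map_apply linear_Ad)

lemma coAd_add: "x \<in> carrier G \<Longrightarrow> coAd G e x (p + q) = coAd G e x p + coAd G e x q"
  by (rule blinfun_eqI) (simp add: coAd_apply blinfun.add_left)

lemma coAd_one [simp]: "coAd G e \<one> p = p"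
  by (rule blinfun_eqI) (simp add: coAd_apply)

lemma coAd_mult: "x \<in> carrier G \<Longrightarrow> y \<in> carrier G \<Longrightarrow> coAd G e (x \<otimes> y) p = coAd G e y (coAd G e x p)"
  by (rule blinfun_eqI) (simp add: coAd_apply Ad_mult)

lemma smooth_coAd:
  assumes M: "charts M" and x: "smooth_map M (atlas G) x" and p: "smooth_map M vec_atlas p"
  shows "smooth_map M vec_atlas (\<lambda>m. coAd G e (x m) (p m))"
proof (rule smooth_map_blinfunI[OF M])
  fix V
  have "smooth_map M vec_atlas (\<lambda>m. blinfun_apply (p m) (Ad G e (x m) V))"
    by (rule smooth_map_bilinear[OF M bounded_bilinear_blinfun_apply p
          smooth_map_compose[OF M charts x smooth_Ad]])
  then show "smooth_map M vec_atlas (\<lambda>m. blinfun_apply (coAd G e (x m) (p m)) V)"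
    by (rule smooth_map_cong[OF M, rotated])
      (use smooth_map_into[OF x] in \<open>simp add: coAd_apply points\<close>)
qed

end

section \<open>Poisson brackets\<close>

lemma smooth_imp_C_inf: "smooth_map A vec_atlas f \<Longrightarrow> f \<in> C_inf A"
  by (simp add: C_inf_def)

lemma poisson_bracketD:
  assumes "poisson_bracket A P" "f \<in> C_inf A" "g \<in> C_inf A"
  shows "P f g \<in> C_inf A"
    and "x \<in> points A \<Longrightarrow> P g f x = - P f g x"
    and "h \<in> C_inf A \<Longrightarrow> x \<in> points A \<Longrightarrow> P (\<lambda>y. a * f y + b * g y) h x = a * P f h x + b * P g h x"
    and "h \<in> C_inf A \<Longrightarrow> x \<in> points A \<Longrightarrow> P f (\<lambda>y. g y * h y) x = P f g x * h x + g x * P f h x"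
  using assms unfolding poisson_bracket_def by blast+

text \<open>Brackets are taken of functions on the whole type, so values off the manifold might matter. They
  do not: a function that vanishes on the manifold is its own product with the function that is 0 on
  the manifold and 1 elsewhere, so its brackets vanish by the Leibniz rule. Brackets with constants
  vanish because \<open>1 = 1 \<cdot> 1\<close>.\<close>

lemma poisson_bracket_shift_left:
  assumes A: "charts A" and P: "poisson_bracket A P"
    and f: "smooth_map A vec_atlas f" and f': "smooth_map A vec_atlas f'" and h: "smooth_map A vec_atlas h"
    and eq: "\<And>y. y \<in> points A \<Longrightarrow> f' y = f y + c" and x: "x \<in> points A"
  shows "P f' h x = P f h x"
proof -
  define d where "d y = f' y - f y - c" for y
  define k :: "'a \<Rightarrow> real" where "k y = (if y \<in> points A then 0 else 1)" for y
  have const: "smooth_map A vec_atlas (\<lambda>_. r)" for r :: real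
    by (rule smooth_map_const[OF A]) simp
  have d: "smooth_map A vec_atlas d"
    by (rule smooth_map_cong[OF A _ const[of 0]]) (simp add: d_def eq)
  have k: "smooth_map A vec_atlas k"
    by (rule smooth_map_cong[OF A _ const[of 0]]) (simp add: k_def)
  note C = f[THEN smooth_imp_C_inf] h[THEN smooth_imp_C_inf] d[THEN smooth_imp_C_inf]
    k[THEN smooth_imp_C_inf] const[THEN smooth_imp_C_inf]
  have "d = (\<lambda>y. d y * k y)" by (rule ext) (auto simp: k_def d_def eq)
  then have "P h d x = P h d x * k x + d x * P h k x"
    using poisson_bracketD(4)[OF P C(2,3,4) x] by simp
  then have "P h d x = 0" using x by (simp add: k_def d_def eq)
  then have Pd: "P d h x = 0" using poisson_bracketD(2)[OF P C(2,3) x] by simp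
  have "P h (\<lambda>_. 1) x = 0" using poisson_bracketD(4)[OF P C(2) C(5) C(5) x, of 1 1] by simp
  then have P1: "P (\<lambda>_. 1) h x = 0" using poisson_bracketD(2)[OF P C(2) C(5) x, of 1] by simp
  have fd: "smooth_map A vec_atlas (\<lambda>y. f y + d y)" by (rule smooth_map_add[OF A f d])
  have "P (\<lambda>y. f y + d y) h x = P f h x + P d h x"
    using poisson_bracketD(3)[OF P C(1,3,2) x, of 1 1] by simp
  moreover have "P (\<lambda>y. (f y + d y) + c) h x = P (\<lambda>y. f y + d y) h x + c * P (\<lambda>_. 1) h x"
    using poisson_bracketD(3)[OF P smooth_imp_C_inf[OF fd] C(5) C(2) x, of 1 c 1] by simp
  moreover have "(\<lambda>y. (f y + d y) + c) = f'" by (rule ext) (simp add: d_def)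
  ultimately show ?thesis by (simp add: Pd P1)
qed

text \<open>Brackets see functions on the manifold only up to additive constants.\<close>

lemma poisson_bracket_shift:
  assumes A: "charts A" and P: "poisson_bracket A P"
    and f: "smooth_map A vec_atlas f" "smooth_map A vec_atlas f'" "\<And>y. y \<in> points A \<Longrightarrow> f' y = f y + a"
    and g: "smooth_map A vec_atlas g" "smooth_map A vec_atlas g'" "\<And>y. y \<in> points A \<Longrightarrow> g' y = g y + b"
    and x: "x \<in> points A"
  shows "P f' g' x = P f g x"
proof -
  have "P f' g' x = P f g' x" by (rule poisson_bracket_shift_left[OF A P f(1,2) g(2) f(3) x])
  also have "\<dots> = - P g' f x"
    using poisson_bracketD(2)[OF P g(2)[THEN smooth_imp_C_inf] f(1)[THEN smooth_imp_C_inf] x] .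
  also have "P g' f x = P g f x" by (rule poisson_bracket_shift_left[OF A P g(1,2) f(1) g(3) x])
  also have "- P g f x = P f g x"
    using poisson_bracketD(2)[OF P g(1)[THEN smooth_imp_C_inf] f(1)[THEN smooth_imp_C_inf] x] by simp
  finally show ?thesis .
qed

section \<open>Equivariance of the morphism to the dual of the subalgebra\<close>

locale dressing =
  G: lie_group_exp G e + H: lie_group_exp H eh + Gs: lie_group_exp Gs es
  for G :: "('a, 'v::finite_dim_normed) liegrp" and e
    and H :: "('a, 'w::finite_dim_normed) liegrp" and eh
    and Gs :: "('d, 'v \<Rightarrow>\<^sub>L real) liegrp" and es +
  fixes \<iota> :: "'w \<Rightarrow> 'v" and R :: "('v \<Rightarrow>\<^sub>L real) \<Rightarrow> 'v"
    and Ps :: "('d \<Rightarrow> real) \<Rightarrow> ('d \<Rightarrow> real) \<Rightarrow> 'd \<Rightarrow> real"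
    and dp :: "'a \<Rightarrow> 'd \<Rightarrow> 'd" and dm :: "'d \<Rightarrow> 'a \<Rightarrow> 'a"
    and Is :: "'d \<Rightarrow> ('w \<Rightarrow>\<^sub>L real)"
  assumes sub: "lie_subgroup H G" and connH: "connected_simply_connected H"
    and \<iota>: "linear \<iota>" and exp_\<iota>: "\<And>Z. e (\<iota> Z) = eh Z"
    and dual: "dual_poisson_lie_group G e R Gs es Ps"
    and right_action: "right_dressing_action G e Gs es Ps dp"
    and left_action: "left_dressing_action G e R Gs es dm"
    and twist_plus: "\<And>x u v. x \<in> carrier G \<Longrightarrow> u \<in> carrier Gs \<Longrightarrow> v \<in> carrier Gs \<Longrightarrow>
          dp x (u \<otimes>\<^bsub>Gs\<^esub> v) = dp (dm v x) u \<otimes>\<^bsub>Gs\<^esub> dp x v"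
    and twist_minus: "\<And>u x y. u \<in> carrier Gs \<Longrightarrow> x \<in> carrier G \<Longrightarrow> y \<in> carrier G \<Longrightarrow>
          dm u (x \<otimes>\<^bsub>G\<^esub> y) = dm u x \<otimes>\<^bsub>G\<^esub> dm (dp x u) y"
    and H_fixed: "\<And>u h. u \<in> carrier Gs \<Longrightarrow> h \<in> carrier H \<Longrightarrow> dm u h = h"
    and smooth_Is: "smooth_map (atlas Gs) vec_atlas Is"
    and Is_mult: "\<And>u v. u \<in> carrier Gs \<Longrightarrow> v \<in> carrier Gs \<Longrightarrow> Is (u \<otimes>\<^bsub>Gs\<^esub> v) = Is u + Is v"
    and Is_exp: "\<And>A. Is (es A) = dual_map \<iota> A"
begin

lemma H_in_G: "h \<in> carrier H \<Longrightarrow> h \<in> carrier G"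
  and H_one: "\<one>\<^bsub>H\<^esub> = \<one>\<^bsub>G\<^esub>"
  and H_mult: "h \<in> carrier H \<Longrightarrow> k \<in> carrier H \<Longrightarrow> h \<otimes>\<^bsub>H\<^esub> k = h \<otimes>\<^bsub>G\<^esub> k"
  and smooth_inclusion: "smooth_map (atlas H) (atlas G) (\<lambda>x. x)"
  using sub by (auto simp: lie_subgroup_def immersion_def dest: subgroup.mem_carrier)

lemma H_inv: "h \<in> carrier H \<Longrightarrow> inv\<^bsub>H\<^esub> h = inv\<^bsub>G\<^esub> h"
proof -
  assume h: "h \<in> carrier H"
  have "inv\<^bsub>H\<^esub> h \<otimes>\<^bsub>G\<^esub> h = \<one>\<^bsub>G\<^esub>"
    using h H.l_inv[OF h] by (simp flip: H_mult H_one)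
  then show ?thesis using h by (intro G.inv_equality[symmetric]) (auto intro: H_in_G)
qed

lemma dp_closed: "x \<in> carrier G \<Longrightarrow> u \<in> carrier Gs \<Longrightarrow> dp x u \<in> carrier Gs"
  and dp_one: "u \<in> carrier Gs \<Longrightarrow> dp \<one>\<^bsub>G\<^esub> u = u"
  and dp_mult: "x \<in> carrier G \<Longrightarrow> y \<in> carrier G \<Longrightarrow> u \<in> carrier Gs \<Longrightarrow> dp (x \<otimes>\<^bsub>G\<^esub> y) u = dp y (dp x u)"
  and smooth_dp0: "smooth_map (prod_atlas (atlas G) (atlas Gs)) (atlas Gs) (\<lambda>z. dp (fst z) (snd z))"
proof -
  show s: "smooth_map (prod_atlas (atlas G) (atlas Gs)) (atlas Gs) (\<lambda>z. dp (fst z) (snd z))"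
    using right_action by (simp add: right_dressing_action_def case_prod_unfold)
  show "x \<in> carrier G \<Longrightarrow> u \<in> carrier Gs \<Longrightarrow> dp x u \<in> carrier Gs"
    using smooth_map_into[OF s, of "(x, u)"] by (simp add: points_prod_atlas G.points Gs.points)
qed (use right_action in \<open>auto simp: right_dressing_action_def\<close>)

lemma dm_closed: "u \<in> carrier Gs \<Longrightarrow> x \<in> carrier G \<Longrightarrow> dm u x \<in> carrier G"
  and dm_one: "x \<in> carrier G \<Longrightarrow> dm \<one>\<^bsub>Gs\<^esub> x = x"
  and dm_mult: "u \<in> carrier Gs \<Longrightarrow> v \<in> carrier Gs \<Longrightarrow> x \<in> carrier G \<Longrightarrow> dm (u \<otimes>\<^bsub>Gs\<^esub> v) x = dm u (dm v x)"
  and smooth_dm0: "smooth_map (prod_atlas (atlas Gs) (atlas G)) (atlas G) (\<lambda>z. dm (fst z) (snd z))"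
proof -
  show s: "smooth_map (prod_atlas (atlas Gs) (atlas G)) (atlas G) (\<lambda>z. dm (fst z) (snd z))"
    using left_action by (simp add: left_dressing_action_def case_prod_unfold)
  show "u \<in> carrier Gs \<Longrightarrow> x \<in> carrier G \<Longrightarrow> dm u x \<in> carrier G"
    using smooth_map_into[OF s, of "(u, x)"] by (simp add: points_prod_atlas G.points Gs.points)
qed (use left_action in \<open>auto simp: left_dressing_action_def\<close>)

lemma smooth_dp:
  assumes "charts M" "smooth_map M (atlas G) f" "smooth_map M (atlas Gs) g"
  shows "smooth_map M (atlas Gs) (\<lambda>m. dp (f m) (g m))"
  using smooth_map_compose[OF assms(1) charts_prod_atlas[OF G.charts Gs.charts] smooth_map_Pair[OF assms] smooth_dp0]
  by simp

lemma smooth_dm: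
  assumes "charts M" "smooth_map M (atlas Gs) f" "smooth_map M (atlas G) g"
  shows "smooth_map M (atlas G) (\<lambda>m. dm (f m) (g m))"
  using smooth_map_compose[OF assms(1) charts_prod_atlas[OF Gs.charts G.charts] smooth_map_Pair[OF assms] smooth_dm0]
  by simp

lemma smooth_H_in_G: "charts M \<Longrightarrow> smooth_map M (atlas H) f \<Longrightarrow> smooth_map M (atlas G) f"
  by (rule smooth_map_compose[OF _ H.charts _ smooth_inclusion])

lemma smooth_Is_compose: "charts M \<Longrightarrow> smooth_map M (atlas Gs) f \<Longrightarrow> smooth_map M vec_atlas (\<lambda>m. Is (f m))"
  by (rule smooth_map_compose[OF _ Gs.charts _ smooth_Is])

lemma exp_line: "e (t *\<^sub>R \<iota> Z) = eh (t *\<^sub>R Z)"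
  by (simp add: exp_\<iota> flip: linear_scale[OF \<iota>])

text \<open>The inclusion of \<open>H\<close> in \<open>G\<close> is smooth and so preserves equality of velocities.\<close>

lemma Ad_\<iota>:
  assumes h: "h \<in> carrier H"
  shows "Ad G e h (\<iota> W) = \<iota> (Ad H eh h W)"
proof (rule G.Ad_eqI)
  have "same_velocity (atlas G) (\<lambda>t. h \<otimes>\<^bsub>H\<^esub> eh (t *\<^sub>R W) \<otimes>\<^bsub>H\<^esub> inv\<^bsub>H\<^esub> h) (\<lambda>t. eh (t *\<^sub>R Ad H eh h W))"
    by (rule same_velocity_push[OF H.charts H.smooth_conjugated_line[OF h] H.smooth_one_parameter
          H.Ad_velocity[OF h] smooth_inclusion])
  then show "same_velocity (atlas G) (\<lambda>t. h \<otimes>\<^bsub>G\<^esub> e (t *\<^sub>R \<iota> W) \<otimes>\<^bsub>G\<^esub> inv\<^bsub>G\<^esub> h) (\<lambda>t. e (t *\<^sub>R \<iota> (Ad H eh h W)))"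
    using h by (simp add: exp_line H_mult[symmetric] H_inv[symmetric])
qed (rule H_in_G[OF h])

lemma ad_\<iota>: "ad G e (\<iota> V) (\<iota> W) = \<iota> (ad H eh V W)"
proof -
  have "((\<lambda>t. \<iota> (Ad H eh (eh (t *\<^sub>R V)) W)) has_vector_derivative \<iota> (ad H eh V W)) (at 0)"
    by (rule bounded_linear.has_vector_derivative[OF linear_imp_bounded_linear[OF \<iota>] H.ad_has_vector_derivative])
  then have "((\<lambda>t. Ad G e (e (t *\<^sub>R \<iota> V)) (\<iota> W)) has_vector_derivative \<iota> (ad H eh V W)) (at 0)"
    by (simp add: exp_line Ad_\<iota>)
  from vector_derivative_unique_at[OF G.ad_has_vector_derivative this] show ?thesis .
qed

text \<open>The functions \<open>F\<^sub>V\<close> of the introduction.\<close>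

definition comp_fun :: "'w \<Rightarrow> 'd \<Rightarrow> real" where "comp_fun V u = blinfun_apply (Is u) V"

lemma smooth_comp_fun: "smooth_map (atlas Gs) vec_atlas (comp_fun V)"
  unfolding comp_fun_def
  by (rule smooth_map_linear[OF Gs.charts _ smooth_Is])
    (auto intro!: linearI simp: blinfun.add_left blinfun.scaleR_left)

lemma comp_fun_mult:
  "u \<in> carrier Gs \<Longrightarrow> v \<in> carrier Gs \<Longrightarrow> comp_fun V (u \<otimes>\<^bsub>Gs\<^esub> v) = comp_fun V u + comp_fun V v"
  by (simp add: comp_fun_def Is_mult blinfun.add_left)

lemma comp_fun_exp: "comp_fun V (es (t *\<^sub>R A)) = t * blinfun_apply A (\<iota> V)"
  by (simp add: comp_fun_def Is_exp dual_map_apply[OF \<iota>] blinfun.scaleR_left)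

lemma poisson: "poisson_bracket (atlas Gs) Ps"
  using dual by (simp add: dual_poisson_lie_group_def poisson_lie_group_def)

lemma connGs: "connected_space (atlas_topology (atlas Gs))"
  using dual by (simp add: dual_poisson_lie_group_def connected_simply_connected_def)

lemma smooth_bracket: "smooth_map (atlas Gs) vec_atlas (Ps (comp_fun V) (comp_fun W))"
  using poisson_bracketD(1)[OF poisson smooth_comp_fun[THEN smooth_imp_C_inf] smooth_comp_fun[THEN smooth_imp_C_inf]]
  by (simp add: C_inf_def)

text \<open>Multiplication is a Poisson map, and translating a component adds a constant to it.\<close>

lemma bracket_mult:
  assumes u: "u \<in> carrier Gs" and v: "v \<in> carrier Gs"
  shows "Ps (comp_fun V) (comp_fun W) (u \<otimes>\<^bsub>Gs\<^esub> v) = Ps (comp_fun V) (comp_fun W) u + Ps (comp_fun V) (comp_fun W) v"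
proof -
  let ?A = "atlas Gs"
  have l: "smooth_map ?A vec_atlas (\<lambda>z. comp_fun V (u \<otimes>\<^bsub>Gs\<^esub> z))" for V
    by (rule smooth_map_compose[OF Gs.charts Gs.charts Gs.smooth_translation[OF u] smooth_comp_fun])
  have r: "smooth_map ?A vec_atlas (\<lambda>z. comp_fun V (z \<otimes>\<^bsub>Gs\<^esub> v))" for V
    by (rule smooth_map_compose[OF Gs.charts Gs.charts _ smooth_comp_fun])
      (intro Gs.smooth_mult Gs.charts Gs.smooth_const Gs.smooth_ident v)
  have "Ps (comp_fun V) (comp_fun W) (u \<otimes>\<^bsub>Gs\<^esub> v) =
      Ps (\<lambda>z. comp_fun V (z \<otimes>\<^bsub>Gs\<^esub> v)) (\<lambda>z. comp_fun W (z \<otimes>\<^bsub>Gs\<^esub> v)) u +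
      Ps (\<lambda>z. comp_fun V (u \<otimes>\<^bsub>Gs\<^esub> z)) (\<lambda>z. comp_fun W (u \<otimes>\<^bsub>Gs\<^esub> z)) v"
    using dual u v smooth_comp_fun[THEN smooth_imp_C_inf]
    unfolding dual_poisson_lie_group_def poisson_lie_group_def by blast
  also have "Ps (\<lambda>z. comp_fun V (z \<otimes>\<^bsub>Gs\<^esub> v)) (\<lambda>z. comp_fun W (z \<otimes>\<^bsub>Gs\<^esub> v)) u = Ps (comp_fun V) (comp_fun W) u"
    by (rule poisson_bracket_shift[OF Gs.charts poisson smooth_comp_fun r _ smooth_comp_fun r])
      (use u v in \<open>auto simp: Gs.points comp_fun_mult\<close>)
  also have "Ps (\<lambda>z. comp_fun V (u \<otimes>\<^bsub>Gs\<^esub> z)) (\<lambda>z. comp_fun W (u \<otimes>\<^bsub>Gs\<^esub> z)) v = Ps (comp_fun V) (comp_fun W) v"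
    by (rule poisson_bracket_shift[OF Gs.charts poisson smooth_comp_fun l _ smooth_comp_fun l])
      (use u v in \<open>auto simp: Gs.points comp_fun_mult\<close>)
  finally show ?thesis .
qed

text \<open>Both sides are additive and smooth, and have the same derivative at the unit, because the
  linearization of the bracket of \<open>G\<^sup>*\<close> is the Lie bracket of \<open>G\<close>.\<close>

lemma bracket_comp_fun:
  assumes u: "u \<in> carrier Gs"
  shows "Ps (comp_fun V) (comp_fun W) u = comp_fun (ad H eh V W) u"
proof -
  let ?P = "Ps (comp_fun V) (comp_fun W)" and ?Z = "ad H eh V W"
  have "((\<lambda>t. ?P (es (t *\<^sub>R A))) has_real_derivative blinfun_apply A (ad G e (\<iota> V) (\<iota> W))) (at 0)" for A
  proof -
    have "((\<lambda>t. comp_fun X (es (t *\<^sub>R B))) has_real_derivative blinfun_apply B (\<iota> X)) (at 0)" for X B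
      by (auto simp: comp_fun_exp intro!: derivative_eq_intros)
    with dual smooth_comp_fun[THEN smooth_imp_C_inf] show ?thesis
      unfolding dual_poisson_lie_group_def by blast
  qed
  then have D: "((\<lambda>t. ?P (es (t *\<^sub>R A))) has_vector_derivative blinfun_apply A (\<iota> ?Z)) (at 0)" for A
    by (simp add: ad_\<iota> has_real_derivative_iff_has_vector_derivative)
  have "?P u + (- 1) *\<^sub>R comp_fun ?Z u = 0"
  proof (rule Gs.additive_zero_if_derivatives_zero[OF connGs _ _ _ u])
    show "smooth_map (atlas Gs) vec_atlas (\<lambda>u. ?P u + (- 1) *\<^sub>R comp_fun ?Z u)"
      by (intro smooth_map_add Gs.charts smooth_bracket smooth_map_linear[OF Gs.charts _ smooth_comp_fun]
          linear_scaleR)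
    show "?P (x \<otimes>\<^bsub>Gs\<^esub> y) + (- 1) *\<^sub>R comp_fun ?Z (x \<otimes>\<^bsub>Gs\<^esub> y) =
        (?P x + (- 1) *\<^sub>R comp_fun ?Z x) + (?P y + (- 1) *\<^sub>R comp_fun ?Z y)"
      if "x \<in> carrier Gs" "y \<in> carrier Gs" for x y
      using that by (simp add: bracket_mult comp_fun_mult)
    show "((\<lambda>t. ?P (es (t *\<^sub>R A)) + (- 1) *\<^sub>R comp_fun ?Z (es (t *\<^sub>R A))) has_vector_derivative 0) (at 0)" for A
    proof -
      have "((\<lambda>t. (- 1) *\<^sub>R comp_fun ?Z (es (t *\<^sub>R A))) has_vector_derivative - blinfun_apply A (\<iota> ?Z)) (at 0)"
        by (auto simp: comp_fun_exp simp flip: has_real_derivative_iff_has_vector_derivative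
            intro!: derivative_eq_intros)
      from has_vector_derivative_add[OF D[of A] this] show ?thesis by simp
    qed
  qed
  then show ?thesis by simp
qed

text \<open>The generator of the dressing action for \<open>\<iota> Z\<close> at \<open>u\<close> is described by a bracket with any function
  whose left-invariant differential at \<open>u\<close> is \<open>\<iota> Z\<close>; the component for \<open>Z\<close> is such a function at every
  \<open>u\<close>.\<close>

lemma dressing_derivative:
  assumes u: "u \<in> carrier Gs"
  shows "((\<lambda>t. comp_fun V (dp (eh (t *\<^sub>R Z)) u)) has_vector_derivative comp_fun (ad H eh Z V) u) (at 0)"
proof -
  have "((\<lambda>t. comp_fun Z (u \<otimes>\<^bsub>Gs\<^esub> es (t *\<^sub>R A))) has_real_derivative blinfun_apply A (\<iota> Z)) (at 0)" for A
    using u by (auto simp: comp_fun_mult comp_fun_exp intro!: derivative_eq_intros)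
  then have "((\<lambda>t. comp_fun V (dp (e (t *\<^sub>R \<iota> Z)) u)) has_real_derivative - Ps (comp_fun V) (comp_fun Z) u) (at 0)"
    using right_action u smooth_comp_fun[THEN smooth_imp_C_inf] unfolding right_dressing_action_def by blast
  moreover have "Ps (comp_fun Z) (comp_fun V) u = - Ps (comp_fun V) (comp_fun Z) u"
    by (rule poisson_bracketD(2)[OF poisson]) (use u in \<open>auto simp: Gs.points smooth_comp_fun smooth_imp_C_inf\<close>)
  ultimately show ?thesis
    by (simp add: exp_line has_real_derivative_iff_has_vector_derivative flip: bracket_comp_fun[OF u])
qed

text \<open>The derivative of \<open>\<langle>I\<^sup>*(\<phi>\<^sup>+\<^sub>k(u)), Ad\<^sub>l V\<rangle>\<close>, \<open>l = k\<inverse>\<close>, along \<open>k e\<^sup>t\<^sup>Z\<close> has two terms,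
  \<open>\<langle>I\<^sup>*(v), [Z, W]\<rangle>\<close> from the dressing action and \<open>-\<langle>I\<^sup>*(v), [Z, W]\<rangle>\<close> from \<open>Ad\<close>, where \<open>v = \<phi>\<^sup>+\<^sub>k(u)\<close> and
  \<open>W = Ad\<^sub>l V\<close>. So the function is constant in \<open>k\<close>.\<close>

lemma Is_dressing:
  assumes h: "h \<in> carrier H" and u: "u \<in> carrier Gs"
  shows "Is (dp h u) = coAd H eh h (Is u)"
proof (rule blinfun_eqI)
  fix V0
  define V where "V = Ad H eh h V0"
  define f where "f k = blinfun_apply (Is (dp k u)) (Ad H eh (inv\<^bsub>H\<^esub> k) V)" for k
  have "f h = f \<one>\<^bsub>H\<^esub>"
  proof (rule H.constant_if_derivatives_zero[OF _ _ _ h H.one_closed])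
    show "connected_space (atlas_topology (atlas H))" using connH by (simp add: connected_simply_connected_def)
    show "smooth_map (atlas H) vec_atlas f"
      unfolding f_def
      by (intro smooth_map_bilinear[OF H.charts bounded_bilinear_blinfun_apply] smooth_Is_compose smooth_dp
          smooth_inclusion Gs.smooth_const H.charts u
          smooth_map_compose[OF H.charts H.charts H.smooth_inv[OF H.charts H.smooth_ident] H.smooth_Ad])
    fix k Z assume k: "k \<in> carrier H"
    define v where "v = dp k u"
    define W where "W = Ad H eh (inv\<^bsub>H\<^esub> k) V"
    have v: "v \<in> carrier Gs" using k u by (simp add: v_def dp_closed H_in_G)
    define a where "a t = Is (dp (eh (t *\<^sub>R Z)) v)" for t
    define b where "b t = Ad H eh (eh ((- t) *\<^sub>R Z)) W" for t
    have "smooth_map vec_atlas vec_atlas a"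
      unfolding a_def
      by (intro smooth_Is_compose smooth_dp smooth_H_in_G H.smooth_one_parameter Gs.smooth_const charts_vec_atlas v)
    then have "a differentiable (at 0)"
      by (auto simp: smooth_map_vec_vec intro: C_infinity_imp_differentiable)
    then obtain a' where a': "(a has_vector_derivative a') (at 0)" by (auto simp: vector_derivative_works)
    have "blinfun_apply a' X = comp_fun (ad H eh Z X) v" for X
    proof -
      have "((\<lambda>t. blinfun_apply (a t) X) has_vector_derivative blinfun_apply a' X) (at 0)"
        by (rule bounded_linear.has_vector_derivative[OF blinfun.bounded_linear_left a'])
      then show ?thesis
        using dressing_derivative[OF v, of X Z] by (auto simp: a_def comp_fun_def intro: vector_derivative_unique_at)
    qed
    moreover have "(b has_vector_derivative - ad H eh Z W) (at 0)"
    proof -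
      have "((\<lambda>t::real. - t) has_vector_derivative - 1) (at 0)"
        by (auto intro!: derivative_eq_intros simp flip: has_real_derivative_iff_has_vector_derivative)
      from vector_diff_chain_at[OF this, of "\<lambda>t. Ad H eh (eh (t *\<^sub>R Z)) W"] H.ad_has_vector_derivative[of Z W]
      show ?thesis by (simp add: b_def[abs_def] comp_def)
    qed
    from bounded_bilinear.has_vector_derivative[OF bounded_bilinear_blinfun_apply a' this]
    have "((\<lambda>t. blinfun_apply (a t) (b t)) has_vector_derivative
        blinfun_apply (a 0) (- ad H eh Z W) + blinfun_apply a' (b 0)) (at 0)" .
    moreover have "a 0 = Is v" using v by (simp add: a_def dp_one H_one)
    moreover have "b 0 = W" by (simp add: b_def)
    moreover have "f (k \<otimes>\<^bsub>H\<^esub> eh (t *\<^sub>R Z)) = blinfun_apply (a t) (b t)" for t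
    proof -
      have "dp (k \<otimes>\<^bsub>H\<^esub> eh (t *\<^sub>R Z)) u = dp (eh (t *\<^sub>R Z)) v"
        using k u by (simp add: v_def H_mult dp_mult H_in_G)
      moreover have "Ad H eh (inv\<^bsub>H\<^esub> (k \<otimes>\<^bsub>H\<^esub> eh (t *\<^sub>R Z))) V = b t"
        using k by (simp add: b_def W_def H.inv_mult_group H.Ad_mult H.exp_uminus)
      ultimately show ?thesis by (simp add: f_def a_def)
    qed
    ultimately show "((\<lambda>t. f (k \<otimes>\<^bsub>H\<^esub> eh (t *\<^sub>R Z))) has_vector_derivative 0) (at 0)"
      by (simp add: comp_fun_def blinfun.minus_right)
  qed
  also have "f \<one>\<^bsub>H\<^esub> = blinfun_apply (Is u) V" using u by (simp add: f_def H_one dp_one) (simp flip: H_one)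
  finally show "blinfun_apply (Is (dp h u)) V0 = blinfun_apply (coAd H eh h (Is u)) V0"
    using h by (simp add: f_def V_def H.coAd_apply flip: H.Ad_mult)
qed

end

section \<open>Algebra of the two actions\<close>

context dressing
begin

text \<open>The operations of \<open>H\<close> are rewritten to those of \<open>G\<close> throughout, with which they agree on \<open>H\<close>.\<close>

abbreviation mult (infixl "\<odot>" 70) where "x \<odot> y \<equiv> x \<otimes>\<^bsub>G\<^esub> y"
abbreviation smult (infixl "\<star>" 70) where "u \<star> v \<equiv> u \<otimes>\<^bsub>Gs\<^esub> v"
abbreviation ginv where "ginv x \<equiv> inv\<^bsub>G\<^esub> x"
abbreviation sinv where "sinv u \<equiv> inv\<^bsub>Gs\<^esub> u"

text \<open>The left action of \<open>H\<close> on \<open>\<h>\<^sup>*\<close> by which \<open>H\<close> enters the target map of \<open>X\<^sup>*\<close>.\<close>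

definition rho where "rho h p = coAd H eh (ginv h) p"

text \<open>\<open>conj2 h g k\<close> is the product \<open>h g k\<^sup>-\<^sup>1\<close> occurring in both actions.\<close>

definition conj2 where "conj2 h g k = h \<odot> g \<odot> ginv k"

lemma H_closed: "h \<in> carrier H \<Longrightarrow> k \<in> carrier H \<Longrightarrow> h \<odot> k \<in> carrier H"
  "h \<in> carrier H \<Longrightarrow> ginv h \<in> carrier H" "\<one>\<^bsub>G\<^esub> \<in> carrier H"
  using sub by (auto simp: lie_subgroup_def subgroup.m_closed subgroup.m_inv_closed subgroup.one_closed)

lemmas closed = H_closed H_in_G dp_closed dm_closed

lemma rho_one [simp]: "rho \<one>\<^bsub>G\<^esub> p = p"
  using H.coAd_one[of p] by (simp add: rho_def H_one)

lemma rho_mult: "h \<in> carrier H \<Longrightarrow> k \<in> carrier H \<Longrightarrow> rho (h \<odot> k) p = rho h (rho k p)"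
  using H.coAd_mult[of "ginv k" "ginv h" p]
  by (simp add: rho_def H_mult H_closed H_in_G G.inv_mult_group)

lemma rho_add: "h \<in> carrier H \<Longrightarrow> rho h (p + q) = rho h p + rho h q"
  by (simp add: rho_def H.coAd_add H_closed)

lemma rho_Is: "h \<in> carrier H \<Longrightarrow> v \<in> carrier Gs \<Longrightarrow> rho h (Is v) = Is (dp (ginv h) v)"
  by (simp add: rho_def Is_dressing H_closed)

lemma rho_Is_inv: "h \<in> carrier H \<Longrightarrow> v \<in> carrier Gs \<Longrightarrow> rho (ginv h) (Is v) = Is (dp h v)"
  using rho_Is[of "ginv h" v] by (simp add: H_closed H_in_G)

lemma rho_inv [simp]:
  assumes "h \<in> carrier H"
  shows "rho (ginv h) (rho h p) = p" "rho h (rho (ginv h) p) = p"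
  using assms by (simp_all add: H_closed H_in_G flip: rho_mult)

lemma Is_one [simp]: "Is \<one>\<^bsub>Gs\<^esub> = 0"
  using Is_mult[of "\<one>\<^bsub>Gs\<^esub>" "\<one>\<^bsub>Gs\<^esub>"] by simp

lemma Is_inv: "u \<in> carrier Gs \<Longrightarrow> Is (sinv u) = - Is u"
  using Is_mult[of "sinv u" u] by (simp add: eq_neg_iff_add_eq_0)

lemma dp_unit [simp]: "x \<in> carrier G \<Longrightarrow> dp x \<one>\<^bsub>Gs\<^esub> = \<one>\<^bsub>Gs\<^esub>"
  using twist_plus[of x "\<one>\<^bsub>Gs\<^esub>" "\<one>\<^bsub>Gs\<^esub>"] by (simp add: dm_one dp_closed)

lemma dm_unit [simp]: "u \<in> carrier Gs \<Longrightarrow> dm u \<one>\<^bsub>G\<^esub> = \<one>\<^bsub>G\<^esub>"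
  by (simp add: H_fixed H_closed)

lemma dp_inv_dp [simp]: "x \<in> carrier G \<Longrightarrow> u \<in> carrier Gs \<Longrightarrow> dp (ginv x) (dp x u) = u"
  and dp_dp_inv [simp]: "x \<in> carrier G \<Longrightarrow> u \<in> carrier Gs \<Longrightarrow> dp x (dp (ginv x) u) = u"
  by (simp_all add: dp_one flip: dp_mult)

lemma dp_H_mult:
  "h \<in> carrier H \<Longrightarrow> u \<in> carrier Gs \<Longrightarrow> v \<in> carrier Gs \<Longrightarrow> dp h (u \<star> v) = dp h u \<star> dp h v"
  by (simp add: twist_plus H_fixed H_in_G)

text \<open>Apply \<open>twist_plus\<close> to \<open>u\<inverse> u = 1\<close>.\<close>

lemma dp_dm_inv:
  assumes "x \<in> carrier G" "u \<in> carrier Gs"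
  shows "dp (dm u x) (sinv u) = sinv (dp x u)"
proof -
  have "dp (dm u x) (sinv u) \<star> dp x u = \<one>\<^bsub>Gs\<^esub>" using assms by (simp flip: twist_plus)
  then show ?thesis using assms by (intro Gs.inv_equality[symmetric]) (auto intro: closed)
qed

lemma dp_H_inv: "h \<in> carrier H \<Longrightarrow> u \<in> carrier Gs \<Longrightarrow> dp h (sinv u) = sinv (dp h u)"
  using dp_dm_inv[of h u] by (simp add: H_fixed H_in_G)

lemma dm_conj2:
  assumes "h \<in> carrier H" "k \<in> carrier H" "y \<in> carrier G" "u \<in> carrier Gs"
  shows "dm u (conj2 h y k) = conj2 h (dm (dp h u) y) k"
  using assms by (simp add: conj2_def closed twist_minus H_fixed)

lemma conj2_closed: "h \<in> carrier H \<Longrightarrow> k \<in> carrier H \<Longrightarrow> y \<in> carrier G \<Longrightarrow> conj2 h y k \<in> carrier G"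
  by (simp add: conj2_def closed)

lemma inv_cancel: "x \<in> carrier G \<Longrightarrow> y \<in> carrier G \<Longrightarrow> ginv x \<odot> (x \<odot> y) = y"
  by (simp flip: G.m_assoc)

lemma conj2_mult:
  assumes "h \<in> carrier H" "k \<in> carrier H" "l \<in> carrier H" "g \<in> carrier G" "g' \<in> carrier G"
  shows "conj2 h (g \<odot> g') l = conj2 h g k \<odot> conj2 k g' l"
  using assms by (simp add: conj2_def closed G.m_assoc inv_cancel)

lemma conj2_conj2:
  assumes "h \<in> carrier H" "k \<in> carrier H" "h' \<in> carrier H" "k' \<in> carrier H" "g \<in> carrier G"
  shows "conj2 (h \<odot> h') g (k \<odot> k') = conj2 h (conj2 h' g k') k"
  using assms by (simp add: conj2_def closed G.m_assoc G.inv_mult_group)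

lemma conj2_inv:
  assumes "h \<in> carrier H" "k \<in> carrier H" "g \<in> carrier G"
  shows "ginv (conj2 h g k) = conj2 k (ginv g) h"
  using assms by (simp add: conj2_def closed G.m_assoc G.inv_mult_group)

lemma conj2_cancel:
  assumes "h \<in> carrier H" "k \<in> carrier H" "g \<in> carrier G"
  shows "conj2 (ginv h) (conj2 h g k) (ginv k) = g"
  using assms by (simp add: conj2_def closed G.m_assoc inv_cancel)

lemma conj2_unit: "h \<in> carrier H \<Longrightarrow> conj2 h \<one>\<^bsub>G\<^esub> h = \<one>\<^bsub>G\<^esub>"
  and conj2_one: "g \<in> carrier G \<Longrightarrow> conj2 \<one>\<^bsub>G\<^esub> g \<one>\<^bsub>G\<^esub> = g"
  by (simp_all add: conj2_def closed)

lemma dp_conj2: "h \<in> carrier H \<Longrightarrow> k \<in> carrier H \<Longrightarrow> y \<in> carrier G \<Longrightarrow> u \<in> carrier Gs \<Longrightarrow>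
    dp (conj2 h y k) u = dp (ginv k) (dp y (dp h u))"
  by (simp add: conj2_def closed dp_mult)

text \<open>The first argument is a product in \<open>X\<^sup>*\<close>. The two lemmas express that \<open>\<Psi>\<^sup>-\<close> is an action, and that
  the vertical source is multiplicative for the horizontal product.\<close>

lemma dm_product:
  assumes "h \<in> carrier H" "k \<in> carrier H" "y \<in> carrier G" "u \<in> carrier Gs" "u' \<in> carrier Gs"
  shows "dm (u \<star> dp (ginv h) u') (conj2 h y k) = dm u (conj2 h (dm u' y) k)"
  using assms by (simp add: dm_mult closed conj2_closed dm_conj2[of _ _ _ "dp (ginv h) u'"])

lemma dp_product:
  assumes "h \<in> carrier H" "k \<in> carrier H" "y \<in> carrier G" "u \<in> carrier Gs" "u' \<in> carrier Gs"
  shows "dp (conj2 h y k) (u \<star> dp (ginv h) u') = dp (conj2 h (dm u' y) k) u \<star> dp (ginv k) (dp y u')"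
  using assms by (simp add: twist_plus closed conj2_closed dm_conj2[of _ _ _ "dp (ginv h) u'"]
      dp_conj2[of _ _ _ "dp (ginv h) u'"])

section \<open>The structure maps in coordinates\<close>

abbreviation "Xs \<equiv> Xs_groupoid H eh Gs Is dp"
abbreviation X :: "(('w \<Rightarrow>\<^sub>L real) \<times> 'a \<times> ('w \<Rightarrow>\<^sub>L real), 'w \<Rightarrow>\<^sub>L real) groupoid" where
  "X \<equiv> X_groupoid G"
abbreviation "Hor \<equiv> horizontal_groupoid G H eh Gs Is dp dm"
abbreviation "Ver \<equiv> vertical_groupoid G H eh Gs Is dp dm"
definition S :: "(('a \<times> ('w \<Rightarrow>\<^sub>L real) \<times> 'd \<times> 'a) \<times> (('w \<Rightarrow>\<^sub>L real) \<times> 'a \<times> ('w \<Rightarrow>\<^sub>L real))) set"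
  where "S = {((h, p, u, k), (p', g, q)) |h p u k p' g q.
  p = p' \<and> h \<in> carrier H \<and> u \<in> carrier Gs \<and> k \<in> carrier H \<and> g \<in> carrier G}"

lemma in_S [simp]: "((h, p, u, k), (p', g, q)) \<in> S \<longleftrightarrow>
  p = p' \<and> h \<in> carrier H \<and> u \<in> carrier Gs \<and> k \<in> carrier H \<and> g \<in> carrier G"
  by (auto simp: S_def)

lemma S_E:
  assumes "s \<in> S"
  obtains h p u k g q where "s = ((h, p, u, k), (p, g, q))"
    "h \<in> carrier H" "u \<in> carrier Gs" "k \<in> carrier H" "g \<in> carrier G"
  using assms by (auto simp: S_def)

lemma Xs_simps:
  "arrows Xs = carrier H \<times> UNIV \<times> carrier Gs" "objects Xs = UNIV"
  "h \<in> carrier H \<Longrightarrow> target Xs (h, p, u) = rho h p + Is u" "source Xs (h, p, u) = p"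
  "ident Xs q = (\<one>\<^bsub>G\<^esub>, q, \<one>\<^bsub>Gs\<^esub>)"
  "h \<in> carrier H \<Longrightarrow> k \<in> carrier H \<Longrightarrow> comp_arr Xs (h, p, u) (k, q, v) = (h \<odot> k, q, u \<star> dp (ginv h) v)"
  by (simp_all add: Xs_groupoid_def rho_def H_inv H_one H_mult)

lemma X_simps:
  "arrows X = UNIV \<times> carrier G \<times> UNIV" "objects X = UNIV"
  "target X (p, g, q) = p" "source X (p, g, q) = q" "ident X p = (p, \<one>\<^bsub>G\<^esub>, p)"
  "comp_arr X (p, g, q) (q', g', r) = (p, g \<odot> g', r)"
  by (simp_all add: X_groupoid_def)

lemma Hor_simps:
  "arrows Hor = S" "objects Hor = UNIV \<times> carrier G \<times> UNIV"
  "h \<in> carrier H \<Longrightarrow> k \<in> carrier H \<Longrightarrow> target Hor ((h, p, u, k), (p', g, q)) =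
     (rho h p + Is u, dm u (conj2 h g k), rho k q + Is (dp (conj2 h g k) u))"
  "source Hor (x, s) = s"
  "ident Hor (p, g, q) = ((\<one>\<^bsub>G\<^esub>, p, \<one>\<^bsub>Gs\<^esub>, \<one>\<^bsub>G\<^esub>), (p, g, q))"
  "h \<in> carrier H \<Longrightarrow> k \<in> carrier H \<Longrightarrow> h' \<in> carrier H \<Longrightarrow> k' \<in> carrier H \<Longrightarrow>
     comp_arr Hor ((h, p, u, k), s) ((h', p', u', k'), s') =
       ((h \<odot> h', p', u \<star> dp (ginv h) u', k \<odot> k'), s')"
  by (auto simp: S_def horizontal_groupoid_def left_action_groupoid_def Xse_groupoid_def Psi_minus_def
      Xs_simps X_simps H_inv H_one H_mult rho_def conj2_def)

lemma swap_apply: "swap_factors ((h, p, u, k), (p', g, q)) = ((h, p, u), (h, k, p', g, q))"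
  by (simp add: swap_factors_def)

lemma swap_inj: "inj_on swap_factors S"
  by (auto simp: inj_on_def swap_factors_def S_def)

lemma right_arrows:
  "arrows (right_groupoid G H eh Gs Is dp) = swap_factors ` S"
  unfolding right_groupoid_def right_action_groupoid_def Xe_groupoid_def
  by (force simp: Xs_simps X_simps swap_factors_def S_def)

lemma swap_inv:
  assumes "h \<in> carrier H" "u \<in> carrier Gs" "k \<in> carrier H" "g \<in> carrier G"
  shows "inv_into S swap_factors ((h, p, u), (h, k, p, g, q)) = ((h, p, u, k), (p, g, q))"
  by (rule inv_into_f_eq[OF swap_inj]) (use assms in \<open>auto simp: swap_factors_def\<close>)

lemma Ver_simps:
  "arrows Ver = S" "objects Ver = carrier H \<times> UNIV \<times> carrier Gs"
  "target Ver ((h, p, u, k), (p', g, q)) = (h, p, u)"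
  "source Ver ((h, p, u, k), (p', g, q)) = (k, q, dp (conj2 h g k) u)"
  "h \<in> carrier H \<Longrightarrow> u \<in> carrier Gs \<Longrightarrow> ident Ver (h, p, u) = ((h, p, u, h), (p, \<one>\<^bsub>G\<^esub>, p))"
  "h \<in> carrier H \<Longrightarrow> u \<in> carrier Gs \<Longrightarrow> l \<in> carrier H \<Longrightarrow> g \<in> carrier G \<Longrightarrow> g' \<in> carrier G \<Longrightarrow>
     comp_arr Ver ((h, p, u, k), (p, g, q)) ((k', q', u', l), (q'', g', r)) = ((h, p, u, l), (p, g \<odot> g', r))"
  unfolding vertical_groupoid_def transport_groupoid_def Hor_simps(1)
  by (simp_all add: right_groupoid_def right_action_groupoid_def Xe_groupoid_def Psi_plus_def swap_inv
      Xs_simps X_simps conj2_def swap_apply)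

end

section \<open>Groupoids and their morphisms\<close>

lemma is_groupoidI:
  assumes "\<And>x. x \<in> arrows \<G> \<Longrightarrow> target \<G> x \<in> objects \<G> \<and> source \<G> x \<in> objects \<G>"
    and "\<And>b. b \<in> objects \<G> \<Longrightarrow> ident \<G> b \<in> arrows \<G> \<and> target \<G> (ident \<G> b) = b \<and> source \<G> (ident \<G> b) = b"
    and "\<And>x y. x \<in> arrows \<G> \<Longrightarrow> y \<in> arrows \<G> \<Longrightarrow> source \<G> x = target \<G> y \<Longrightarrow> comp_arr \<G> x y \<in> arrows \<G> \<and>
        target \<G> (comp_arr \<G> x y) = target \<G> x \<and> source \<G> (comp_arr \<G> x y) = source \<G> y"
    and "\<And>x y z. x \<in> arrows \<G> \<Longrightarrow> y \<in> arrows \<G> \<Longrightarrow> z \<in> arrows \<G> \<Longrightarrow> source \<G> x = target \<G> y \<Longrightarrow>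
        source \<G> y = target \<G> z \<Longrightarrow>
        comp_arr \<G> (comp_arr \<G> x y) z = comp_arr \<G> x (comp_arr \<G> y z)"
    and "\<And>x. x \<in> arrows \<G> \<Longrightarrow> comp_arr \<G> (ident \<G> (target \<G> x)) x = x \<and>
        comp_arr \<G> x (ident \<G> (source \<G> x)) = x"
    and "\<And>x. x \<in> arrows \<G> \<Longrightarrow> is_inverse \<G> x (i x)"
  shows "is_groupoid \<G>"
  unfolding is_groupoid_def
proof (intro conjI)
  show "\<forall>x\<in>arrows \<G>. \<exists>y. is_inverse \<G> x y" using assms(6) by blast
  show "\<forall>x y z. (x, y) \<in> composable \<G> \<and> (y, z) \<in> composable \<G> \<longrightarrow>
      comp_arr \<G> (comp_arr \<G> x y) z = comp_arr \<G> x (comp_arr \<G> y z)"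
    using assms(4) by (simp add: composable_def)
  show "\<forall>(x, y)\<in>composable \<G>. comp_arr \<G> x y \<in> arrows \<G> \<and>
      target \<G> (comp_arr \<G> x y) = target \<G> x \<and> source \<G> (comp_arr \<G> x y) = source \<G> y"
    using assms(3) by (simp add: composable_def split_beta)
qed (use assms(1,2,5) in simp_all)

text \<open>The algebraic part of \<^const>\<open>lie_groupoid_morphism\<close>.\<close>

definition groupoid_morphism ::
   "('x, 'b) groupoid \<Rightarrow> ('y, 'c) groupoid \<Rightarrow> ('x \<Rightarrow> 'y) \<Rightarrow> ('b \<Rightarrow> 'c) \<Rightarrow> bool" where
  "groupoid_morphism \<A> \<B> F f \<longleftrightarrow>
     (\<forall>x\<in>arrows \<A>. F x \<in> arrows \<B> \<and>
        target \<B> (F x) = f (target \<A> x) \<and> source \<B> (F x) = f (source \<A> x)) \<and>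
     (\<forall>b\<in>objects \<A>. f b \<in> objects \<B> \<and> F (ident \<A> b) = ident \<B> (f b)) \<and>
     (\<forall>(x, y)\<in>composable \<A>. F (comp_arr \<A> x y) = comp_arr \<B> (F x) (F y))"

lemma groupoid_morphismI:
  assumes "\<And>x. x \<in> arrows \<A> \<Longrightarrow> F x \<in> arrows \<B> \<and>
        target \<B> (F x) = f (target \<A> x) \<and> source \<B> (F x) = f (source \<A> x)"
    and "\<And>b. b \<in> objects \<A> \<Longrightarrow> f b \<in> objects \<B> \<and> F (ident \<A> b) = ident \<B> (f b)"
    and "\<And>x y. x \<in> arrows \<A> \<Longrightarrow> y \<in> arrows \<A> \<Longrightarrow> source \<A> x = target \<A> y \<Longrightarrow>
        F (comp_arr \<A> x y) = comp_arr \<B> (F x) (F y)"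
  shows "groupoid_morphism \<A> \<B> F f"
  unfolding groupoid_morphism_def using assms by (auto simp: composable_def)

lemma lie_groupoid_morphism_iff:
  "lie_groupoid_morphism \<A> A A0 \<B> B B0 F f \<longleftrightarrow>
    smooth_map_on A B (arrows \<A>) F \<and> smooth_map_on A0 B0 (objects \<A>) f \<and> groupoid_morphism \<A> \<B> F f"
  by (simp only: lie_groupoid_morphism_def groupoid_morphism_def)

text \<open>Structure maps of Lie groupoids are smooth by definition, which leaves the algebra.\<close>

lemma structure_maps_morphismsI:
  assumes S: "lie_groupoid \<S> AS AL" and T: "lie_groupoid \<T> AS AK"
    and K: "lie_groupoid \<K> AK AB" and L: "lie_groupoid \<L> AL AB"
    and m: "groupoid_morphism \<T> \<L> (source \<S>) (source \<K>)" "groupoid_morphism \<T> \<L> (target \<S>) (target \<K>)"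
      "groupoid_morphism (composable_groupoid \<S> \<T> \<K>) \<T> (\<lambda>(s, t). comp_arr \<S> s t) (\<lambda>(a, b). comp_arr \<K> a b)"
      "groupoid_morphism \<L> \<T> (ident \<S>) (ident \<K>)"
      "groupoid_morphism \<T> \<T> (inv_arr \<S>) (inv_arr \<K>)"
  shows "structure_maps_morphisms \<S> \<T> \<K> \<L> AS AK AL AB"
proof -
  have on: "smooth_map_on A B (points A) f" if "smooth_manifold A" "smooth_map A B f"
    for A :: "('p, 'e1::finite_dim_normed) atlas" and B :: "('q, 'e2::finite_dim_normed) atlas" and f
    by (rule smooth_map_onI[OF that]) auto
  note S' = S[unfolded lie_groupoid_def submersion_def] and T' = T[unfolded lie_groupoid_def submersion_def]
    and K' = K[unfolded lie_groupoid_def submersion_def] and L' = L[unfolded lie_groupoid_def submersion_def]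
  have pts: "arrows \<T> = points AS" "objects \<T> = points AK" "arrows \<L> = points AL" "objects \<L> = points AB"
    using T' L' by auto
  have c: "smooth_map_on (prod_atlas AS AS) AS (arrows (composable_groupoid \<S> \<T> \<K>)) (\<lambda>(s, t). comp_arr \<S> s t)"
    "smooth_map_on (prod_atlas AK AK) AK (objects (composable_groupoid \<S> \<T> \<K>)) (\<lambda>(s, t). comp_arr \<K> s t)"
    using S' K' by (simp_all add: composable_groupoid_def)
  have M: "smooth_manifold AS" "smooth_manifold AK" "smooth_manifold AL" "smooth_manifold AB"
    using S' K' by auto
  have f: "smooth_map AS AL (source \<S>)" "smooth_map AS AL (target \<S>)" "smooth_map AL AS (ident \<S>)"
     "smooth_map AS AS (inv_arr \<S>)" "smooth_map AK AB (source \<K>)" "smooth_map AK AB (target \<K>)"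
     "smooth_map AB AK (ident \<K>)" "smooth_map AK AK (inv_arr \<K>)"
    using S' K' by auto
  show ?thesis
    unfolding structure_maps_morphisms_def lie_groupoid_morphism_iff pts
    by (intro conjI on c M f m)
qed

lemma groupoid_morphismD:
  assumes "groupoid_morphism \<A> \<B> F f"
  shows "x \<in> arrows \<A> \<Longrightarrow> F x \<in> arrows \<B>" "x \<in> arrows \<A> \<Longrightarrow> target \<B> (F x) = f (target \<A> x)"
    "x \<in> arrows \<A> \<Longrightarrow> source \<B> (F x) = f (source \<A> x)"
    "b \<in> objects \<A> \<Longrightarrow> f b \<in> objects \<B>" "b \<in> objects \<A> \<Longrightarrow> F (ident \<A> b) = ident \<B> (f b)"
    "x \<in> arrows \<A> \<Longrightarrow> y \<in> arrows \<A> \<Longrightarrow> source \<A> x = target \<A> y \<Longrightarrow>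
      F (comp_arr \<A> x y) = comp_arr \<B> (F x) (F y)"
  using assms by (auto simp: groupoid_morphism_def composable_def)

lemma groupoidD:
  assumes "is_groupoid \<G>" and x: "x \<in> arrows \<G>"
  shows "target \<G> x \<in> objects \<G>" "source \<G> x \<in> objects \<G>" "is_inverse \<G> x (inv_arr \<G> x)"
    and "y \<in> arrows \<G> \<Longrightarrow> source \<G> x = target \<G> y \<Longrightarrow> comp_arr \<G> x y \<in> arrows \<G> \<and>
        target \<G> (comp_arr \<G> x y) = target \<G> x \<and> source \<G> (comp_arr \<G> x y) = source \<G> y"
proof -
  show "target \<G> x \<in> objects \<G>" "source \<G> x \<in> objects \<G>" using assms by (auto simp: is_groupoid_def)
  obtain z where "is_inverse \<G> x z" using assms unfolding is_groupoid_def by blast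
  then show "is_inverse \<G> x (inv_arr \<G> x)" using inv_arr_eq[OF assms] by simp
  assume "y \<in> arrows \<G>" "source \<G> x = target \<G> y"
  then have "(x, y) \<in> composable \<G>" using x by (simp add: composable_def)
  with assms(1) show "comp_arr \<G> x y \<in> arrows \<G> \<and>
      target \<G> (comp_arr \<G> x y) = target \<G> x \<and> source \<G> (comp_arr \<G> x y) = source \<G> y"
    unfolding is_groupoid_def by blast
qed

lemma groupoid_morphism_inv_arr:
  assumes A: "is_groupoid \<A>" and B: "is_groupoid \<B>" and F: "groupoid_morphism \<A> \<B> F f" and x: "x \<in> arrows \<A>"
  shows "F (inv_arr \<A> x) = inv_arr \<B> (F x)"
proof (rule inv_arr_eq[OF B _, symmetric])
  note m = groupoid_morphismD[OF F]
  show "F x \<in> arrows \<B>" by (rule m(1)[OF x])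
  show "is_inverse \<B> (F x) (F (inv_arr \<A> x))"
    using groupoidD(1-3)[OF A x] x
    by (simp add: is_inverse_def m(1-3) flip: m(5,6))
qed

text \<open>If the source, target and unit maps of two groupoid structures on the same set are morphisms and the
  interchange law holds, so are multiplication and inversion. For the inversion of \<open>\<S>\<close>: the
  \<open>\<T>\<close>-product of the \<open>\<S>\<close>-inverses of \<open>s\<close> and \<open>t\<close> is, by interchange, an \<open>\<S>\<close>-inverse of the \<open>\<T>\<close>-product
  of \<open>s\<close> and \<open>t\<close>.\<close>

context
  fixes \<S> :: "('s, 'x) groupoid" and \<T> :: "('s, 'y) groupoid" and \<K> :: "('y, 'b) groupoid" and \<L> :: "('x, 'b) groupoid"
  assumes S: "is_groupoid \<S>" and T: "is_groupoid \<T>" and K: "is_groupoid \<K>"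
    and arrows_eq: "arrows \<T> = arrows \<S>" and objects_eq: "objects \<T> = arrows \<K>"
    and sT: "groupoid_morphism \<S> \<K> (source \<T>) (source \<L>)" and tT: "groupoid_morphism \<S> \<K> (target \<T>) (target \<L>)"
    and iT: "groupoid_morphism \<K> \<S> (ident \<T>) (ident \<L>)"
    and interchange: "\<And>s t s' t'. s \<in> arrows \<S> \<Longrightarrow> t \<in> arrows \<S> \<Longrightarrow> s' \<in> arrows \<S> \<Longrightarrow> t' \<in> arrows \<S> \<Longrightarrow>
      source \<S> s = target \<S> t \<Longrightarrow> source \<S> s' = target \<S> t' \<Longrightarrow>
      source \<T> s = target \<T> s' \<Longrightarrow> source \<T> t = target \<T> t' \<Longrightarrow>
      comp_arr \<S> (comp_arr \<T> s s') (comp_arr \<T> t t') = comp_arr \<T> (comp_arr \<S> s t) (comp_arr \<S> s' t')"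
begin

lemma comp_morphism_if_interchange:
  "groupoid_morphism (composable_groupoid \<S> \<T> \<K>) \<T> (\<lambda>(s, t). comp_arr \<S> s t) (\<lambda>(a, b). comp_arr \<K> a b)"
proof (rule groupoid_morphismI)
  fix x assume "x \<in> arrows (composable_groupoid \<S> \<T> \<K>)"
  then obtain s t where x: "x = (s, t)" and st: "s \<in> arrows \<S>" "t \<in> arrows \<S>" "source \<S> s = target \<S> t"
    by (auto simp: composable_groupoid_def composable_def)
  show "(case x of (s, t) \<Rightarrow> comp_arr \<S> s t) \<in> arrows \<T> \<and>
      target \<T> (case x of (s, t) \<Rightarrow> comp_arr \<S> s t) =
        (case target (composable_groupoid \<S> \<T> \<K>) x of (a, b) \<Rightarrow> comp_arr \<K> a b) \<and>
      source \<T> (case x of (s, t) \<Rightarrow> comp_arr \<S> s t) =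
        (case source (composable_groupoid \<S> \<T> \<K>) x of (a, b) \<Rightarrow> comp_arr \<K> a b)"
    using groupoidD(4)[OF S st] st
    by (simp add: x composable_groupoid_def arrows_eq groupoid_morphismD(6)[OF sT] groupoid_morphismD(6)[OF tT])
next
  fix b assume "b \<in> objects (composable_groupoid \<S> \<T> \<K>)"
  then obtain k l where b: "b = (k, l)" and kl: "k \<in> arrows \<K>" "l \<in> arrows \<K>" "source \<K> k = target \<K> l"
    by (auto simp: composable_groupoid_def composable_def)
  show "(case b of (a, b) \<Rightarrow> comp_arr \<K> a b) \<in> objects \<T> \<and>
      (case ident (composable_groupoid \<S> \<T> \<K>) b of (s, t) \<Rightarrow> comp_arr \<S> s t) =
        ident \<T> (case b of (a, b) \<Rightarrow> comp_arr \<K> a b)"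
    using groupoidD(4)[OF K kl] kl
    by (simp add: b composable_groupoid_def objects_eq groupoid_morphismD(6)[OF iT])
next
  fix x y assume "x \<in> arrows (composable_groupoid \<S> \<T> \<K>)" "y \<in> arrows (composable_groupoid \<S> \<T> \<K>)"
    "source (composable_groupoid \<S> \<T> \<K>) x = target (composable_groupoid \<S> \<T> \<K>) y"
  then show "(case comp_arr (composable_groupoid \<S> \<T> \<K>) x y of (s, t) \<Rightarrow> comp_arr \<S> s t) =
      comp_arr \<T> (case x of (s, t) \<Rightarrow> comp_arr \<S> s t) (case y of (s, t) \<Rightarrow> comp_arr \<S> s t)"
    by (cases x; cases y) (simp add: composable_groupoid_def composable_def interchange)
qed

lemma inv_morphism_if_interchange:
  assumes sS: "groupoid_morphism \<T> \<L> (source \<S>) (source \<K>)" and tS: "groupoid_morphism \<T> \<L> (target \<S>) (target \<K>)"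
    and iS: "groupoid_morphism \<L> \<T> (ident \<S>) (ident \<K>)"
  shows "groupoid_morphism \<T> \<T> (inv_arr \<S>) (inv_arr \<K>)"
proof -
  note inv = groupoidD(3)[OF S, unfolded is_inverse_def]
  note inv_sT = groupoid_morphism_inv_arr[OF S K sT] and inv_tT = groupoid_morphism_inv_arr[OF S K tT]
  show ?thesis
  proof (rule groupoid_morphismI)
    show "inv_arr \<S> s \<in> arrows \<T> \<and> target \<T> (inv_arr \<S> s) = inv_arr \<K> (target \<T> s) \<and>
        source \<T> (inv_arr \<S> s) = inv_arr \<K> (source \<T> s)" if "s \<in> arrows \<T>" for s
      using that inv[of s] inv_sT[of s] inv_tT[of s] by (simp add: arrows_eq)
    show "inv_arr \<K> k \<in> objects \<T> \<and> inv_arr \<S> (ident \<T> k) = ident \<T> (inv_arr \<K> k)" if "k \<in> objects \<T>" for k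
      using that groupoidD(3)[OF K, of k] groupoid_morphism_inv_arr[OF K S iT, of k]
      by (simp add: objects_eq is_inverse_def)
    fix s t assume "s \<in> arrows \<T>" "t \<in> arrows \<T>" and st: "source \<T> s = target \<T> t"
    then have s: "s \<in> arrows \<S>" and t: "t \<in> arrows \<S>" by (simp_all add: arrows_eq)
    let ?s = "inv_arr \<S> s" and ?t = "inv_arr \<S> t"
    note si = inv[OF s] and ti = inv[OF t]
    have st': "source \<T> ?s = target \<T> ?t" using inv_sT[OF s] inv_tT[OF t] st by simp
    have arr: "comp_arr \<T> s t \<in> arrows \<S>" "comp_arr \<T> ?s ?t \<in> arrows \<S>"
      using groupoidD(4)[OF T _ _ st] groupoidD(4)[OF T _ _ st'] s t si ti by (simp_all add: arrows_eq)
    have ends: "source \<S> (comp_arr \<T> s t) = comp_arr \<L> (source \<S> s) (source \<S> t)"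
      "target \<S> (comp_arr \<T> s t) = comp_arr \<L> (target \<S> s) (target \<S> t)"
      "source \<S> (comp_arr \<T> ?s ?t) = comp_arr \<L> (target \<S> s) (target \<S> t)"
      "target \<S> (comp_arr \<T> ?s ?t) = comp_arr \<L> (source \<S> s) (source \<S> t)"
      using groupoid_morphismD(6)[OF sS] groupoid_morphismD(6)[OF tS] s t st st' si ti by (simp_all add: arrows_eq)
    have L: "source \<S> s \<in> arrows \<L>" "source \<S> t \<in> arrows \<L>" "source \<L> (source \<S> s) = target \<L> (source \<S> t)"
      "target \<S> s \<in> arrows \<L>" "target \<S> t \<in> arrows \<L>" "source \<L> (target \<S> s) = target \<L> (target \<S> t)"
      using groupoid_morphismD(1-3)[OF sS] groupoid_morphismD(1-3)[OF tS] s t st by (simp_all add: arrows_eq)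
    have "is_inverse \<S> (comp_arr \<T> s t) (comp_arr \<T> ?s ?t)"
      unfolding is_inverse_def ends
      using s t st st' si ti arr L by (simp add: interchange groupoid_morphismD(6)[OF iS])
    then show "inv_arr \<S> (comp_arr \<T> s t) = comp_arr \<T> ?s ?t" by (rule inv_arr_eq[OF S arr(1)])
  qed
qed

end

section \<open>The four groupoids\<close>

context dressing
begin

definition X_inv where "X_inv = (\<lambda>(p, g, q). (q, ginv g, p))"
definition Xs_inv where "Xs_inv = (\<lambda>(h, p, u). (ginv h, rho h p + Is u, dp h (sinv u)))"
definition Hor_inv where "Hor_inv = (\<lambda>((h, p, u, k), (p', g, q)).
  ((ginv h, rho h p + Is u, dp h (sinv u), ginv k),
   (rho h p + Is u, dm u (conj2 h g k), rho k q + Is (dp (conj2 h g k) u))))"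
definition Ver_inv where "Ver_inv = (\<lambda>((h, p, u, k), (p', g, q)).
  ((k, q, dp (conj2 h g k) u, h), (q, ginv g, p)))"

lemma X_inverse: "x \<in> arrows X \<Longrightarrow> is_inverse X x (X_inv x)"
  by (auto simp: is_inverse_def X_simps X_inv_def)

lemma groupoid_X: "is_groupoid X"
  by (rule is_groupoidI[of _ X_inv]) (auto simp: X_simps G.m_assoc intro!: X_inverse)

lemma Xs_inverse: "x \<in> arrows Xs \<Longrightarrow> is_inverse Xs x (Xs_inv x)"
  by (auto simp: is_inverse_def Xs_simps Xs_inv_def closed rho_add rho_Is_inv dp_H_inv Is_inv)

text \<open>Here the equivariance of \<open>I\<^sup>*\<close> enters, through \<open>rho_Is\<close>.\<close>

lemma Xs_target_comp:
  assumes "h \<in> carrier H" "k \<in> carrier H" "u \<in> carrier Gs" "v \<in> carrier Gs"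
  shows "rho (h \<odot> k) q + Is (u \<star> dp (ginv h) v) = rho h (rho k q + Is v) + Is u"
  using assms by (simp add: closed rho_mult rho_add rho_Is Is_mult)

lemma Xs_assoc:
  assumes "h \<in> carrier H" "k \<in> carrier H" "u \<in> carrier Gs" "v \<in> carrier Gs" "w \<in> carrier Gs"
  shows "u \<star> dp (ginv h) v \<star> dp (ginv (h \<odot> k)) w = u \<star> dp (ginv h) (v \<star> dp (ginv k) w)"
  using assms by (simp add: closed dp_H_mult Gs.m_assoc G.inv_mult_group dp_mult)

lemma groupoid_Xs: "is_groupoid Xs"
proof (rule is_groupoidI[of _ Xs_inv])
  fix x y z assume xyz: "x \<in> arrows Xs" "y \<in> arrows Xs" "z \<in> arrows Xs"
  obtain h p u k q v l r w where e: "x = (h, p, u)" "y = (k, q, v)" "z = (l, r, w)" by (cases x; cases y; cases z)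
  show "comp_arr Xs (comp_arr Xs x y) z = comp_arr Xs x (comp_arr Xs y z)"
    using xyz by (simp add: e Xs_simps closed Xs_assoc G.m_assoc)
qed (auto simp: Xs_simps closed dp_one Xs_target_comp intro!: Xs_inverse)

lemma Hor_inverse:
  assumes "s \<in> arrows Hor"
  shows "is_inverse Hor s (Hor_inv s)"
proof -
  from assms obtain h p u k g q where s: "s = ((h, p, u, k), (p, g, q))"
    and c: "h \<in> carrier H" "u \<in> carrier Gs" "k \<in> carrier H" "g \<in> carrier G"
    unfolding Hor_simps(1) by (rule S_E)
  have 1: "rho (ginv h) (rho h p + Is u) + Is (dp h (sinv u)) = p"
    using c by (simp add: closed rho_add rho_Is_inv dp_H_inv Is_inv)
  have 2: "conj2 (ginv h) (dm u (conj2 h g k)) (ginv k) = dm (dp h u) g"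
    using c by (simp add: dm_conj2 conj2_cancel closed)
  have 3: "dm (dp h (sinv u)) (dm (dp h u) g) = g"
    using c by (simp add: dp_H_inv dm_one closed flip: dm_mult)
  have 4: "dp (dm (dp h u) g) (dp h (sinv u)) = sinv (dp g (dp h u))"
    using c by (simp add: dp_H_inv dp_dm_inv closed)
  have 5: "rho (ginv k) (rho k q + Is (dp (conj2 h g k) u)) + Is (sinv (dp g (dp h u))) = q"
    using c by (simp add: closed conj2_closed rho_add rho_Is_inv dp_conj2 Is_inv)
  have 6: "u \<star> dp (ginv h) (dp h (sinv u)) = \<one>\<^bsub>Gs\<^esub>" "dp h (sinv u) \<star> dp h u = \<one>\<^bsub>Gs\<^esub>"
    using c by (simp_all add: closed flip: dp_H_mult)
  show ?thesis
    using c by (simp add: s is_inverse_def Hor_inv_def Hor_simps closed conj2_closed 1 2 3 4 5 6)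
qed

lemma Hor_target_comp:
  assumes "h \<in> carrier H" "k \<in> carrier H" "u \<in> carrier Gs" "h' \<in> carrier H" "k' \<in> carrier H" "u' \<in> carrier Gs"
    "g' \<in> carrier G"
  defines "x \<equiv> conj2 (h \<odot> h') g' (k \<odot> k')" and "y \<equiv> conj2 h' g' k'"
  shows "dm (u \<star> dp (ginv h) u') x = dm u (conj2 h (dm u' y) k)"
    and "dp x (u \<star> dp (ginv h) u') = dp (conj2 h (dm u' y) k) u \<star> dp (ginv k) (dp y u')"
  unfolding x_def y_def using assms(1-7) by (simp_all add: conj2_conj2 conj2_closed dm_product dp_product)

lemma groupoid_Hor: "is_groupoid Hor"
proof (rule is_groupoidI[of _ Hor_inv])
  show "target Hor s \<in> objects Hor \<and> source Hor s \<in> objects Hor" if "s \<in> arrows Hor" for s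
    using that unfolding Hor_simps(1) by (rule S_E) (simp add: Hor_simps closed conj2_closed)
  show "ident Hor b \<in> arrows Hor \<and> target Hor (ident Hor b) = b \<and> source Hor (ident Hor b) = b"
    if "b \<in> objects Hor" for b
    using that by (cases b) (simp add: Hor_simps closed conj2_one dm_one)
  show "comp_arr Hor s t \<in> arrows Hor \<and> target Hor (comp_arr Hor s t) = target Hor s \<and>
      source Hor (comp_arr Hor s t) = source Hor t"
    if "s \<in> arrows Hor" "t \<in> arrows Hor" "source Hor s = target Hor t" for s t
    using that unfolding Hor_simps(1) by (elim S_E) (auto simp: Hor_simps closed conj2_closed Xs_target_comp Hor_target_comp)
  show "comp_arr Hor (comp_arr Hor s t) r = comp_arr Hor s (comp_arr Hor t r)"
    if "s \<in> arrows Hor" "t \<in> arrows Hor" "r \<in> arrows Hor" for s t r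
    using that unfolding Hor_simps(1) by (elim S_E) (simp add: Hor_simps closed Xs_assoc G.m_assoc)
  show "comp_arr Hor (ident Hor (target Hor s)) s = s \<and> comp_arr Hor s (ident Hor (source Hor s)) = s"
    if "s \<in> arrows Hor" for s
    using that unfolding Hor_simps(1) by (rule S_E) (simp add: Hor_simps closed dp_one)
qed (rule Hor_inverse)

lemma Ver_inverse:
  assumes "s \<in> arrows Ver"
  shows "is_inverse Ver s (Ver_inv s)"
proof -
  from assms obtain h p u k g q where s: "s = ((h, p, u, k), (p, g, q))"
    and c: "h \<in> carrier H" "u \<in> carrier Gs" "k \<in> carrier H" "g \<in> carrier G"
    unfolding Ver_simps(1) by (rule S_E)
  have 1: "dp (conj2 k (ginv g) h) (dp (conj2 h g k) u) = u"
    using c by (simp add: conj2_closed flip: conj2_inv)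
  show ?thesis using c by (simp add: s is_inverse_def Ver_inv_def Ver_simps closed conj2_closed 1)
qed

lemma dp_conj2_mult:
  assumes "h \<in> carrier H" "k \<in> carrier H" "l \<in> carrier H" "g \<in> carrier G" "g' \<in> carrier G" "u \<in> carrier Gs"
  shows "dp (conj2 h (g \<odot> g') l) u = dp (conj2 k g' l) (dp (conj2 h g k) u)"
  using assms by (simp add: conj2_mult[of h k l] dp_mult conj2_closed)

lemma dm_conj2_mult:
  assumes "h \<in> carrier H" "k \<in> carrier H" "l \<in> carrier H" "g \<in> carrier G" "g' \<in> carrier G" "u \<in> carrier Gs"
  shows "dm u (conj2 h (g \<odot> g') l) = dm u (conj2 h g k) \<odot> dm (dp (conj2 h g k) u) (conj2 k g' l)"
  using assms by (simp add: conj2_mult[of h k l] twist_minus conj2_closed)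

lemma groupoid_Ver: "is_groupoid Ver"
proof (rule is_groupoidI[of _ Ver_inv])
  show "target Ver s \<in> objects Ver \<and> source Ver s \<in> objects Ver" if "s \<in> arrows Ver" for s
    using that unfolding Ver_simps(1) by (rule S_E) (simp add: Ver_simps closed conj2_closed)
  show "ident Ver b \<in> arrows Ver \<and> target Ver (ident Ver b) = b \<and> source Ver (ident Ver b) = b"
    if "b \<in> objects Ver" for b
    using that by (cases b) (simp add: Ver_simps closed conj2_unit dp_one)
  show "comp_arr Ver s t \<in> arrows Ver \<and> target Ver (comp_arr Ver s t) = target Ver s \<and>
      source Ver (comp_arr Ver s t) = source Ver t"
    if "s \<in> arrows Ver" "t \<in> arrows Ver" "source Ver s = target Ver t" for s t
    using that unfolding Ver_simps(1) by (elim S_E) (auto simp: Ver_simps closed dp_conj2_mult)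
  show "comp_arr Ver (comp_arr Ver s t) r = comp_arr Ver s (comp_arr Ver t r)"
    if "s \<in> arrows Ver" "t \<in> arrows Ver" "r \<in> arrows Ver" for s t r
    using that unfolding Ver_simps(1) by (elim S_E) (simp add: Ver_simps closed G.m_assoc)
  show "comp_arr Ver (ident Ver (target Ver s)) s = s \<and> comp_arr Ver s (ident Ver (source Ver s)) = s"
    if "s \<in> arrows Ver" for s
    using that unfolding Ver_simps(1) by (rule S_E) (simp add: Ver_simps closed conj2_closed)
qed (rule Ver_inverse)

end

section \<open>Compatibility of the two structures\<close>

context dressing
begin

lemma source_Hor_morphism: "groupoid_morphism Ver X (source Hor) (source Xs)"
proof (rule groupoid_morphismI)
  fix s t assume "s \<in> arrows Ver" "t \<in> arrows Ver"
  then show "source Hor (comp_arr Ver s t) = comp_arr X (source Hor s) (source Hor t)"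
    unfolding Ver_simps(1) by (elim S_E) (simp add: Hor_simps Ver_simps X_simps)
next
  fix s assume "s \<in> arrows Ver"
  then show "source Hor s \<in> arrows X \<and> target X (source Hor s) = source Xs (target Ver s) \<and>
      source X (source Hor s) = source Xs (source Ver s)"
    unfolding Ver_simps(1) by (elim S_E) (simp add: Hor_simps Ver_simps X_simps Xs_simps)
qed (auto simp: Hor_simps Ver_simps X_simps Xs_simps)

lemma target_Hor_morphism: "groupoid_morphism Ver X (target Hor) (target Xs)"
proof (rule groupoid_morphismI)
  fix s t assume "s \<in> arrows Ver" "t \<in> arrows Ver" "source Ver s = target Ver t"
  then show "target Hor (comp_arr Ver s t) = comp_arr X (target Hor s) (target Hor t)"
    unfolding Ver_simps(1)
    by (elim S_E) (auto simp: Hor_simps Ver_simps X_simps closed dp_conj2_mult dm_conj2_mult)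
next
  fix s assume "s \<in> arrows Ver"
  then show "target Hor s \<in> arrows X \<and> target X (target Hor s) = target Xs (target Ver s) \<and>
      source X (target Hor s) = target Xs (source Ver s)"
    unfolding Ver_simps(1) by (elim S_E) (simp add: Hor_simps Ver_simps X_simps Xs_simps closed conj2_closed)
qed (auto simp: Hor_simps Ver_simps X_simps Xs_simps closed conj2_unit dp_one)

lemma target_Ver_morphism: "groupoid_morphism Hor Xs (target Ver) (target X)"
proof (rule groupoid_morphismI)
  fix s t assume "s \<in> arrows Hor" "t \<in> arrows Hor"
  then show "target Ver (comp_arr Hor s t) = comp_arr Xs (target Ver s) (target Ver t)"
    unfolding Hor_simps(1) by (elim S_E) (simp add: Hor_simps Ver_simps Xs_simps)
next
  fix s assume "s \<in> arrows Hor"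
  then show "target Ver s \<in> arrows Xs \<and> target Xs (target Ver s) = target X (target Hor s) \<and>
      source Xs (target Ver s) = target X (source Hor s)"
    unfolding Hor_simps(1) by (elim S_E) (simp add: Hor_simps Ver_simps X_simps Xs_simps)
qed (auto simp: Hor_simps Ver_simps X_simps Xs_simps)

lemma source_Ver_morphism: "groupoid_morphism Hor Xs (source Ver) (source X)"
proof (rule groupoid_morphismI)
  fix s t assume "s \<in> arrows Hor" "t \<in> arrows Hor" "source Hor s = target Hor t"
  then show "source Ver (comp_arr Hor s t) = comp_arr Xs (source Ver s) (source Ver t)"
    unfolding Hor_simps(1)
    by (elim S_E) (simp add: Hor_simps Ver_simps Xs_simps closed Hor_target_comp)
next
  fix s assume "s \<in> arrows Hor"
  then show "source Ver s \<in> arrows Xs \<and> target Xs (source Ver s) = source X (target Hor s) \<and>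
      source Xs (source Ver s) = source X (source Hor s)"
    unfolding Hor_simps(1) by (elim S_E) (simp add: Hor_simps Ver_simps X_simps Xs_simps closed conj2_closed)
qed (auto simp: Hor_simps Ver_simps X_simps Xs_simps closed conj2_closed)

lemma ident_Hor_morphism: "groupoid_morphism X Ver (ident Hor) (ident Xs)"
  by (rule groupoid_morphismI)
    (auto simp: Hor_simps Ver_simps X_simps Xs_simps closed conj2_one)

lemma ident_Ver_morphism: "groupoid_morphism Xs Hor (ident Ver) (ident X)"
  by (rule groupoid_morphismI)
    (auto simp: Hor_simps Ver_simps X_simps Xs_simps closed conj2_unit dp_one)

text \<open>The horizontal product multiplies the \<open>X\<^sup>*\<^sub>e\<close> components and the vertical product the \<open>X\<close> components,
  so they do not interfere.\<close>

lemma interchange: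
  assumes "s \<in> S" "t \<in> S" "s' \<in> S" "t' \<in> S" "source Hor s = target Hor t" "source Hor s' = target Hor t'"
    "source Ver s = target Ver s'" "source Ver t = target Ver t'"
  shows "comp_arr Hor (comp_arr Ver s s') (comp_arr Ver t t') = comp_arr Ver (comp_arr Hor s t) (comp_arr Hor s' t')"
  using assms by (elim S_E) (simp add: Hor_simps Ver_simps closed)

lemmas comp_Hor_morphism = comp_morphism_if_interchange[OF groupoid_Hor groupoid_Ver groupoid_Xs _ _
      source_Ver_morphism target_Ver_morphism ident_Ver_morphism]
  and comp_Ver_morphism = comp_morphism_if_interchange[OF groupoid_Ver groupoid_Hor groupoid_X _ _
      source_Hor_morphism target_Hor_morphism ident_Hor_morphism]
  and inv_Hor_morphism = inv_morphism_if_interchange[OF groupoid_Hor groupoid_Ver groupoid_Xs _ _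
      source_Ver_morphism target_Ver_morphism ident_Ver_morphism _
      source_Hor_morphism target_Hor_morphism ident_Hor_morphism]
  and inv_Ver_morphism = inv_morphism_if_interchange[OF groupoid_Ver groupoid_Hor groupoid_X _ _
      source_Hor_morphism target_Hor_morphism ident_Hor_morphism _
      source_Ver_morphism target_Ver_morphism ident_Ver_morphism]

end

section \<open>Smoothness of the structure maps\<close>

lemma smooth_fst_compose:
  assumes "charts M" "smooth_manifold A" "smooth_manifold B" "smooth_map M (prod_atlas A B) f"
  shows "smooth_map M A (\<lambda>m. fst (f m))"
  by (rule smooth_map_compose[OF assms(1) charts_prod_atlas assms(4) smooth_map_fst])
    (use assms manifold_charts in auto)

lemma smooth_snd_compose:
  assumes "charts M" "smooth_manifold A" "smooth_manifold B" "smooth_map M (prod_atlas A B) f"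
  shows "smooth_map M B (\<lambda>m. snd (f m))"
  by (rule smooth_map_compose[OF assms(1) charts_prod_atlas assms(4) smooth_map_snd])
    (use assms manifold_charts in auto)

lemma smooth_triple_compose:
  assumes M: "charts M" and A: "smooth_manifold A" and B: "smooth_manifold B" and C: "smooth_manifold C"
    and f: "smooth_map M (prod_atlas A (prod_atlas B C)) f"
  shows "smooth_map M A (\<lambda>m. fst (f m))" "smooth_map M B (\<lambda>m. fst (snd (f m)))"
    "smooth_map M C (\<lambda>m. snd (snd (f m)))"
proof -
  note BC = smooth_manifold_prod[OF B C]
  note fs = smooth_snd_compose[OF M A BC f]
  show "smooth_map M A (\<lambda>m. fst (f m))" "smooth_map M B (\<lambda>m. fst (snd (f m)))"
    "smooth_map M C (\<lambda>m. snd (snd (f m)))"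
    by (rule smooth_fst_compose[OF M A BC f] smooth_fst_compose[OF M B C fs] smooth_snd_compose[OF M B C fs])+
qed

context dressing
begin

abbreviation AX :: "(('w \<Rightarrow>\<^sub>L real) \<times> 'a \<times> ('w \<Rightarrow>\<^sub>L real), ('w \<Rightarrow>\<^sub>L real) \<times> 'v \<times> ('w \<Rightarrow>\<^sub>L real)) atlas" where
  "AX \<equiv> X_atlas G"
abbreviation AXs :: "('a \<times> ('w \<Rightarrow>\<^sub>L real) \<times> 'd, 'w \<times> ('w \<Rightarrow>\<^sub>L real) \<times> ('v \<Rightarrow>\<^sub>L real)) atlas" where
  "AXs \<equiv> Xs_atlas H Gs"
abbreviation AS where "AS \<equiv> S_atlas G H eh Gs Is dp dm"
abbreviation AP where "AP \<equiv> prod_atlas (atlas H) (prod_atlas (vec_atlas :: ('w \<Rightarrow>\<^sub>L real, 'w \<Rightarrow>\<^sub>L real) atlas)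
  (prod_atlas (atlas Gs) (prod_atlas (atlas H) (prod_atlas (atlas G) (vec_atlas :: ('w \<Rightarrow>\<^sub>L real, 'w \<Rightarrow>\<^sub>L real) atlas)))))"

lemmas manifolds = G.manifold H.manifold Gs.manifold smooth_manifold_vec smooth_manifold_prod

lemma S_coords_bij: "bij_betw S_coords S (points AP)"
proof -
  have "inj_on S_coords S" by (auto simp: inj_on_def S_coords_def S_def)
  moreover have "S_coords ` S = points AP"
  proof (intro subset_antisym subsetI)
    fix z assume "z \<in> S_coords ` S"
    then show "z \<in> points AP"
      by (auto simp: S_coords_def S_def points_prod_atlas G.points H.points Gs.points)
  next
    fix z assume z: "z \<in> points AP"
    obtain h p u k g q where e: "z = (h, p, u, k, g, q)" by (metis prod.exhaust)
    have "z = S_coords ((h, p, u, k), (p, g, q))" by (simp add: e S_coords_def)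
    moreover have "((h, p, u, k), (p, g, q)) \<in> S"
      using z by (simp add: e points_prod_atlas G.points H.points Gs.points)
    ultimately show "z \<in> S_coords ` S" by (rule image_eqI)
  qed
  ultimately show ?thesis by (simp add: bij_betw_def)
qed

lemma AS_eq: "AS = pullback_atlas S_coords S AP"
  by (simp add: S_atlas_def Hor_simps(1))

lemma manifold_AX: "smooth_manifold AX" and manifold_AXs: "smooth_manifold AXs" and manifold_AS: "smooth_manifold AS"
proof -
  show "smooth_manifold AX" unfolding X_atlas_def by (intro manifolds)
  show "smooth_manifold AXs" unfolding Xs_atlas_def by (intro manifolds)
  have "smooth_manifold AP" by (intro manifolds)
  then show "smooth_manifold AS" unfolding AS_eq by (rule smooth_manifold_pullback[OF _ S_coords_bij])
qed

lemma points_AX: "points AX = arrows X" and points_AXs: "points AXs = arrows Xs" and points_AS: "points AS = S"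
proof -
  show "points AX = arrows X" by (simp add: X_atlas_def points_prod_atlas X_simps G.points)
  show "points AXs = arrows Xs" by (simp add: Xs_atlas_def points_prod_atlas Xs_simps H.points Gs.points)
  show "points AS = S" unfolding AS_eq
    by (rule points_pullback_atlas) (use S_coords_bij in \<open>simp add: bij_betw_def\<close>)
qed

lemmas charts_atlases = manifold_charts[OF manifold_AX] manifold_charts[OF manifold_AXs]
  manifold_charts[OF manifold_AS] manifold_charts[OF smooth_manifold_prod[OF manifold_AX manifold_AX]]
  manifold_charts[OF smooth_manifold_prod[OF manifold_AXs manifold_AXs]]
  manifold_charts[OF smooth_manifold_prod[OF manifold_AS manifold_AS]] charts_vec_atlas

lemma AX_proj:
  assumes M: "charts M" and f: "smooth_map M AX f"
  shows "smooth_map M vec_atlas (\<lambda>m. fst (f m))" "smooth_map M (atlas G) (\<lambda>m. fst (snd (f m)))"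
    "smooth_map M vec_atlas (\<lambda>m. snd (snd (f m)))"
  by (rule smooth_triple_compose[OF M _ _ _ f[unfolded X_atlas_def]]; intro manifolds)+

lemma AXs_proj:
  assumes M: "charts M" and f: "smooth_map M AXs f"
  shows "smooth_map M (atlas H) (\<lambda>m. fst (f m))" "smooth_map M vec_atlas (\<lambda>m. fst (snd (f m)))"
    "smooth_map M (atlas Gs) (\<lambda>m. snd (snd (f m)))"
  by (rule smooth_triple_compose[OF M _ _ _ f[unfolded Xs_atlas_def]]; intro manifolds)+

abbreviation "hc x \<equiv> fst (fst x)" abbreviation "pc x \<equiv> fst (snd (fst x))"
abbreviation "uc x \<equiv> fst (snd (snd (fst x)))" abbreviation "kc x \<equiv> snd (snd (snd (fst x)))"
abbreviation "gc x \<equiv> fst (snd (snd x))" abbreviation "qc x \<equiv> snd (snd (snd x))"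

lemma AS_proj:
  assumes M: "charts M" and f: "smooth_map M AS f"
  shows "smooth_map M (atlas H) (\<lambda>m. hc (f m))" "smooth_map M vec_atlas (\<lambda>m. pc (f m))"
    "smooth_map M (atlas Gs) (\<lambda>m. uc (f m))"
    "smooth_map M (atlas H) (\<lambda>m. kc (f m))"
    "smooth_map M (atlas G) (\<lambda>m. gc (f m))" "smooth_map M vec_atlas (\<lambda>m. qc (f m))"
proof -
  have P: "smooth_manifold AP" by (intro manifolds)
  have c: "smooth_map AS AP S_coords" unfolding AS_eq
    by (rule smooth_map_pullback_coords[OF manifold_charts[OF P] _ _ smooth_map_id[OF P]])
      (use S_coords_bij in \<open>auto simp: bij_betw_def\<close>)
  have 0: "smooth_map M AP (\<lambda>m. S_coords (f m))"
    by (rule smooth_map_compose[OF M manifold_charts[OF manifold_AS] f c])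
  have e: "S_coords x = (hc x, pc x, uc x, kc x,
      gc x, qc x)" for x :: "('a \<times> ('w \<Rightarrow>\<^sub>L real) \<times> 'd \<times> 'a) \<times> ('w \<Rightarrow>\<^sub>L real) \<times> 'a \<times> ('w \<Rightarrow>\<^sub>L real)"
    by (simp add: S_coords_def split_beta)
  note 0 = 0[unfolded e]
  note 1 = smooth_snd_compose[OF M _ _ 0, unfolded fst_conv snd_conv]
  note 2 = smooth_snd_compose[OF M _ _ 1, unfolded fst_conv snd_conv]
  note 3 = smooth_snd_compose[OF M _ _ 2, unfolded fst_conv snd_conv]
  note 4 = smooth_snd_compose[OF M _ _ 3, unfolded fst_conv snd_conv]
  note fsts = smooth_fst_compose[OF M _ _ 0, unfolded fst_conv] smooth_fst_compose[OF M _ _ 1, unfolded fst_conv]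
    smooth_fst_compose[OF M _ _ 2, unfolded fst_conv] smooth_fst_compose[OF M _ _ 3, unfolded fst_conv]
    smooth_fst_compose[OF M _ _ 4, unfolded fst_conv] smooth_snd_compose[OF M _ _ 4, unfolded snd_conv]
  show "smooth_map M (atlas H) (\<lambda>m. hc (f m))" by (rule fsts(1)) (intro manifolds)+
  show "smooth_map M vec_atlas (\<lambda>m. pc (f m))" by (rule fsts(2)) (intro manifolds)+
  show "smooth_map M (atlas Gs) (\<lambda>m. uc (f m))" by (rule fsts(3)) (intro manifolds)+
  show "smooth_map M (atlas H) (\<lambda>m. kc (f m))" by (rule fsts(4)) (intro manifolds)+
  show "smooth_map M (atlas G) (\<lambda>m. gc (f m))" by (rule fsts(5)) (intro manifolds)+
  show "smooth_map M vec_atlas (\<lambda>m. qc (f m))" by (rule fsts(6)) (intro manifolds)+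
qed

lemma AX_into:
  "charts M \<Longrightarrow> smooth_map M vec_atlas f \<Longrightarrow> smooth_map M (atlas G) g \<Longrightarrow> smooth_map M vec_atlas k \<Longrightarrow>
    smooth_map M AX (\<lambda>m. (f m, g m, k m))"
  unfolding X_atlas_def by (intro smooth_map_Pair)

lemma AXs_into:
  "charts M \<Longrightarrow> smooth_map M (atlas H) f \<Longrightarrow> smooth_map M vec_atlas g \<Longrightarrow> smooth_map M (atlas Gs) k \<Longrightarrow>
    smooth_map M AXs (\<lambda>m. (f m, g m, k m))"
  unfolding Xs_atlas_def by (intro smooth_map_Pair)

text \<open>\<open>p\<close> occurs twice: \<open>S\<close> is given by the equality of these two coordinates, and \<^const>\<open>S_coords\<close> drops
  one of them.\<close>

lemma AS_into:
  assumes M: "charts M" and f: "smooth_map M (atlas H) h" "smooth_map M vec_atlas p" "smooth_map M (atlas Gs) u"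
    "smooth_map M (atlas H) k" "smooth_map M (atlas G) g" "smooth_map M vec_atlas q"
    and eq: "\<And>m. m \<in> points M \<Longrightarrow> F m = ((h m, p m, u m, k m), (p m, g m, q m))"
  shows "smooth_map M AS F"
proof -
  have "smooth_map M AS (\<lambda>m. ((h m, p m, u m, k m), (p m, g m, q m)))"
    unfolding AS_eq
  proof (rule smooth_map_into_pullback[OF M])
    show "(\<lambda>m. ((h m, p m, u m, k m), (p m, g m, q m))) ` points M \<subseteq> S"
      using f[THEN smooth_map_into] by (auto simp: G.points H.points Gs.points)
    show "S_coords ` S = points AP" using S_coords_bij by (simp add: bij_betw_def)
    show "smooth_map M AP (\<lambda>m. S_coords ((h m, p m, u m, k m), (p m, g m, q m)))"
      unfolding S_coords_def prod.case by (intro smooth_map_Pair M f)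
  qed
  then show ?thesis by (rule smooth_map_cong[OF M, rotated]) (simp add: eq)
qed

lemma smooth_ginv: "charts M \<Longrightarrow> smooth_map M (atlas H) f \<Longrightarrow> smooth_map M (atlas H) (\<lambda>m. ginv (f m))"
  by (rule smooth_map_cong[OF _ _ H.smooth_inv]) (auto dest!: smooth_map_into simp: H_inv H.points)

lemma smooth_Hmult: "charts M \<Longrightarrow> smooth_map M (atlas H) f \<Longrightarrow> smooth_map M (atlas H) g \<Longrightarrow>
    smooth_map M (atlas H) (\<lambda>m. f m \<odot> g m)"
  by (rule smooth_map_cong[OF _ _ H.smooth_mult[of M f g]]) (auto dest!: smooth_map_into simp: H_mult H.points)

lemma smooth_rho: "charts M \<Longrightarrow> smooth_map M (atlas H) f \<Longrightarrow> smooth_map M vec_atlas p \<Longrightarrow>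
    smooth_map M vec_atlas (\<lambda>m. rho (f m) (p m))"
  unfolding rho_def by (intro H.smooth_coAd smooth_ginv)

lemma smooth_conj2: "charts M \<Longrightarrow> smooth_map M (atlas H) f \<Longrightarrow> smooth_map M (atlas G) g \<Longrightarrow>
    smooth_map M (atlas H) k \<Longrightarrow> smooth_map M (atlas G) (\<lambda>m. conj2 (f m) (g m) (k m))"
  unfolding conj2_def by (intro G.smooth_mult G.smooth_inv smooth_H_in_G[of M f] smooth_H_in_G[of M k])

text \<open>Special cases of \<open>smooth_dp\<close> whose terms determine whether the first argument is to be shown
  smooth as a map to \<open>H\<close> or to \<open>G\<close>, so that they can be used for automatic introduction.\<close>

lemma smooth_dp_conj2: "charts M \<Longrightarrow> smooth_map M (atlas H) f \<Longrightarrow> smooth_map M (atlas G) g \<Longrightarrow>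
    smooth_map M (atlas H) k \<Longrightarrow> smooth_map M (atlas Gs) v \<Longrightarrow>
    smooth_map M (atlas Gs) (\<lambda>m. dp (conj2 (f m) (g m) (k m)) (v m))"
  by (intro smooth_dp smooth_conj2)

lemma smooth_dp_ginv: "charts M \<Longrightarrow> smooth_map M (atlas H) f \<Longrightarrow> smooth_map M (atlas Gs) v \<Longrightarrow>
    smooth_map M (atlas Gs) (\<lambda>m. dp (ginv (f m)) (v m))"
  by (intro smooth_dp smooth_H_in_G[OF _ smooth_ginv])

lemma smooth_dp_sinv: "charts M \<Longrightarrow> smooth_map M (atlas H) f \<Longrightarrow> smooth_map M (atlas Gs) v \<Longrightarrow>
    smooth_map M (atlas Gs) (\<lambda>m. dp (f m) (sinv (v m)))"
  by (intro smooth_dp smooth_H_in_G[of M f] Gs.smooth_inv)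

lemma smooth_constants: "charts M \<Longrightarrow> smooth_map M (atlas H) (\<lambda>_. \<one>\<^bsub>G\<^esub>)"
  "charts M \<Longrightarrow> smooth_map M (atlas G) (\<lambda>_. \<one>\<^bsub>G\<^esub>)" "charts M \<Longrightarrow> smooth_map M (atlas Gs) (\<lambda>_. \<one>\<^bsub>Gs\<^esub>)"
  by (auto intro: H.smooth_const G.smooth_const Gs.smooth_const closed)

lemmas smooth_intros = smooth_ginv smooth_Hmult smooth_rho smooth_conj2 smooth_dp_conj2 smooth_dp_ginv
  smooth_dp_sinv smooth_constants smooth_Is_compose smooth_map_add smooth_dm G.smooth_mult G.smooth_inv
  Gs.smooth_mult charts_atlases

lemma smooth_factors:
  "smooth_map AX AX (\<lambda>x. x)" "smooth_map AXs AXs (\<lambda>x. x)" "smooth_map AS AS (\<lambda>x. x)"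
  "smooth_map (prod_atlas AX AX) AX fst" "smooth_map (prod_atlas AX AX) AX snd"
  "smooth_map (prod_atlas AXs AXs) AXs fst" "smooth_map (prod_atlas AXs AXs) AXs snd"
  "smooth_map (prod_atlas AS AS) AS fst" "smooth_map (prod_atlas AS AS) AS snd"
  by (simp_all add: smooth_map_id smooth_map_fst smooth_map_snd manifold_AX manifold_AXs manifold_AS)

lemma smooth_vec_id: "smooth_map vec_atlas vec_atlas (\<lambda>x. x)"
  by (rule smooth_map_id[OF smooth_manifold_vec])

lemmas AX_id_proj = AX_proj[OF charts_atlases(1) smooth_factors(1)]
  and AXs_id_proj = AXs_proj[OF charts_atlases(2) smooth_factors(2)]
  and AS_id_proj = AS_proj[OF charts_atlases(3) smooth_factors(3)]
  and AX_pair_proj = AX_proj[OF charts_atlases(4) smooth_factors(4)] AX_proj[OF charts_atlases(4) smooth_factors(5)]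
  and AXs_pair_proj = AXs_proj[OF charts_atlases(5) smooth_factors(6)] AXs_proj[OF charts_atlases(5) smooth_factors(7)]
  and AS_pair_proj = AS_proj[OF charts_atlases(6) smooth_factors(8)] AS_proj[OF charts_atlases(6) smooth_factors(9)]

section \<open>The four Lie groupoids\<close>

lemma smooth_const_vec: "charts M \<Longrightarrow> smooth_map M vec_atlas (\<lambda>_. c)"
  by (rule smooth_map_const) auto

lemma lie_groupoid_X: "lie_groupoid X AX vec_atlas"
proof (rule lie_groupoidI[OF groupoid_X manifold_AX points_AX smooth_manifold_vec _ X_inverse])
  show "points vec_atlas = objects X" by (simp add: X_simps)
  show "smooth_map AX AX X_inv" unfolding X_inv_def case_prod_unfold
    by (intro AX_into smooth_intros AX_id_proj)
  have "sectioned AX vec_atlas (source X)"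
  proof (rule sectionedI[where s = "\<lambda>x b. (fst x, fst (snd x), b)"])
    show "smooth_map AX vec_atlas (source X)"
      unfolding X_groupoid_def groupoid.simps case_prod_unfold by (rule AX_id_proj)
    show "smooth_map vec_atlas AX (\<lambda>b. (fst x, fst (snd x), b))" if "x \<in> points AX" for x
      using that by (intro AX_into charts_vec_atlas smooth_const_vec G.smooth_const smooth_vec_id)
        (auto simp: points_AX X_simps)
  qed (auto simp: X_simps)
  then show "sectioned AX vec_atlas (source X) \<or> sectioned AX vec_atlas (target X)" ..
  show "smooth_map vec_atlas AX (ident X)"
    unfolding X_groupoid_def groupoid.simps by (intro AX_into smooth_intros smooth_vec_id)
  show "smooth_map (prod_atlas AX AX) AX (\<lambda>z. comp_arr X (fst z) (snd z))"
    unfolding X_groupoid_def groupoid.simps case_prod_unfold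
    by (intro AX_into smooth_intros AX_pair_proj)
qed

lemma lie_groupoid_Xs: "lie_groupoid Xs AXs vec_atlas"
proof (rule lie_groupoidI[OF groupoid_Xs manifold_AXs points_AXs smooth_manifold_vec _ Xs_inverse])
  show "points vec_atlas = objects Xs" by (simp add: Xs_simps)
  show "smooth_map AXs AXs Xs_inv" unfolding Xs_inv_def case_prod_unfold
    by (intro AXs_into smooth_intros AXs_id_proj)
  have "sectioned AXs vec_atlas (source Xs)"
  proof (rule sectionedI[where s = "\<lambda>x b. (fst x, b, snd (snd x))"])
    show "smooth_map AXs vec_atlas (source Xs)"
      unfolding Xs_groupoid_def groupoid.simps case_prod_unfold by (rule AXs_id_proj)
    show "smooth_map vec_atlas AXs (\<lambda>b. (fst x, b, snd (snd x)))" if "x \<in> points AXs" for x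
      using that by (intro AXs_into charts_vec_atlas H.smooth_const Gs.smooth_const smooth_vec_id)
        (auto simp: points_AXs Xs_simps)
  qed (auto simp: Xs_simps)
  then show "sectioned AXs vec_atlas (source Xs) \<or> sectioned AXs vec_atlas (target Xs)" ..
  have "smooth_map vec_atlas AXs (\<lambda>q. (\<one>\<^bsub>G\<^esub>, q, \<one>\<^bsub>Gs\<^esub>))"
    by (intro AXs_into smooth_intros smooth_vec_id)
  then show "smooth_map vec_atlas AXs (ident Xs)"
    by (rule smooth_map_cong[OF charts_vec_atlas, rotated]) (simp add: Xs_simps)
  have "smooth_map (prod_atlas AXs AXs) AXs (\<lambda>z. (fst (fst z) \<odot> fst (snd z), fst (snd (snd z)),
      snd (snd (fst z)) \<star> dp (ginv (fst (fst z))) (snd (snd (snd z)))))"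
    by (intro AXs_into smooth_intros AXs_pair_proj)
  then show "smooth_map (prod_atlas AXs AXs) AXs (\<lambda>z. comp_arr Xs (fst z) (snd z))"
    by (rule smooth_map_cong[OF charts_atlases(5), rotated])
      (auto simp: points_prod_atlas points_AXs Xs_simps)
qed

lemma lie_groupoid_Hor: "lie_groupoid Hor AS AX"
proof (rule lie_groupoidI[OF groupoid_Hor manifold_AS _ manifold_AX _ Hor_inverse])
  show "points AS = arrows Hor" by (simp add: points_AS Hor_simps)
  show "points AX = objects Hor" by (simp add: points_AX X_simps Hor_simps)
  show "smooth_map AS AS Hor_inv"
  proof (rule AS_into)
    fix s assume "s \<in> points AS"
    then show "Hor_inv s =
      ((ginv (hc s), rho (hc s) (pc s) + Is (uc s),
        dp (hc s) (sinv (uc s)), ginv (kc s)),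
       (rho (hc s) (pc s) + Is (uc s),
        dm (uc s) (conj2 (hc s) (gc s) (kc s)),
        rho (kc s) (qc s) +
          Is (dp (conj2 (hc s) (gc s) (kc s)) (uc s))))"
      unfolding points_AS by (elim S_E) (simp add: Hor_inv_def)
  qed (intro smooth_intros AS_id_proj)+
  \<comment> \<open>sections of the source keep \<open>h, u, k\<close> and let the element of \<open>X\<close> vary\<close>
  have "sectioned AS AX (source Hor)"
  proof (rule sectionedI[where s = "\<lambda>s x. ((hc s, fst x, uc s, kc s), x)"])
    show "smooth_map AS AX (source Hor)"
    proof (rule smooth_map_cong[OF charts_atlases(3)])
      show "smooth_map AS AX (\<lambda>s. (pc s, gc s, qc s))"
        by (intro AX_into charts_atlases AS_id_proj)
      show "(pc s, gc s, qc s) = source Hor s" if "s \<in> points AS" for s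
        using that unfolding points_AS by (elim S_E) (simp add: Hor_simps)
    qed
    show "smooth_map AX AS (\<lambda>x. ((hc s, fst x, uc s, kc s), x))" if s: "s \<in> points AS" for s
    proof (rule AS_into[where p = fst and g = "\<lambda>x. fst (snd x)" and q = "\<lambda>x. snd (snd x)"])
      show "smooth_map AX (atlas H) (\<lambda>_. hc s)" "smooth_map AX (atlas Gs) (\<lambda>_. uc s)"
        "smooth_map AX (atlas H) (\<lambda>_. kc s)"
        using s unfolding points_AS by (auto elim!: S_E intro: H.smooth_const Gs.smooth_const charts_atlases)
    qed (auto intro: charts_atlases AX_id_proj)
  qed (auto simp: points_AS Hor_simps elim!: S_E)
  then show "sectioned AS AX (source Hor) \<or> sectioned AS AX (target Hor)" ..
  show "smooth_map AX AS (ident Hor)"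
    by (rule AS_into[where p = fst and g = "\<lambda>x. fst (snd x)" and q = "\<lambda>x. snd (snd x)" and
          h = "\<lambda>_. \<one>\<^bsub>G\<^esub>" and k = "\<lambda>_. \<one>\<^bsub>G\<^esub>" and u = "\<lambda>_. \<one>\<^bsub>Gs\<^esub>"])
      (auto intro: smooth_intros AX_id_proj simp: Hor_simps)
  show "smooth_map (prod_atlas AS AS) AS (\<lambda>z. comp_arr Hor (fst z) (snd z))"
  proof (rule AS_into)
    fix z assume "z \<in> points (prod_atlas AS AS)"
    then have "fst z \<in> S" "snd z \<in> S" by (auto simp: points_prod_atlas points_AS)
    then show "comp_arr Hor (fst z) (snd z) =
      ((hc (fst z) \<odot> hc (snd z), pc (snd z),
        uc (fst z) \<star> dp (ginv (hc (fst z))) (uc (snd z)),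
        kc (fst z) \<odot> kc (snd z)),
       (pc (snd z), gc (snd z), qc (snd z)))"
      by (elim S_E) (simp add: Hor_simps)
  qed (intro smooth_intros AS_pair_proj)+
qed

lemma lie_groupoid_Ver: "lie_groupoid Ver AS AXs"
proof (rule lie_groupoidI[OF groupoid_Ver manifold_AS _ manifold_AXs _ Ver_inverse])
  show "points AS = arrows Ver" by (simp add: points_AS Ver_simps)
  show "points AXs = objects Ver" by (simp add: points_AXs Xs_simps Ver_simps)
  show "smooth_map AS AS Ver_inv"
  proof (rule AS_into)
    fix s assume "s \<in> points AS"
    then show "Ver_inv s =
      ((kc s, qc s,
        dp (conj2 (hc s) (gc s) (kc s)) (uc s),
        hc s),
       (qc s, ginv (gc s), pc s))"
      unfolding points_AS by (elim S_E) (simp add: Ver_inv_def)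
  qed (intro smooth_intros AS_id_proj)+
  \<comment> \<open>sections of the target keep \<open>k, g, q\<close> and let the element of \<open>X\<^sup>*\<close> vary\<close>
  have "sectioned AS AXs (target Ver)"
  proof (rule sectionedI[where s = "\<lambda>s x. ((fst x, fst (snd x), snd (snd x), kc s), (fst (snd x), gc s, qc s))"])
    show "smooth_map AS AXs (target Ver)"
    proof (rule smooth_map_cong[OF charts_atlases(3)])
      show "smooth_map AS AXs (\<lambda>s. (hc s, pc s, uc s))"
        by (intro AXs_into charts_atlases AS_id_proj)
      show "(hc s, pc s, uc s) = target Ver s" if "s \<in> points AS" for s
        using that unfolding points_AS by (elim S_E) (simp add: Ver_simps)
    qed
    show "smooth_map AXs AS (\<lambda>x. ((fst x, fst (snd x), snd (snd x), kc s), (fst (snd x), gc s, qc s)))"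
      if s: "s \<in> points AS" for s
    proof (rule AS_into[where h = fst and p = "\<lambda>x. fst (snd x)" and u = "\<lambda>x. snd (snd x)"])
      show "smooth_map AXs (atlas H) (\<lambda>_. kc s)" "smooth_map AXs (atlas G) (\<lambda>_. gc s)"
        using s unfolding points_AS by (auto elim!: S_E intro: H.smooth_const G.smooth_const charts_atlases)
      show "smooth_map AXs vec_atlas (\<lambda>_. qc s)" by (intro smooth_const_vec charts_atlases)
    qed (auto intro: charts_atlases AXs_id_proj)
  qed (auto simp: points_AS Ver_simps elim!: S_E)
  then show "sectioned AS AXs (source Ver) \<or> sectioned AS AXs (target Ver)" ..
  show "smooth_map AXs AS (ident Ver)"
  proof (rule AS_into)
    fix x assume "x \<in> points AXs"
    then show "ident Ver x = ((fst x, fst (snd x), snd (snd x), fst x), (fst (snd x), \<one>\<^bsub>G\<^esub>, fst (snd x)))"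
      by (auto simp: points_AXs Xs_simps Ver_simps)
  qed (intro smooth_intros AXs_id_proj)+
  show "smooth_map (prod_atlas AS AS) AS (\<lambda>z. comp_arr Ver (fst z) (snd z))"
  proof (rule AS_into)
    fix z assume "z \<in> points (prod_atlas AS AS)"
    then have "fst z \<in> S" "snd z \<in> S" by (auto simp: points_prod_atlas points_AS)
    then show "comp_arr Ver (fst z) (snd z) =
      ((hc (fst z), pc (fst z), uc (fst z), kc (snd z)),
       (pc (fst z), gc (fst z) \<odot> gc (snd z), qc (snd z)))"
      by (elim S_E) (simp add: Ver_simps)
  qed (intro smooth_intros AS_pair_proj)+
qed

lemma double_lie_groupoid: "double_lie_groupoid Hor Ver Xs X AS AXs AX vec_atlas"
  unfolding double_lie_groupoid_def
  by (intro conjI structure_maps_morphismsI lie_groupoid_Xs lie_groupoid_X lie_groupoid_Hor lie_groupoid_Ver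
      source_Hor_morphism target_Hor_morphism ident_Hor_morphism comp_Hor_morphism inv_Hor_morphism
      source_Ver_morphism target_Ver_morphism ident_Ver_morphism comp_Ver_morphism inv_Ver_morphism)
    (simp_all add: Hor_simps(1,2) Ver_simps(1,2) Xs_simps(1) X_simps(1) interchange)

lemma swap_bij: "bij_betw swap_factors (arrows Hor) (arrows (right_groupoid G H eh Gs Is dp))"
  using swap_inj by (simp add: bij_betw_def right_arrows Hor_simps(1))

end

theorem theorem5p2p10:
  fixes G :: "('a, 'v::finite_dim_normed) liegrp"
    and H :: "('a, 'w::finite_dim_normed) liegrp"
    and Gs :: "('d, 'v \<Rightarrow>\<^sub>L real) liegrp"
    and e :: "'v \<Rightarrow> 'a" and eh :: "'w \<Rightarrow> 'a" and es :: "('v \<Rightarrow>\<^sub>L real) \<Rightarrow> 'd"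
    and \<iota> :: "'w \<Rightarrow> 'v" and R :: "('v \<Rightarrow>\<^sub>L real) \<Rightarrow> 'v"
    and Ps :: "('d \<Rightarrow> real) \<Rightarrow> ('d \<Rightarrow> real) \<Rightarrow> 'd \<Rightarrow> real"
    and dp :: "'a \<Rightarrow> 'd \<Rightarrow> 'd" and dm :: "'d \<Rightarrow> 'a \<Rightarrow> 'a"
    and Is :: "'d \<Rightarrow> ('w \<Rightarrow>\<^sub>L real)"
  assumes G: "lie_group G" "connected_simply_connected G" "exponential G e"
    and H: "lie_subgroup H G" "connected_simply_connected H" "exponential H eh"
    and \<iota>: "linear \<iota>" "\<And>Z. e (\<iota> Z) = eh Z"
    and R: "linear R" "skew_map R"
    and kappa_invariant: "\<And>Y A B. ad G e Y (kappa G e R A B) +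
          kappa G e R (coad G e Y A) B + kappa G e R A (coad G e Y B) = 0"
    and R_invariant: "\<And>Z A. R (coad G e (\<iota> Z) A) + ad G e (\<iota> Z) (R A) = 0"
    and dual: "dual_poisson_lie_group G e R Gs es Ps"
    and dressing: "right_dressing_action G e Gs es Ps dp" "left_dressing_action G e R Gs es dm"
    and twist_plus: "\<And>x u v. x \<in> carrier G \<Longrightarrow> u \<in> carrier Gs \<Longrightarrow> v \<in> carrier Gs \<Longrightarrow>
          dp x (u \<otimes>\<^bsub>Gs\<^esub> v) = dp (dm v x) u \<otimes>\<^bsub>Gs\<^esub> dp x v"
    and twist_minus: "\<And>u x y. u \<in> carrier Gs \<Longrightarrow> x \<in> carrier G \<Longrightarrow> y \<in> carrier G \<Longrightarrow>
          dm u (x \<otimes>\<^bsub>G\<^esub> y) = dm u x \<otimes>\<^bsub>G\<^esub> dm (dp x u) y"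
    and H_fixed: "\<And>u h. u \<in> carrier Gs \<Longrightarrow> h \<in> carrier H \<Longrightarrow> dm u h = h"
    and Is_morphism: "smooth_map (atlas Gs) vec_atlas Is"
          "\<And>u v. u \<in> carrier Gs \<Longrightarrow> v \<in> carrier Gs \<Longrightarrow> Is (u \<otimes>\<^bsub>Gs\<^esub> v) = Is u + Is v"
    and Is_integrates: "\<And>A. Is (es A) = dual_map \<iota> A"
  shows "bij_betw swap_factors (arrows (horizontal_groupoid G H eh Gs Is dp dm))
           (arrows (right_groupoid G H eh Gs Is dp)) \<and>
         double_lie_groupoid (horizontal_groupoid G H eh Gs Is dp dm)
           (vertical_groupoid G H eh Gs Is dp dm)
           (Xs_groupoid H eh Gs Is dp) (X_groupoid G)
           (S_atlas G H eh Gs Is dp dm) (Xs_atlas H Gs) (X_atlas G) vec_atlas"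
proof -
  interpret dressing G e H eh Gs es \<iota> R Ps dp dm Is
  proof (intro dressing.intro lie_group_exp.intro dressing_axioms.intro)
    show "lie_group H" using H(1) by (simp add: lie_subgroup_def)
    show "lie_group Gs" using dual by (simp add: dual_poisson_lie_group_def poisson_lie_group_def)
    show "exponential Gs es" using dual by (simp add: dual_poisson_lie_group_def)
  qed (fact assms)+
  show ?thesis using swap_bij double_lie_groupoid ..
qed

end
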